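(* Let $K$ be a compact quantum subgroup of a compact quantum group $G=(\mathcal A,\Delta)$, let $K_u\subset H_u$ be the space of $K$-invariant vectors of $u\in\mathrm{Rep}(G)$, and let $\overline L$ be the spectral functor of the ergodic $G$-action on $K\backslash G$. For $\psi\in K_u$ let $T_\psi:H_u\to\mathcal A^\delta$ be $T_\psi(\phi)=\ell_\psi^*u(\phi)$, which lies in $L_u$. Then the map $$U_u:\psi\in K_u\mapsto\overline{T_\psi}\in\overline L_u$$ is a quasitensor natural transformation from the functor $u\mapsto K_u$ to the functor $u\mapsto\overline L_u$ such that $U_u$ is a unitary whenever $K_u\neq0$.
   Context: Compact quantum group (Woronowicz): $G=(\mathcal A,\Delta)$, $\mathcal A$ a unital $C^*$-algebra, $\Delta:\mathcal A\to\mathcal A\otimes\mathcal A$ a coassociative unital $^*$-homomorphism such that $\{(b\otimes I)\Delta(c)\}$ and $\{(I\otimes b)\Delta(c)\}$ each span dense subspaces. A unitary representation $u$ on a finite-dimensional $H_u$ is a linear map $u:H_u\to H_u\otimes\mathcal A$, $u(e_j)=\sum_i e_i\otimes u_{ij}$, with $(u_{ij})$ unitary and $\Delta(u_{ij})=\sum_k u_{ik}\otimes u_{kj}$; arrows $(u,v)$ in $\mathrm{Rep}(G)$ are linear $T:H_u\to H_v$ with $(T\otimes I)u=vT$; $u\otimes v$ acts on $H_u\otimes H_v$ with coefficients $u_{ij}v_{pq}$. $\ell_\psi:\mathcal A\to H_u\otimes\mathcal A$ is $a\mapsto\psi\otimes a$, so $\ell_\psi^*(\phi\otimes a)=(\psi,\phi)a$.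 A compact quantum subgroup is a compact quantum group $K=(\mathcal A',\Delta')$ with a surjective $^*$-homomorphism $\pi:\mathcal A\to\mathcal A'$, $(\pi\otimes\pi)\Delta=\Delta'\pi$. $K\backslash G$ is $\mathcal A^\delta=\{a:(\pi\otimes\iota)\Delta(a)=I\otimes a\}$ with the (nondegenerate ergodic) $G$-action $\eta_K=\Delta\restriction_{\mathcal A^\delta}:\mathcal A^\delta\to\mathcal A^\delta\otimes\mathcal A$. Invariant vectors functor: $K_u=\{k\in H_u:(\iota\otimes\pi)u(k)=k\otimes I\}$, $K_A=A\restriction_{K_u}$ for $A\in(u,v)$, with $K_u\otimes K_v\subset K_{u\otimes v}$. Spectral functor of $\eta_K$: $L_u$ is the space of linear $T:H_u\to\mathcal A^\delta$ with $\eta_KT=(T\otimes\iota)u$; $\overline L_u$ is its complex conjugate with inner product $(\overline S,\overline T)I=\sum_iS(e_i)T(e_i)^*$; $\overline L_A(\overline T)=\overline{T\circ A^*}$; $\overline L_u\otimes\overline L_v\to\overline L_{u\otimes v}$ is $\overline S\otimes\overline T\mapsto\overline{S\otimes T}$, $(S\otimes T)(\psi\otimes\phi)=S(\psi)T(\phi)$. Quasitensor natural transformation here means: natural, $U_\iota$ is the identity of $\mathbb C$, and $U_{u\otimes v}(\psi\otimes\psi')=\overline{T_\psi\otimes T_{\psi'}}$ (the image of $U_u(\psi)\otimes U_v(\psi')$) for $\psi\in K_u$, $\psi'\in K_v$. *)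

theory Defs
  imports
    "HOL-Analysis.Elementary_Topology"
    "HOL-Library.Extended_Nonnegative_Real"
    "HOL-Library.Nonpos_Ints"
    "HOL-Library.FuncSet"
    "Jordan_Normal_Form.Schur_Decomposition"
begin

section \<open>Unital C*-algebras\<close>

class cstar_algebra = real_normed_algebra_1 + banach +
  fixes scaleC :: "complex \<Rightarrow> 'a \<Rightarrow> 'a" (infixr \<open>*\<^sub>C\<close> 75)
    and star :: "'a \<Rightarrow> 'a"
  assumes scaleC_of_real: "scaleC (of_real r) x = r *\<^sub>R x"
    and scaleC_add_left: "scaleC (c + d) x = scaleC c x + scaleC d x"
    and scaleC_add_right: "scaleC c (x + y) = scaleC c x + scaleC c y"
    and scaleC_scaleC: "scaleC c (scaleC d x) = scaleC (c * d) x"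
    and scaleC_mult_left: "scaleC c x * y = scaleC c (x * y)"
    and scaleC_mult_right: "x * scaleC c y = scaleC c (x * y)"
    and norm_scaleC: "norm (scaleC c x) = cmod c * norm x"
    and star_star: "star (star x) = x"
    and star_add: "star (x + y) = star x + star y"
    and star_mult: "star (x * y) = star y * star x"
    and star_scaleC: "star (scaleC c x) = scaleC (cnj c) (star x)"
    and cstar_identity: "norm (star x * x) = (norm x)\<^sup>2"

abbreviation of_cplx :: "complex \<Rightarrow> 'a::cstar_algebra" where
  "of_cplx c \<equiv> c *\<^sub>C 1"

definition clinear_map :: "('a::cstar_algebra \<Rightarrow> 'b::cstar_algebra) \<Rightarrow> bool" where
  "clinear_map F \<longleftrightarrow> (\<forall>x y. F (x + y) = F x + F y) \<and> (\<forall>c x. F (c *\<^sub>C x) = c *\<^sub>C F x)"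

definition unital_star_hom :: "('a::cstar_algebra \<Rightarrow> 'b::cstar_algebra) \<Rightarrow> bool" where
  "unital_star_hom F \<longleftrightarrow> clinear_map F \<and> (\<forall>x y. F (x * y) = F x * F y) \<and>
     (\<forall>x. F (star x) = star (F x)) \<and> F 1 = 1"

definition state :: "('a::cstar_algebra \<Rightarrow> complex) \<Rightarrow> bool" where
  "state f \<longleftrightarrow> (\<forall>x y. f (x + y) = f x + f y) \<and> (\<forall>c x. f (c *\<^sub>C x) = c * f x) \<and>
     (\<forall>x. f (star x * x) \<in> \<real>\<^sub>\<ge>\<^sub>0) \<and> f 1 = 1"

section \<open>The minimal (spatial) C*-tensor product\<close>

text \<open>A list of pairs \<open>[(a\<^sub>1, b\<^sub>1), \<dots>]\<close> stands for the element \<open>a\<^sub>1 \<otimes> b\<^sub>1 + \<dots>\<close> of the algebraic tensor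
  product; \<open>alg_sum \<beta>\<close> is the value on it of the linear map induced by the bilinear map \<open>\<beta>\<close>.\<close>

definition alg_sum :: "('a \<Rightarrow> 'b \<Rightarrow> 'c::comm_monoid_add) \<Rightarrow> ('a \<times> 'b) list \<Rightarrow> 'c" where
  "alg_sum \<beta> xs = (\<Sum>(a, b)\<leftarrow>xs. \<beta> a b)"

definition alg_mult ::
  "('a::cstar_algebra \<times> 'b::cstar_algebra) list \<Rightarrow> ('a \<times> 'b) list \<Rightarrow> ('a \<times> 'b) list" where
  "alg_mult xs ys = [(fst x * fst y, snd x * snd y). x \<leftarrow> xs, y \<leftarrow> ys]"

definition alg_star :: "('a::cstar_algebra \<times> 'b::cstar_algebra) list \<Rightarrow> ('a \<times> 'b) list" where
  "alg_star xs = map (\<lambda>(a, b). (star a, star b)) xs"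

text \<open>The norm of \<open>x\<close> in the direct sum of the representations \<open>\<pi>\<^sub>f \<otimes> \<pi>\<^sub>g\<close>, with \<open>\<pi>\<^sub>f\<close>, \<open>\<pi>\<^sub>g\<close> the GNS
  representations of the states \<open>f\<close>, \<open>g\<close>: the classes of the \<open>y\<close> with \<open>(f \<otimes> g)(y\<^sup>*y) = 1\<close> are
  dense in the unit sphere of the Hilbert space of \<open>\<pi>\<^sub>f \<otimes> \<pi>\<^sub>g\<close>, and the image of such a vector
  under \<open>x\<close> has squared length \<open>(f \<otimes> g)(y\<^sup>*x\<^sup>*xy)\<close>. The supremum is taken in the complete lattice
  \<^typ>\<open>ennreal\<close>, so that it is meaningful without a proof of boundedness.\<close>

definition spatial_norm :: "('a::cstar_algebra \<times> 'b::cstar_algebra) list \<Rightarrow> ennreal" where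
  "spatial_norm xs = Sup {ennreal (sqrt (Re (alg_sum (\<lambda>a b. f a * g b)
       (alg_mult (alg_star ys) (alg_mult (alg_star xs) (alg_mult xs ys)))))) | f g ys.
     state f \<and> state g \<and> alg_sum (\<lambda>a b. f a * g b) (alg_mult (alg_star ys) ys) = 1}"

text \<open>\<open>min_tensor t\<close> says that the codomain of \<open>t\<close>, with \<open>t a b\<close> in the role of \<open>a \<otimes> b\<close>, is the
  minimal C*-tensor product: the algebraic tensor product sits in it faithfully and densely, as
  a unital *-algebra, with the spatial norm. This determines it up to a unique isomorphism. The real
  span of the elementary tensors is also their complex span.\<close>

definition min_tensor ::
  "('a::cstar_algebra \<Rightarrow> 'b::cstar_algebra \<Rightarrow> 'c::cstar_algebra) \<Rightarrow> bool" where
  "min_tensor t \<longleftrightarrow>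
     (\<forall>a. clinear_map (t a)) \<and> (\<forall>b. clinear_map (\<lambda>a. t a b)) \<and>
     (\<forall>a b a' b'. t a b * t a' b' = t (a * a') (b * b')) \<and>
     (\<forall>a b. star (t a b) = t (star a) (star b)) \<and>
     t 1 1 = 1 \<and>
     (\<forall>(n::nat) a b. (\<forall>c. (\<Sum>k<n. c k *\<^sub>C b k) = 0 \<longrightarrow> (\<forall>k<n. c k = 0)) \<longrightarrow>
        (\<Sum>k<n. t (a k) (b k)) = 0 \<longrightarrow> (\<forall>k<n. a k = 0)) \<and>
     closure (span (range (\<lambda>(a, b). t a b))) = UNIV \<and>
     (\<forall>xs. ennreal (norm (alg_sum t xs)) = spatial_norm xs)"

text \<open>\<open>F \<otimes> G\<close> on the completed tensor products, for *-homomorphisms \<open>F\<close> and \<open>G\<close>.\<close>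

definition tensor_map ::
  "('a::cstar_algebra \<Rightarrow> 'b::cstar_algebra \<Rightarrow> 'c::cstar_algebra) \<Rightarrow>
   ('d::cstar_algebra \<Rightarrow> 'e::cstar_algebra \<Rightarrow> 'f::cstar_algebra) \<Rightarrow>
   ('a \<Rightarrow> 'd) \<Rightarrow> ('b \<Rightarrow> 'e) \<Rightarrow> 'c \<Rightarrow> 'f" where
  "tensor_map t t' F G =
     (THE \<Phi>. bounded_linear \<Phi> \<and> (\<forall>a b. \<Phi> (t a b) = t' (F a) (G b)))"

section \<open>Compact quantum groups and subgroups\<close>

text \<open>\<open>t\<close> realises \<open>A \<otimes> A\<close>, while \<open>tl\<close> and \<open>tr\<close> realise \<open>(A \<otimes> A) \<otimes> A\<close> and \<open>A \<otimes> (A \<otimes> A)\<close>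
  on one algebra. The sets of products below are stable under complex scalars, so their real
  spans are their complex spans.\<close>

locale compact_quantum_group =
  fixes t :: "'a::cstar_algebra \<Rightarrow> 'a \<Rightarrow> 'aa::cstar_algebra"
    and tl :: "'aa \<Rightarrow> 'a \<Rightarrow> 'aaa::cstar_algebra"
    and tr :: "'a \<Rightarrow> 'aa \<Rightarrow> 'aaa"
    and \<Delta> :: "'a \<Rightarrow> 'aa"
  assumes tensor2: "min_tensor t"
    and tensor3_left: "min_tensor tl"
    and tensor3_right: "min_tensor tr"
    and tensor3_assoc: "tl (t a b) c = tr a (t b c)"
    and comult_hom: "unital_star_hom \<Delta>"
    and coassoc: "tensor_map t tl \<Delta> id (\<Delta> a) = tensor_map t tr id \<Delta> (\<Delta> a)"
    and dense_left: "closure (span {t b 1 * \<Delta> c | b c. True}) = UNIV"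
    and dense_right: "closure (span {t 1 b * \<Delta> c | b c. True}) = UNIV"

text \<open>\<open>t\<close>, \<open>t'\<close> and \<open>s\<close> realise \<open>A \<otimes> A\<close>, \<open>A' \<otimes> A'\<close> and \<open>A' \<otimes> A\<close>.\<close>

locale compact_quantum_subgroup =
  G: compact_quantum_group t tl tr \<Delta> + K: compact_quantum_group t' tl' tr' \<Delta>'
  for t :: "'a::cstar_algebra \<Rightarrow> 'a \<Rightarrow> 'aa::cstar_algebra"
    and tl :: "'aa \<Rightarrow> 'a \<Rightarrow> 'aaa::cstar_algebra"
    and tr :: "'a \<Rightarrow> 'aa \<Rightarrow> 'aaa"
    and \<Delta> :: "'a \<Rightarrow> 'aa"
    and t' :: "'b::cstar_algebra \<Rightarrow> 'b \<Rightarrow> 'bb::cstar_algebra"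
    and tl' :: "'bb \<Rightarrow> 'b \<Rightarrow> 'bbb::cstar_algebra"
    and tr' :: "'b \<Rightarrow> 'bb \<Rightarrow> 'bbb"
    and \<Delta>' :: "'b \<Rightarrow> 'bb" +
  fixes s :: "'b \<Rightarrow> 'a \<Rightarrow> 'ba::cstar_algebra"
    and \<pi> :: "'a \<Rightarrow> 'b"
  assumes tensor_mixed: "min_tensor s"
    and restriction_hom: "unital_star_hom \<pi>"
    and restriction_surj: "surj \<pi>"
    and restriction_comult: "tensor_map t t' \<pi> \<pi> (\<Delta> a) = \<Delta>' (\<pi> a)"

text \<open>\<open>A\<^sup>\<delta> = {a. (\<pi> \<otimes> \<iota>)\<Delta>(a) = I \<otimes> a}\<close>, the algebra of \<open>K\G\<close>; the action on it is
  the restriction of \<open>\<Delta>\<close>.\<close>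

definition quotient_space ::
  "('a::cstar_algebra \<Rightarrow> 'a \<Rightarrow> 'aa::cstar_algebra) \<Rightarrow> ('b::cstar_algebra \<Rightarrow> 'a \<Rightarrow> 'ba::cstar_algebra) \<Rightarrow>
   ('a \<Rightarrow> 'aa) \<Rightarrow> ('a \<Rightarrow> 'b) \<Rightarrow> 'a set" where
  "quotient_space t s \<Delta> \<pi> = {a. tensor_map t s \<pi> id (\<Delta> a) = s 1 a}"

section \<open>The category Rep(G)\<close>

text \<open>The space of a representation is \<open>\<complex>\<^sup>n = carrier_vec n\<close>, where \<open>n = dim_row u\<close>, with the
  standard basis as \<open>(e\<^sub>i)\<close> and the inner product \<open>(\<psi>, \<phi>) = \<phi> \<bullet>c \<psi>\<close>, linear in \<open>\<phi>\<close>. A representation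
  is given by its matrix \<open>(u\<^sub>i\<^sub>j)\<close> of coefficients, and \<open>\<complex>\<^sup>n \<otimes> A\<close> is the set of
  \<open>A\<close>-valued vectors of dimension \<open>n\<close>. The space \<open>\<complex>\<^sup>n \<otimes> \<complex>\<^sup>m\<close> is \<open>\<complex>\<^sup>n\<^sup>m\<close> with \<open>e\<^sub>i \<otimes> e\<^sub>p\<close>
  the basis vector of index \<open>i * m + p\<close>.\<close>

definition star_mat :: "'a::cstar_algebra mat \<Rightarrow> 'a mat" where
  "star_mat u = mat (dim_col u) (dim_row u) (\<lambda>(i, j). star (u $$ (j, i)))"

definition unitary_rep ::
  "('a::cstar_algebra \<Rightarrow> 'a \<Rightarrow> 'aa::cstar_algebra) \<Rightarrow> ('a \<Rightarrow> 'aa) \<Rightarrow> 'a mat \<Rightarrow> bool" where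
  "unitary_rep t \<Delta> u \<longleftrightarrow>
     dim_col u = dim_row u \<and>
     star_mat u * u = 1\<^sub>m (dim_row u) \<and> u * star_mat u = 1\<^sub>m (dim_row u) \<and>
     (\<forall>i<dim_row u. \<forall>j<dim_row u.
        \<Delta> (u $$ (i, j)) = (\<Sum>k<dim_row u. t (u $$ (i, k)) (u $$ (k, j))))"

text \<open>\<open>u(\<phi>) = (\<Sum>\<^sub>j u\<^sub>i\<^sub>j \<phi>\<^sub>j)\<^sub>i\<close>.\<close>

definition rep_apply :: "'a::cstar_algebra mat \<Rightarrow> complex vec \<Rightarrow> 'a vec" where
  "rep_apply u \<phi> = u *\<^sub>v map_vec of_cplx \<phi>"

text \<open>\<open>(T \<otimes> I)u = vT\<close>.\<close>

definition arrows :: "'a::cstar_algebra mat \<Rightarrow> 'a mat \<Rightarrow> complex mat set" where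
  "arrows u v = {T \<in> carrier_mat (dim_row v) (dim_row u).
     map_mat of_cplx T * u = v * map_mat of_cplx T}"

definition rep_tensor :: "'a::cstar_algebra mat \<Rightarrow> 'a mat \<Rightarrow> 'a mat" where
  "rep_tensor u v = (let m = dim_row v in
     mat (dim_row u * m) (dim_row u * m)
       (\<lambda>(k, l). u $$ (k div m, l div m) * v $$ (k mod m, l mod m)))"

definition trivial_rep :: "'a::cstar_algebra mat" where
  "trivial_rep = 1\<^sub>m 1"

definition vec_tensor :: "complex vec \<Rightarrow> complex vec \<Rightarrow> complex vec" where
  "vec_tensor \<psi> \<phi> = (let m = dim_vec \<phi> in
     vec (dim_vec \<psi> * m) (\<lambda>k. \<psi> $ (k div m) * \<phi> $ (k mod m)))"

text \<open>\<open>\<ell>\<^sub>\<psi>\<^sup>*\<close>, determined by \<open>\<ell>\<^sub>\<psi>\<^sup>*(\<phi> \<otimes> a) = (\<psi>, \<phi>)a\<close>.\<close>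

definition ell_adj :: "complex vec \<Rightarrow> 'a::cstar_algebra vec \<Rightarrow> 'a" where
  "ell_adj \<psi> x = (\<Sum>i<dim_vec x. cnj (\<psi> $ i) *\<^sub>C (x $ i))"

section \<open>Functors to Hilbert spaces\<close>

record 'v hilb =
  carr :: "'v set"
  plus_h :: "'v \<Rightarrow> 'v \<Rightarrow> 'v"
  scale_h :: "complex \<Rightarrow> 'v \<Rightarrow> 'v"
  inner_h :: "'v \<Rightarrow> 'v \<Rightarrow> complex"

definition linear_h :: "'v hilb \<Rightarrow> 'w hilb \<Rightarrow> ('v \<Rightarrow> 'w) \<Rightarrow> bool" where
  "linear_h H H' U \<longleftrightarrow> (\<forall>x\<in>carr H. U x \<in> carr H') \<and>
     (\<forall>x\<in>carr H. \<forall>y\<in>carr H. U (plus_h H x y) = plus_h H' (U x) (U y)) \<and>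
     (\<forall>c. \<forall>x\<in>carr H. U (scale_h H c x) = scale_h H' c (U x))"

definition unitary_h :: "'v hilb \<Rightarrow> 'w hilb \<Rightarrow> ('v \<Rightarrow> 'w) \<Rightarrow> bool" where
  "unitary_h H H' U \<longleftrightarrow> linear_h H H' U \<and> bij_betw U (carr H) (carr H') \<and>
     (\<forall>x\<in>carr H. \<forall>y\<in>carr H. inner_h H' (U x) (U y) = inner_h H x y)"

text \<open>The data of a quasitensor functor \<open>F\<close> on Rep(G): its values on objects and, for
  \<open>A \<in> (u, v)\<close>, on arrows, the maps \<open>F\<^sub>u \<otimes> F\<^sub>v \<rightarrow> F\<^sub>u\<^sub>\<otimes>\<^sub>v\<close>, and the vector \<open>one_f\<close> of \<open>F\<^sub>\<iota>\<close> which is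
  \<open>1\<close> under the identification \<open>F\<^sub>\<iota> = \<complex>\<close>.\<close>

record ('a, 'v) hilb_functor =
  obj_f :: "'a mat \<Rightarrow> 'v hilb"
  arr_f :: "'a mat \<Rightarrow> 'a mat \<Rightarrow> complex mat \<Rightarrow> 'v \<Rightarrow> 'v"
  tensor_f :: "'a mat \<Rightarrow> 'a mat \<Rightarrow> 'v \<Rightarrow> 'v \<Rightarrow> 'v"
  one_f :: 'v

definition quasitensor_nat_trans ::
  "('a::cstar_algebra \<Rightarrow> 'a \<Rightarrow> 'aa::cstar_algebra) \<Rightarrow> ('a \<Rightarrow> 'aa) \<Rightarrow>
   ('a, 'v) hilb_functor \<Rightarrow> ('a, 'w) hilb_functor \<Rightarrow> ('a mat \<Rightarrow> 'v \<Rightarrow> 'w) \<Rightarrow> bool" where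
  "quasitensor_nat_trans t \<Delta> F F' U \<longleftrightarrow>
     (\<forall>u. unitary_rep t \<Delta> u \<longrightarrow> linear_h (obj_f F u) (obj_f F' u) (U u)) \<and>
     (\<forall>u v. unitary_rep t \<Delta> u \<and> unitary_rep t \<Delta> v \<longrightarrow>
        (\<forall>A\<in>arrows u v. \<forall>x\<in>carr (obj_f F u). U v (arr_f F u v A x) = arr_f F' u v A (U u x))) \<and>
     (\<forall>c. U trivial_rep (scale_h (obj_f F trivial_rep) c (one_f F)) =
        scale_h (obj_f F' trivial_rep) c (one_f F')) \<and>
     (\<forall>u v. unitary_rep t \<Delta> u \<and> unitary_rep t \<Delta> v \<longrightarrow>
        (\<forall>x\<in>carr (obj_f F u). \<forall>y\<in>carr (obj_f F v).
          U (rep_tensor u v) (tensor_f F u v x y) = tensor_f F' u v (U u x) (U v y)))"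

subsection \<open>Invariant vectors\<close>

definition invariant_vectors ::
  "('a::cstar_algebra \<Rightarrow> 'b::cstar_algebra) \<Rightarrow> 'a mat \<Rightarrow> complex vec set" where
  "invariant_vectors \<pi> u =
     {k \<in> carrier_vec (dim_row u). map_vec \<pi> (rep_apply u k) = map_vec of_cplx k}"

definition invariant_functor ::
  "('a::cstar_algebra \<Rightarrow> 'b::cstar_algebra) \<Rightarrow> ('a, complex vec) hilb_functor" where
  "invariant_functor \<pi> =
     \<lparr>obj_f = (\<lambda>u. \<lparr>carr = invariant_vectors \<pi> u, plus_h = (+), scale_h = (\<cdot>\<^sub>v),
                    inner_h = (\<lambda>\<psi> \<phi>. \<phi> \<bullet>c \<psi>)\<rparr>),
      arr_f = (\<lambda>u v A \<psi>. A *\<^sub>v \<psi>),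
      tensor_f = (\<lambda>u v. vec_tensor),
      one_f = unit_vec 1 0\<rparr>"

subsection \<open>The spectral functor of an action\<close>

text \<open>For an action \<open>\<eta>\<close> of \<open>G\<close> on a subalgebra \<open>B\<close> of \<open>A\<close>, where \<open>B \<otimes> A \<subseteq> A \<otimes> A\<close>. For linear
  \<open>T : \<complex>\<^sup>n \<rightarrow> A\<close>, \<open>(T \<otimes> \<iota>)(\<phi> \<otimes> a) = T(\<phi>) \<otimes> a\<close>.\<close>

definition tensor_id ::
  "('a::cstar_algebra \<Rightarrow> 'a \<Rightarrow> 'aa::cstar_algebra) \<Rightarrow> (complex vec \<Rightarrow> 'a) \<Rightarrow> 'a vec \<Rightarrow> 'aa" where
  "tensor_id t T x = (\<Sum>i<dim_vec x. t (T (unit_vec (dim_vec x) i)) (x $ i))"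

text \<open>Maps on \<open>\<complex>\<^sup>n\<close> are extensional: they are \<open>undefined\<close> outside \<open>carrier_vec n\<close>.\<close>

definition spectral_space ::
  "('a::cstar_algebra \<Rightarrow> 'a \<Rightarrow> 'aa::cstar_algebra) \<Rightarrow> 'a set \<Rightarrow> ('a \<Rightarrow> 'aa) \<Rightarrow>
   'a mat \<Rightarrow> (complex vec \<Rightarrow> 'a) set" where
  "spectral_space t B \<eta> u = {T \<in> carrier_vec (dim_row u) \<rightarrow>\<^sub>E B.
     (\<forall>\<phi>\<in>carrier_vec (dim_row u). \<forall>\<phi>'\<in>carrier_vec (dim_row u). T (\<phi> + \<phi>') = T \<phi> + T \<phi>') \<and>
     (\<forall>c. \<forall>\<phi>\<in>carrier_vec (dim_row u). T (c \<cdot>\<^sub>v \<phi>) = c *\<^sub>C T \<phi>) \<and>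
     (\<forall>\<phi>\<in>carrier_vec (dim_row u). \<eta> (T \<phi>) = tensor_id t T (rep_apply u \<phi>))}"

text \<open>The complex conjugate of \<open>L\<^sub>u\<close>: an element \<open>T\<close> of the carrier stands for \<open>T\<close> overlined, so
  a scalar \<open>c\<close> acts as \<open>cnj c\<close> does on \<open>L\<^sub>u\<close>. The inner product of \<open>S\<close> and \<open>T\<close> is the scalar \<open>c\<close> with
  \<open>cI = \<Sum>\<^sub>i S(e\<^sub>i)T(e\<^sub>i)\<^sup>*\<close>, which exists because the action is ergodic.\<close>

definition conj_spectral_hilb ::
  "('a::cstar_algebra \<Rightarrow> 'a \<Rightarrow> 'aa::cstar_algebra) \<Rightarrow> 'a set \<Rightarrow> ('a \<Rightarrow> 'aa) \<Rightarrow>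
   'a mat \<Rightarrow> (complex vec \<Rightarrow> 'a) hilb" where
  "conj_spectral_hilb t B \<eta> u = (let n = dim_row u in
     \<lparr>carr = spectral_space t B \<eta> u,
      plus_h = (\<lambda>S T. \<lambda>\<phi>\<in>carrier_vec n. S \<phi> + T \<phi>),
      scale_h = (\<lambda>c T. \<lambda>\<phi>\<in>carrier_vec n. cnj c *\<^sub>C T \<phi>),
      inner_h = (\<lambda>S T. THE c. of_cplx c = (\<Sum>i<n. S (unit_vec n i) * star (T (unit_vec n i))))\<rparr>)"

text \<open>\<open>map_tensor n m S T\<close> is the linear map \<open>\<complex>\<^sup>n \<otimes> \<complex>\<^sup>m \<rightarrow> A\<close> with \<open>\<psi> \<otimes> \<phi> \<mapsto> S(\<psi>)T(\<phi>)\<close>.\<close>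

definition map_tensor ::
  "nat \<Rightarrow> nat \<Rightarrow> (complex vec \<Rightarrow> 'a::cstar_algebra) \<Rightarrow> (complex vec \<Rightarrow> 'a) \<Rightarrow> complex vec \<Rightarrow> 'a" where
  "map_tensor n m S T = (\<lambda>\<zeta>\<in>carrier_vec (n * m).
     \<Sum>i<n. \<Sum>p<m. (\<zeta> $ (i * m + p)) *\<^sub>C (S (unit_vec n i) * T (unit_vec m p)))"

text \<open>The identification of \<open>\<complex>\<close> with the value at the trivial representation sends \<open>1\<close> to the
  conjugate of \<open>\<phi> \<mapsto> \<phi>I\<close>.\<close>

definition spectral_functor ::
  "('a::cstar_algebra \<Rightarrow> 'a \<Rightarrow> 'aa::cstar_algebra) \<Rightarrow> 'a set \<Rightarrow> ('a \<Rightarrow> 'aa) \<Rightarrow>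
   ('a, complex vec \<Rightarrow> 'a) hilb_functor" where
  "spectral_functor t B \<eta> =
     \<lparr>obj_f = conj_spectral_hilb t B \<eta>,
      arr_f = (\<lambda>u v A T. \<lambda>\<phi>\<in>carrier_vec (dim_row v). T (mat_adjoint A *\<^sub>v \<phi>)),
      tensor_f = (\<lambda>u v. map_tensor (dim_row u) (dim_row v)),
      one_f = (\<lambda>\<phi>\<in>carrier_vec 1. of_cplx (\<phi> $ 0))\<rparr>"

subsection \<open>The comparison map\<close>

definition T_map :: "'a::cstar_algebra mat \<Rightarrow> complex vec \<Rightarrow> complex vec \<Rightarrow> 'a" where
  "T_map u \<psi> = (\<lambda>\<phi>\<in>carrier_vec (dim_row u). ell_adj \<psi> (rep_apply u \<phi>))"

end

theory Submission
  imports Defs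
    "HOL-Analysis.Elementary_Metric_Spaces"
    "HOL-Computational_Algebra.Formal_Power_Series"
begin

text \<open>Only the surjectivity of \<open>\<psi> \<mapsto> T\<^sub>\<psi>\<close> is not a computation with coefficients. For \<open>T \<in> L\<^sub>u\<close> put
  \<open>a\<^sub>j = T e\<^sub>j\<close>, so that \<open>\<Delta> a\<^sub>j = \<Sum>\<^sub>k a\<^sub>k \<otimes> u\<^sub>k\<^sub>j\<close>. By unitarity \<open>b\<^sub>k = \<Sum>\<^sub>j a\<^sub>j u\<^sub>k\<^sub>j\<^sup>*\<close> satisfies \<open>\<Delta> b\<^sub>k = b\<^sub>k \<otimes> 1\<close>,
  and such an element is a scalar \<open>c\<^sub>k\<close>; hence \<open>a\<^sub>j = \<Sum>\<^sub>k c\<^sub>k u\<^sub>k\<^sub>j\<close>, and \<open>a\<^sub>j \<in> A\<^sup>\<delta>\<close> makes \<open>\<psi> = (cnj c\<^sub>k)\<^sub>k\<close> invariant.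

  That \<open>\<Delta> x = x \<otimes> 1\<close> forces \<open>x\<close> to be a scalar amounts to \<open>\<phi> x = \<phi>' x\<close> for all states. Let \<open>h\<^sub>n\<close> be the
  Cesaro means of the convolution powers of \<open>\<omega> = (\<phi> + \<phi>') / 2\<close>; they are nearly \<open>\<omega>\<close>-invariant, and as
  \<open>\<phi> \<le> 2\<omega>\<close>, Van Daele's argument shows that they are nearly \<open>\<phi>\<close>-invariant. Since \<open>h\<^sub>n x = \<omega> x\<close> and
  \<open>(\<phi> * h\<^sub>n) x = \<phi> x\<close>, it follows that \<open>\<phi> x = \<omega> x\<close>.\<close>

section \<open>Unital C*-algebras\<close>

text \<open>Everything about states is drawn from the C*-identity and from the spatial norm.
  Positivity gives boundedness because 1 - w has a self-adjoint square root for norm w < 1. States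
  separate points because a \<mapsto> a \<otimes> 1 is faithful and the norm of a \<otimes> 1 is a
  supremum over pairs of states. The functional f \<otimes> g is positive on formal sums by Schur's
  theorem on entrywise products of Gram matrices, and only once F \<otimes> G is known to be
  contractive does \<open>tensor_map\<close>, a definite description, denote the map that
  coassociativity and A\<delta> speak of.

  Stopping at a Cesaro mean h leaves an invariance error of order 1/n, and this error has to pass
  through the whole argument. The slice (id \<otimes> h)(\<Delta> a) is not formed in the
  completion: \<Delta> a is replaced by a formal sum X, with an error of the same order, whose slice
  b is a finite combination. The size of b enters only through the values f (star b * b) for states
  f, all bounded by the squared norm of X.\<close>

lemma scaleC_zero_left [simp]: "0 *\<^sub>C (x::'a::cstar_algebra) = 0"
  using scaleC_add_left[of 0 0 x] by simp

lemma scaleC_zero_right [simp]: "c *\<^sub>C (0::'a::cstar_algebra) = 0"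
  using scaleC_add_right[of c 0 0] by simp

lemma scaleC_one [simp]: "1 *\<^sub>C (x::'a::cstar_algebra) = x"
  using scaleC_of_real[of 1 x] by simp

lemma scaleC_minus_left: "(- c) *\<^sub>C (x::'a::cstar_algebra) = - (c *\<^sub>C x)"
  using scaleC_add_left[of c "-c" x] by (simp add: eq_neg_iff_add_eq_0 add.commute)

lemma scaleC_diff_left: "(c - d) *\<^sub>C (x::'a::cstar_algebra) = c *\<^sub>C x - d *\<^sub>C x"
  using scaleC_add_left[of c "-d" x] by (simp add: scaleC_minus_left)

lemma scaleC_minus_one [simp]: "(- 1) *\<^sub>C (x::'a::cstar_algebra) = - x"
  by (simp add: scaleC_minus_left)

lemma scaleR_eq_scaleC: "r *\<^sub>R (x::'a::cstar_algebra) = of_real r *\<^sub>C x"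
  by (simp add: scaleC_of_real)

lemma scaleC_sum_right: "c *\<^sub>C (\<Sum>i\<in>I. f i) = (\<Sum>i\<in>I. c *\<^sub>C (f i :: 'a::cstar_algebra))"
  by (induction I rule: infinite_finite_induct) (auto simp: scaleC_add_right)

lemma scaleC_sum_left: "(\<Sum>i\<in>I. c i) *\<^sub>C (x :: 'a::cstar_algebra) = (\<Sum>i\<in>I. c i *\<^sub>C x)"
  by (induction I rule: infinite_finite_induct) (auto simp: scaleC_add_left)

lemma of_cplx_eq_iff: "(of_cplx c :: 'a::cstar_algebra) = of_cplx d \<longleftrightarrow> c = d"
proof
  assume "(of_cplx c :: 'a) = of_cplx d"
  then have "norm ((c - d) *\<^sub>C (1::'a)) = 0"
    by (simp add: scaleC_diff_left)
  then have "cmod (c - d) = 0" unfolding norm_scaleC by simp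
  then show "c = d" by simp
qed simp

lemma star_zero [simp]: "star (0::'a::cstar_algebra) = 0"
  using star_add[of "0::'a" 0] by simp

lemma star_minus: "star (- (x::'a::cstar_algebra)) = - star x"
  using star_add[of x "-x"] by (simp add: eq_neg_iff_add_eq_0 add.commute)

lemma star_diff: "star (x - (y::'a::cstar_algebra)) = star x - star y"
  using star_add[of x "-y"] by (simp add: star_minus)

lemma star_one [simp]: "star (1::'a::cstar_algebra) = 1"
  using star_mult[of "star (1::'a)" 1] by (simp add: star_star)

lemma star_sum: "star (\<Sum>i\<in>I. f i) = (\<Sum>i\<in>I. star (f i :: 'a::cstar_algebra))"
  by (induction I rule: infinite_finite_induct) (auto simp: star_add)

lemma norm_star [simp]: "norm (star (x::'a::cstar_algebra)) = norm x"
proof -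
  have le: "norm y \<le> norm (star y)" for y :: 'a
  proof (cases "y = 0")
    case False
    have "(norm y)\<^sup>2 \<le> norm (star y) * norm y"
      using norm_mult_ineq[of "star y" y] by (simp add: cstar_identity)
    with False show ?thesis by (simp add: power2_eq_square)
  qed simp
  from le[of x] le[of "star x"] show ?thesis by (simp add: star_star)
qed

lemma bounded_linear_star: "bounded_linear (star :: 'a::cstar_algebra \<Rightarrow> 'a)"
  by (rule bounded_linear_intro[of _ 1])
    (auto simp: star_add scaleR_eq_scaleC star_scaleC)

lemma bounded_linear_scaleC: "bounded_linear (\<lambda>x::'a::cstar_algebra. c *\<^sub>C x)"
  by (rule bounded_linear_intro[of _ "cmod c"])
    (auto simp: scaleC_add_right scaleR_eq_scaleC scaleC_scaleC norm_scaleC mult.commute)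

text \<open>The coefficients are those of the binomial series of \<open>(1 - w)\<^bsup>1/2\<^esup>\<close>; their squares convolve
  to those of \<open>1 - w\<close> by Vandermonde's identity.\<close>

lemma self_adjoint_sqrt_one_minus:
  fixes w :: "'a::cstar_algebra"
  assumes sa: "star w = w" and w: "norm w < 1"
  shows "\<exists>r. star r = r \<and> r * r = 1 - w"
proof -
  define c where "c n = (- 1) ^ n * ((1/2 :: real) gchoose n)" for n
  \<comment> \<open>Consecutive coefficients have ratio (1/2 - n) / (n + 1), of modulus at most 1,
    so all are bounded by the zeroth one and the series is dominated by the geometric series of norm
    w.\<close>
  have c_bd: "\<bar>(1/2 :: real) gchoose n\<bar> \<le> 1" for n
  proof (induction n)
    case (Suc n)
    have "(1/2 gchoose Suc n) = (1/2 gchoose n) * ((1/2 - real n) / real (Suc n))"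
      using gbinomial_absorb_comp[of "1/2::real" n] gbinomial_mult_1[of "1/2::real" n]
      by (simp add: field_simps)
    moreover have "\<bar>(1/2 - real n) / real (Suc n)\<bar> \<le> 1"
      by (simp add: abs_le_iff field_simps)
    ultimately show ?case using Suc
      by (simp only: abs_mult mult_le_one abs_ge_zero)
  qed simp
  have sm: "summable (\<lambda>n. norm (c n *\<^sub>R w ^ n))"
  proof (rule summable_comparison_test[OF _ summable_geometric[of "norm w"]])
    have "norm (c n *\<^sub>R w ^ n) \<le> 1 * norm w ^ n" for n
      unfolding norm_scaleR
      using c_bd[of n] by (intro mult_mono norm_power_ineq) (auto simp: c_def abs_mult)
    then show "\<exists>N. \<forall>n\<ge>N. norm (norm (c n *\<^sub>R w ^ n)) \<le> norm w ^ n" by simp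
  qed (use w in simp)
  define r where "r = (\<Sum>n. c n *\<^sub>R w ^ n)"
  have star_pow: "star (w ^ n) = w ^ n" for n
    by (induction n) (auto simp: star_mult sa power_commutes)
  have "star r = (\<Sum>n. star (c n *\<^sub>R w ^ n))"
    unfolding r_def
    by (rule bounded_linear.suminf[OF bounded_linear_star summable_norm_cancel[OF sm]])
  then have "star r = r"
    by (simp add: r_def star_pow scaleR_eq_scaleC star_scaleC)
  moreover have "r * r = 1 - w"
  proof -
    have "r * r = (\<Sum>k. \<Sum>i\<le>k. (c i *\<^sub>R w ^ i) * (c (k - i) *\<^sub>R w ^ (k - i)))"
      unfolding r_def by (rule Cauchy_product[OF sm sm])
    also have "\<dots> = (\<Sum>k. ((- 1) ^ k * ((1::real) gchoose k)) *\<^sub>R w ^ k)"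
    proof (rule suminf_cong)
      fix k
      have "(\<Sum>i\<le>k. (c i *\<^sub>R w ^ i) * (c (k - i) *\<^sub>R w ^ (k - i))) =
          (\<Sum>i\<le>k. (c i * c (k - i)) *\<^sub>R w ^ k)"
        by (rule sum.cong) (auto simp: power_add[symmetric])
      also have "\<dots> = (\<Sum>i\<le>k. c i * c (k - i)) *\<^sub>R w ^ k"
        by (simp add: scaleR_sum_left)
      also have "(\<Sum>i\<le>k. c i * c (k - i)) =
          (- 1) ^ k * (\<Sum>i\<le>k. (1/2 gchoose i) * (1/2 gchoose (k - i)))"
        unfolding c_def sum_distrib_left
        by (rule sum.cong) (auto simp: power_add[symmetric] mult_ac)
      also have "(\<Sum>i\<le>k. ((1/2::real) gchoose i) * (1/2 gchoose (k - i))) = (1 gchoose k)"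
        using gbinomial_Vandermonde[of "1/2::real" "1/2" k] by (simp add: atLeast0AtMost)
      finally show "(\<Sum>i\<le>k. (c i *\<^sub>R w ^ i) * (c (k - i) *\<^sub>R w ^ (k - i))) =
          ((- 1) ^ k * ((1::real) gchoose k)) *\<^sub>R w ^ k" .
    qed
    \<comment> \<open>The coefficients vanish from k = 2 on; the terms 1 and - w survive.\<close>
    also have "\<dots> = (\<Sum>k<2. ((- 1) ^ k * ((1::real) gchoose k)) *\<^sub>R w ^ k)"
    proof (rule suminf_finite)
      fix k assume "k \<notin> {..<2::nat}"
      then have "1 choose k = 0" by (intro binomial_eq_0) simp
      then have "(1 :: real) gchoose k = 0"
        using binomial_gbinomial[of 1 k, where 'a = real] by (simp only: of_nat_1 of_nat_0)
      then show "((- 1) ^ k * ((1::real) gchoose k)) *\<^sub>R w ^ k = 0" by simp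
    qed simp
    also have "\<dots> = 1 - w" by (simp add: numeral_2_eq_2)
    finally show ?thesis .
  qed
  ultimately show ?thesis by blast
qed

section \<open>Positive functionals\<close>

definition clinear_functional :: "('a::cstar_algebra \<Rightarrow> complex) \<Rightarrow> bool" where
  "clinear_functional f \<longleftrightarrow> (\<forall>x y. f (x + y) = f x + f y) \<and> (\<forall>c x. f (c *\<^sub>C x) = c * f x)"

lemma clinear_functional_simps:
  assumes "clinear_functional f"
  shows "f (x + y) = f x + f y" "f (c *\<^sub>C x) = c * f x" "f (- x) = - f x" "f (x - y) = f x - f y"
    "f 0 = 0" "f (r *\<^sub>R x) = of_real r * f x" "f (sum g I) = (\<Sum>i\<in>I. f (g i))"
proof -
  show add: "f (x + y) = f x + f y" and sc: "f (c *\<^sub>C x) = c * f x" for x y c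
    using assms by (auto simp: clinear_functional_def)
  show z: "f 0 = 0" using sc[of 0 0] by simp
  show m: "f (- x) = - f x" for x using sc[of "-1" x] by simp
  show "f (x - y) = f x - f y" using add[of x "-y"] m by simp
  show "f (r *\<^sub>R x) = of_real r * f x" by (simp add: scaleR_eq_scaleC sc)
  show "f (sum g I) = (\<Sum>i\<in>I. f (g i))"
    by (induction I rule: infinite_finite_induct) (auto simp: add z)
qed

definition positive_functional :: "('a::cstar_algebra \<Rightarrow> complex) \<Rightarrow> bool" where
  "positive_functional f \<longleftrightarrow> clinear_functional f \<and> (\<forall>x. f (star x * x) \<in> \<real>\<^sub>\<ge>\<^sub>0)"

lemma positive_functional_clinear: "positive_functional f \<Longrightarrow> clinear_functional f"
  by (simp add: positive_functional_def)

lemma state_iff: "state f \<longleftrightarrow> positive_functional f \<and> f 1 = 1"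
  by (auto simp: state_def positive_functional_def clinear_functional_def)

lemma positive_functionalD:
  assumes "positive_functional f"
  shows "0 \<le> Re (f (star x * x))" "Im (f (star x * x)) = 0"
    "f (star x * x) = of_real (Re (f (star x * x)))"
proof -
  have *: "f (star x * x) \<in> \<real>\<^sub>\<ge>\<^sub>0" using assms by (simp add: positive_functional_def)
  then show "0 \<le> Re (f (star x * x))" "Im (f (star x * x)) = 0"
    by (auto simp: complex_nonneg_Reals_iff)
  then show "f (star x * x) = of_real (Re (f (star x * x)))" by (simp add: complex_eq_iff)
qed

text \<open>That the form is real at c = 1 and at c = \<i> forces w = cnj z. Multiples c = r * cnj z
  then make c * z real, and the claim is the discriminant bound for a real quadratic in r. Bare
  numbers are used so that the lemma applies both to a functional on an algebra and to f \<otimes> g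
  on lists.\<close>

lemma quadratic_form_discriminant:
  fixes a b :: real and z w :: complex
  assumes *: "\<And>c. of_real a + c * z + cnj c * w + c * cnj c * of_real b \<in> \<real>\<^sub>\<ge>\<^sub>0"
  shows "w = cnj z" and "(cmod z)\<^sup>2 \<le> a * b"
proof -
  have im: "Im (of_real a + c * z + cnj c * w + c * cnj c * of_real b) = 0" for c
    using *[of c] by (auto simp: complex_nonneg_Reals_iff)
  from im[of 1] im[of "\<i>"] show wz: "w = cnj z" by (auto simp: complex_eq_iff)
  have q: "0 \<le> a + 2 * Re (c * z) + (cmod c)\<^sup>2 * b" for c
  proof -
    have "0 \<le> Re (of_real a + c * z + cnj c * w + c * cnj c * of_real b)"
      using *[of c] by (auto simp: complex_nonneg_Reals_iff)
    also have "\<dots> = a + 2 * Re (c * z) + (cmod c)\<^sup>2 * b"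
      by (simp add: wz cmod_power2) (simp add: power2_eq_square algebra_simps)
    finally show ?thesis .
  qed
  define s where "s = (cmod z)\<^sup>2"
  have zz: "Re (of_real r * cnj z * z) = r * s" "(cmod (of_real r * cnj z))\<^sup>2 = r\<^sup>2 * s" for r
    by (simp_all add: s_def cmod_power2 power_mult_distrib norm_mult)
      (simp_all add: power2_eq_square algebra_simps)
  have qr: "0 \<le> a + 2 * r * s + r\<^sup>2 * s * b" for r
    using q[of "of_real r * cnj z"] unfolding zz by simp
  have s0: "0 \<le> s" by (simp add: s_def)
  have a0: "0 \<le> a" using qr[of 0] by simp
  show "(cmod z)\<^sup>2 \<le> a * b"
  proof (cases "b > 0")
    case True
    \<comment> \<open>The quadratic a + 2 r s + r^2 s b has its minimum at r = -1/b.\<close>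
    have "(-1/b)\<^sup>2 * s * b = s / b" using True by (simp add: power2_eq_square)
    then have "0 \<le> a - s / b" using qr[of "- 1/b"] by simp
    then have "s / b \<le> a" by simp
    then show ?thesis using True unfolding s_def[symmetric] by (simp add: field_simps)
  next
    case False
    \<comment> \<open>For s > 0 the r chosen below makes a + 2 r s equal to - a - 2, while the
      quadratic term is at most 0; this contradicts \<open>qr\<close>.\<close>
    have "s = 0"
    proof (rule ccontr)
      assume "s \<noteq> 0"
      then have s: "s > 0" using s0 by simp
      define r where "r = - ((a + 1) / s)"
      have "2 * r * s = - 2 * (a + 1)" using s by (simp add: r_def)
      moreover have "r\<^sup>2 * s * b \<le> 0" using False s0 by (intro mult_nonneg_nonpos) auto
      ultimately have "(a + 2 * r * s) + r\<^sup>2 * s * b \<le> (a + - 2 * (a + 1)) + 0"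
        by (intro add_mono) auto
      with qr[of r] have "0 \<le> a + - 2 * (a + 1)" by simp
      then show False using a0 by simp
    qed
    \<comment> \<open>With z = 0 the claim is 0 \<le> a * b. A negative b is excluded by the real c
      with c^2 b = - (a + 1), at which the form has the value -1.\<close>
    moreover have "b \<ge> 0"
    proof (rule ccontr)
      assume b: "\<not> b \<ge> 0"
      define r where "r = sqrt ((a + 1) / - b)"
      have "(a + 1) / - b \<ge> 0" using a0 b by (simp add: divide_nonneg_neg)
      then have "(cmod (of_real r))\<^sup>2 * b = - (a + 1)"
        using b by (simp add: r_def real_sqrt_pow2)
      moreover have "z = 0" using \<open>s = 0\<close> by (simp add: s_def)
      ultimately show False using q[of "of_real r"] by simp
    qed
    ultimately show ?thesis using a0 by (simp add: s_def)
  qed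
qed

lemma positive_functional_sesquilinear:
  fixes f :: "'a::cstar_algebra \<Rightarrow> complex"
  assumes f: "positive_functional f"
  shows "f (star y * x) = cnj (f (star x * y))"
    and "(cmod (f (star x * y)))\<^sup>2 \<le> Re (f (star x * x)) * Re (f (star y * y))"
proof -
  note lin = clinear_functional_simps[OF positive_functional_clinear[OF f]]
  have "of_real (Re (f (star x * x))) + c * f (star x * y) + cnj c * f (star y * x)
      + c * cnj c * of_real (Re (f (star y * y))) \<in> \<real>\<^sub>\<ge>\<^sub>0" for c
  proof -
    have "f (star (x + c *\<^sub>C y) * (x + c *\<^sub>C y)) = f (star x * x) + c * f (star x * y)
        + cnj c * f (star y * x) + c * cnj c * f (star y * y)"
      by (simp add: lin star_add star_scaleC distrib_left distrib_right scaleC_mult_left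
          scaleC_mult_right scaleC_scaleC mult.assoc add.assoc)
    moreover have "f (star (x + c *\<^sub>C y) * (x + c *\<^sub>C y)) \<in> \<real>\<^sub>\<ge>\<^sub>0"
      using f by (simp add: positive_functional_def)
    ultimately show ?thesis by (simp only: positive_functionalD(3)[OF f, symmetric])
  qed
  from quadratic_form_discriminant[OF this]
  show "f (star y * x) = cnj (f (star x * y))"
    and "(cmod (f (star x * y)))\<^sup>2 \<le> Re (f (star x * x)) * Re (f (star y * y))" by auto
qed

lemma positive_functional_star: "positive_functional f \<Longrightarrow> f (star x) = cnj (f x)"
  using positive_functional_sesquilinear(1)[of f x 1] by simp

lemma positive_functional_one:
  "positive_functional f \<Longrightarrow> 0 \<le> Re (f 1)" "positive_functional f \<Longrightarrow> f 1 = of_real (Re (f 1))"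
  using positive_functionalD[of f 1] by simp_all

text \<open>For k > (norm x)^2 the element 1 - star x * x / k is the square of a self-adjoint
  element, so f is nonnegative on it; then k decreases to (norm x)^2. The inequality for k is strict
  because the square root is taken inside the open unit ball.\<close>

lemma positive_functional_square_bound:
  fixes f :: "'a::cstar_algebra \<Rightarrow> complex"
  assumes f: "positive_functional f"
  shows "Re (f (star x * x)) \<le> Re (f 1) * (norm x)\<^sup>2"
proof -
  note lin = clinear_functional_simps[OF positive_functional_clinear[OF f]]
  have *: "Re (f (star x * x)) \<le> Re (f 1) * k" if k: "k > (norm x)\<^sup>2" for k
  proof -
    have k0: "k > 0" using k by (smt (verit) zero_le_power2)
    define w where "w = (1 / k) *\<^sub>R (star x * x)"
    have "star w = w"
      by (simp add: w_def scaleR_eq_scaleC star_scaleC star_mult star_star)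
    moreover have "norm w < 1" using k k0 by (simp add: w_def cstar_identity)
    ultimately obtain r where r: "star r = r" "r * r = 1 - w"
      using self_adjoint_sqrt_one_minus by blast
    have "0 \<le> Re (f (1 - w))" using positive_functionalD(1)[OF f, of r] r by simp
    then have "0 \<le> Re (f 1) - Re (f (star x * x)) / k"
      by (simp add: lin w_def)
    then show ?thesis using k0 by (simp add: field_simps)
  qed
  show ?thesis
  proof (rule field_le_epsilon)
    fix e :: real assume e: "e > 0"
    \<comment> \<open>The added 1 covers the case f 1 = 0.\<close>
    define d where "d = e / (Re (f 1) + 1)"
    have f1: "Re (f 1) \<ge> 0" using positive_functional_one[OF f] by simp
    have "d > 0" using e f1 by (simp add: d_def)
    then have "Re (f (star x * x)) \<le> Re (f 1) * ((norm x)\<^sup>2 + d)" by (intro *) simp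
    also have "\<dots> = Re (f 1) * (norm x)\<^sup>2 + Re (f 1) * d" by (simp add: algebra_simps)
    also have "Re (f 1) * d \<le> e" using e f1 by (simp add: d_def field_simps)
    finally show "Re (f (star x * x)) \<le> Re (f 1) * (norm x)\<^sup>2 + e" by simp
  qed
qed

lemma positive_functional_bound:
  fixes f :: "'a::cstar_algebra \<Rightarrow> complex"
  assumes f: "positive_functional f"
  shows "cmod (f x) \<le> Re (f 1) * norm x"
proof -
  have f1: "Re (f 1) \<ge> 0" using positive_functional_one[OF f] by simp
  have "(cmod (f x))\<^sup>2 \<le> Re (f 1) * Re (f (star x * x))"
    using positive_functional_sesquilinear(2)[OF f, of 1 x] by simp
  also have "\<dots> \<le> Re (f 1) * (Re (f 1) * (norm x)\<^sup>2)"
    by (intro mult_left_mono positive_functional_square_bound f f1)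
  also have "\<dots> = (Re (f 1) * norm x)\<^sup>2" by (simp add: power2_eq_square)
  finally show ?thesis by (rule power2_le_imp_le) (simp add: f1)
qed

lemma bounded_linear_positive_functional:
  assumes f: "positive_functional (f :: 'a::cstar_algebra \<Rightarrow> complex)"
  shows "bounded_linear f"
proof -
  note lin = clinear_functional_simps[OF positive_functional_clinear[OF f]]
  show ?thesis
    by (rule bounded_linear_intro[of _ "Re (f 1)"])
      (use positive_functional_bound[OF f] in
        \<open>auto simp: lin scaleR_conv_of_real[where 'a = complex] mult.commute\<close>)
qed

section \<open>Functionals on minimal tensor products\<close>

lemma alg_sum_Nil [simp]: "alg_sum \<beta> [] = 0"
  and alg_sum_Cons [simp]: "alg_sum \<beta> (x # xs) = \<beta> (fst x) (snd x) + alg_sum \<beta> xs"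
  and alg_sum_append [simp]: "alg_sum \<beta> (xs @ ys) = alg_sum \<beta> xs + alg_sum \<beta> ys"
  by (auto simp: alg_sum_def case_prod_beta add.assoc)

lemma alg_star_Nil [simp]: "alg_star [] = []"
  and alg_star_Cons [simp]: "alg_star (x # xs) = (star (fst x), star (snd x)) # alg_star xs"
  and alg_star_append [simp]: "alg_star (xs @ ys) = alg_star xs @ alg_star ys"
  by (auto simp: alg_star_def case_prod_beta)

lemma alg_sum_alg_mult:
  "alg_sum \<beta> (alg_mult xs ys) = (\<Sum>x\<leftarrow>xs. \<Sum>y\<leftarrow>ys. \<beta> (fst x * fst y) (snd x * snd y))"
proof -
  have "alg_sum \<beta> (map (\<lambda>y. (fst x * fst y, snd x * snd y)) ys) =
      (\<Sum>y\<leftarrow>ys. \<beta> (fst x * fst y) (snd x * snd y))" for x :: "'b \<times> 'c"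
    by (induction ys) auto
  then show ?thesis
    unfolding alg_mult_def by (induction xs) auto
qed

lemma min_tensorD:
  fixes t :: "'a::cstar_algebra \<Rightarrow> 'b::cstar_algebra \<Rightarrow> 'c::cstar_algebra"
  assumes "min_tensor t"
  shows "t (a + a') b = t a b + t a' b" "t a (b + b') = t a b + t a b'"
    "t (c *\<^sub>C a) b = c *\<^sub>C t a b" "t a (c *\<^sub>C b) = c *\<^sub>C t a b"
    "t a b * t a' b' = t (a * a') (b * b')" "star (t a b) = t (star a) (star b)" "t 1 1 = 1"
    "t 0 b = 0" "t a 0 = 0" "t (- a) b = - t a b" "t a (- b) = - t a b"
    "t (a - a') b = t a b - t a' b" "t a (b - b') = t a b - t a b'"
    "t (\<Sum>i\<in>I. f i) b = (\<Sum>i\<in>I. t (f i) b)" "t a (\<Sum>i\<in>J. g i) = (\<Sum>i\<in>J. t a (g i))"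
proof -
  show add: "t (a + a') b = t a b + t a' b" "t a (b + b') = t a b + t a b'"
    and sc: "t (c *\<^sub>C a) b = c *\<^sub>C t a b" "t a (c *\<^sub>C b) = c *\<^sub>C t a b"
    and "t a b * t a' b' = t (a * a') (b * b')" "star (t a b) = t (star a) (star b)" "t 1 1 = 1"
    for a a' b b' c
    using assms by (auto simp: min_tensor_def clinear_map_def)
  show z: "t 0 b = 0" "t a 0 = 0" for a b
    using sc(1)[of 0 0 b] sc(2)[of a 0 0] by simp_all
  show m: "t (- a) b = - t a b" "t a (- b) = - t a b" for a b
    using sc(1)[of "-1" a b] sc(2)[of a "-1" b] by simp_all
  show "t (a - a') b = t a b - t a' b" "t a (b - b') = t a b - t a b'"
    using add(1)[of a "-a'" b] add(2)[of a b "-b'"] m by simp_all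
  show "t (\<Sum>i\<in>I. f i) b = (\<Sum>i\<in>I. t (f i) b)"
    by (induction I rule: infinite_finite_induct) (auto simp: add z)
  show "t a (\<Sum>i\<in>J. g i) = (\<Sum>i\<in>J. t a (g i))"
    by (induction J rule: infinite_finite_induct) (auto simp: add z)
qed

text \<open>The independence clause of \<open>min_tensor\<close> for a single summand; the element 1
  is independent because \<open>of_cplx\<close> is injective.\<close>

lemma min_tensor_left_cancel:
  fixes t :: "'a::cstar_algebra \<Rightarrow> 'b::cstar_algebra \<Rightarrow> 'c::cstar_algebra"
  assumes "min_tensor t" "t a 1 = 0"
  shows "a = 0"
proof -
  have *: "\<forall>(n::nat) a b. (\<forall>c. (\<Sum>k<n. c k *\<^sub>C b k) = 0 \<longrightarrow> (\<forall>k<n. c k = 0)) \<longrightarrow>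
        (\<Sum>k<n. t (a k) (b k)) = 0 \<longrightarrow> (\<forall>k<n. a k = 0)"
    using assms(1) unfolding min_tensor_def by (elim conjE) assumption
  have "\<forall>c. (\<Sum>k<1::nat. c k *\<^sub>C (1::'b)) = 0 \<longrightarrow> (\<forall>k<1. c k = 0)"
    using of_cplx_eq_iff[of _ 0, where 'a = 'b] by simp
  from *[THEN spec, THEN spec, THEN spec, THEN mp, OF this, of "\<lambda>_. a"] show ?thesis
    using assms(2) by simp
qed

lemma alg_sum_mult:
  assumes "min_tensor t"
  shows "alg_sum t (alg_mult xs ys) = alg_sum t xs * alg_sum t ys"
proof -
  have "(\<Sum>y\<leftarrow>ys. t (a * fst y) (b * snd y)) = t a b * alg_sum t ys" for a b
    by (induction ys) (auto simp: min_tensorD[OF assms] distrib_left)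
  then show ?thesis
    unfolding alg_sum_alg_mult by (induction xs) (auto simp: distrib_right)
qed

lemma alg_sum_star: "min_tensor t \<Longrightarrow> alg_sum t (alg_star xs) = star (alg_sum t xs)"
  by (induction xs) (auto simp: min_tensorD star_add)

text \<open>A real scalar is absorbed into the left entry of a pair, so every element of the dense
  span is the value of one list. Closed conditions therefore need checking on lists only.\<close>

lemma min_tensor_closed_induct:
  assumes t: "min_tensor t" and P: "closed {X. P X}" "\<And>xs. P (alg_sum t xs)"
  shows "P X"
proof -
  have "span (range (\<lambda>(a, b). t a b)) \<subseteq> range (alg_sum t)"
  proof
    fix X assume "X \<in> span (range (\<lambda>(a, b). t a b))"
    then show "X \<in> range (alg_sum t)"
    proof (induction rule: span_induct_alt)
      case base
      show ?case by (metis alg_sum_Nil rangeI)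
    next
      case (step c x y)
      then obtain a b ys where x: "x = t a b" "y = alg_sum t ys" by auto
      then have "c *\<^sub>R x + y = alg_sum t ((c *\<^sub>R a, b) # ys)"
        by (simp add: scaleR_eq_scaleC min_tensorD[OF t])
      then show ?case by blast
    qed
  qed
  with P(2) have "span (range (\<lambda>(a, b). t a b)) \<subseteq> {X. P X}" by auto
  then have "closure (span (range (\<lambda>(a, b). t a b))) \<subseteq> {X. P X}"
    using P(1) by (rule closure_minimal)
  moreover have "closure (span (range (\<lambda>(a, b). t a b))) = UNIV"
    using t by (simp add: min_tensor_def)
  ultimately show ?thesis by auto
qed

lemma bounded_linear_alg_sum:
  assumes "bounded_linear \<Phi>"
  shows "\<Phi> (alg_sum t xs) = alg_sum (\<lambda>a b. \<Phi> (t a b)) xs"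
  using bounded_linear.linear[OF assms] by (induction xs) (auto simp: linear_0 linear_add)

lemma min_tensor_eqI:
  fixes \<Phi> \<Psi> :: "'c::cstar_algebra \<Rightarrow> 'd::real_normed_vector"
  assumes t: "min_tensor t" and "bounded_linear \<Phi>" "bounded_linear \<Psi>"
    and "\<And>a b. \<Phi> (t a b) = \<Psi> (t a b)"
  shows "\<Phi> X = \<Psi> X"
proof (rule min_tensor_closed_induct[OF t])
  show "closed {X. \<Phi> X = \<Psi> X}"
    using assms(2,3)[THEN bounded_linear.continuous_on, OF continuous_on_id]
    by (rule closed_Collect_eq)
qed (use assms in \<open>simp add: bounded_linear_alg_sum\<close>)

text \<open>The bound on lists makes the value depend only on the element represented and makes the
  resulting map Lipschitz, hence extendable to the closure. Sums are concatenations of lists;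
  \<open>neg\<close> and \<open>scale\<close> let differences and multiples be formed by changing
  left entries.\<close>

lemma min_tensor_extension:
  fixes t :: "'a::cstar_algebra \<Rightarrow> 'b::cstar_algebra \<Rightarrow> 'c::cstar_algebra"
    and \<beta> :: "'a \<Rightarrow> 'b \<Rightarrow> 'd::banach"
  assumes t: "min_tensor t"
    and neg: "\<And>a b. \<beta> (- a) b = - \<beta> a b"
    and scale: "\<And>r a b. \<beta> (r *\<^sub>R a) b = r *\<^sub>R \<beta> a b"
    and bound: "\<And>xs. norm (alg_sum \<beta> xs) \<le> C * norm (alg_sum t xs)"
  shows "\<exists>\<Phi>. bounded_linear \<Phi> \<and> (\<forall>a b. \<Phi> (t a b) = \<beta> a b)"
proof -
  have t_scale: "t (r *\<^sub>R a) b = r *\<^sub>R t a b" for r a b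
    by (simp add: scaleR_eq_scaleC min_tensorD[OF t])
  have bound': "norm (alg_sum \<beta> xs) \<le> \<bar>C\<bar> * norm (alg_sum t xs)" for xs
    by (rule order_trans[OF bound]) (simp add: mult_right_mono)
  have dist: "dist (alg_sum \<beta> xs) (alg_sum \<beta> ys) \<le> \<bar>C\<bar> * dist (alg_sum t xs) (alg_sum t ys)" for xs ys
  proof -
    define zs :: "('a \<times> 'b) list" where "zs = map (\<lambda>y. (- fst y, snd y)) ys"
    have "alg_sum \<beta> zs = - alg_sum \<beta> ys" "alg_sum t zs = - alg_sum t ys"
      unfolding zs_def by (induction ys) (auto simp: neg min_tensorD[OF t])
    then show ?thesis using bound'[of "xs @ zs"] by (simp add: dist_norm)
  qed
  \<comment> \<open>The representing list is chosen arbitrarily; by \<open>dist\<close> any other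
    one gives the same value.\<close>
  define g where "g X = alg_sum \<beta> (SOME xs. alg_sum t xs = X)" for X
  have g: "g (alg_sum t xs) = alg_sum \<beta> xs" for xs
  proof -
    have "alg_sum t (SOME ys. alg_sum t ys = alg_sum t xs) = alg_sum t xs" by (rule someI) simp
    then have "dist (g (alg_sum t xs)) (alg_sum \<beta> xs) \<le> 0"
      using dist[of "SOME ys. alg_sum t ys = alg_sum t xs" xs] by (simp add: g_def)
    then show ?thesis by simp
  qed
  let ?S = "range (alg_sum t)"
  have cl: "closure ?S = UNIV"
    using min_tensor_closed_induct[OF t, of "\<lambda>X. X \<in> closure ?S"] closure_subset[of ?S] by auto
  have uc: "uniformly_continuous_on ?S g"
    unfolding uniformly_continuous_on_def
  proof (intro allI impI)
    fix e :: real assume e: "e > 0"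
    show "\<exists>d>0. \<forall>x\<in>?S. \<forall>x'\<in>?S. dist x' x < d \<longrightarrow> dist (g x') (g x) < e"
    \<comment> \<open>The constant \<bar>C\<bar> + 1 is nonzero even for C = 0.\<close>
    proof (intro exI[of _ "e / (\<bar>C\<bar> + 1)"] conjI ballI impI)
      fix x x' assume "x \<in> ?S" "x' \<in> ?S" and d: "dist x' x < e / (\<bar>C\<bar> + 1)"
      then have "dist (g x') (g x) \<le> \<bar>C\<bar> * dist x' x" using g dist by auto
      also have "\<dots> \<le> (\<bar>C\<bar> + 1) * dist x' x" by (simp add: mult_right_mono)
      also have "\<dots> < e" using d by (simp add: field_simps)
      finally show "dist (g x') (g x) < e" .
    qed (use e in \<open>simp add: add_nonneg_pos\<close>)
  qed
  obtain \<Phi> where \<Phi>: "uniformly_continuous_on (closure ?S) \<Phi>" "\<And>x. x \<in> ?S \<Longrightarrow> g x = \<Phi> x"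
    by (rule uniformly_continuous_on_extension_on_closure[OF uc]) (rule that)
  have cont: "continuous_on UNIV \<Phi>"
    using uniformly_continuous_imp_continuous[OF \<Phi>(1)] cl by simp
  have cont': "continuous_on UNIV (\<lambda>X. \<Phi> (h X))" if "continuous_on UNIV h" for h :: "'c \<Rightarrow> 'c"
    using continuous_on_compose2[OF cont that] by simp
  have \<Phi>_alg: "\<Phi> (alg_sum t xs) = alg_sum \<beta> xs" for xs
    using \<Phi>(2)[of "alg_sum t xs"] g by simp
  \<comment> \<open>Additivity passes to the closure in one argument at a time.\<close>
  have add1: "\<Phi> (X + alg_sum t ys) = \<Phi> X + alg_sum \<beta> ys" for X ys
  proof (rule min_tensor_closed_induct[OF t])
    show "closed {X. \<Phi> (X + alg_sum t ys) = \<Phi> X + alg_sum \<beta> ys}"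
      by (intro closed_Collect_eq cont' cont continuous_intros)
    show "\<Phi> (alg_sum t xs + alg_sum t ys) = \<Phi> (alg_sum t xs) + alg_sum \<beta> ys" for xs
      using \<Phi>_alg[of "xs @ ys"] by (simp add: \<Phi>_alg)
  qed
  have add: "\<Phi> (X + Y) = \<Phi> X + \<Phi> Y" for X Y
  proof (rule min_tensor_closed_induct[OF t])
    show "closed {Y. \<Phi> (X + Y) = \<Phi> X + \<Phi> Y}"
      by (intro closed_Collect_eq cont' cont continuous_intros)
  qed (simp add: add1 \<Phi>_alg)
  have sc: "\<Phi> (r *\<^sub>R X) = r *\<^sub>R \<Phi> X" for r X
  proof (rule min_tensor_closed_induct[OF t])
    show "closed {X. \<Phi> (r *\<^sub>R X) = r *\<^sub>R \<Phi> X}"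
      by (intro closed_Collect_eq cont' cont continuous_intros)
    fix xs
    define zs :: "('a \<times> 'b) list" where "zs = map (\<lambda>y. (r *\<^sub>R fst y, snd y)) xs"
    have "alg_sum \<beta> zs = r *\<^sub>R alg_sum \<beta> xs" "alg_sum t zs = r *\<^sub>R alg_sum t xs"
      unfolding zs_def by (induction xs) (auto simp: scale t_scale scaleR_add_right)
    then show "\<Phi> (r *\<^sub>R alg_sum t xs) = r *\<^sub>R \<Phi> (alg_sum t xs)"
      using \<Phi>_alg[of zs] by (simp add: \<Phi>_alg)
  qed
  have "norm (\<Phi> X) \<le> norm X * \<bar>C\<bar>" for X
  proof (rule min_tensor_closed_induct[OF t])
    show "closed {X. norm (\<Phi> X) \<le> norm X * \<bar>C\<bar>}"
      by (intro closed_Collect_le cont continuous_intros)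
  qed (use bound' in \<open>simp add: \<Phi>_alg mult.commute\<close>)
  then have "bounded_linear \<Phi>" by (intro bounded_linear_intro[of _ "\<bar>C\<bar>"] add sc)
  moreover have "\<Phi> (t a b) = \<beta> a b" for a b using \<Phi>_alg[of "[(a, b)]"] by simp
  ultimately show ?thesis by blast
qed

text \<open>The induction projects all \<open>b\<^sub>i\<close> to the orthogonal complement of the last one, which changes the
  Gram matrix \<open>g (b\<^sub>i\<^sup>*b\<^sub>j)\<close> by one of rank one.\<close>

lemma Schur_product_functionals:
  fixes f :: "'a::cstar_algebra \<Rightarrow> complex" and g :: "'b::cstar_algebra \<Rightarrow> complex"
    and a :: "nat \<Rightarrow> 'a" and b :: "nat \<Rightarrow> 'b"
  assumes f: "positive_functional f" and g: "positive_functional g"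
  shows "(\<Sum>i<n. \<Sum>j<n. f (star (a i) * a j) * g (star (b i) * b j)) \<in> \<real>\<^sub>\<ge>\<^sub>0"
proof (induction n arbitrary: b)
  case (Suc n)
  note lin = clinear_functional_simps[OF positive_functional_clinear[OF f]]
    clinear_functional_simps[OF positive_functional_clinear[OF g]]
  define d where "d = Re (g (star (b n) * b n))"
  have d: "g (star (b n) * b n) = of_real d" "d \<ge> 0"
    using positive_functionalD[OF g, of "b n"] by (auto simp: d_def)
  define e where "e i = g (star (b n) * b i)" for i
  have e: "g (star (b i) * b n) = cnj (e i)" for i
    unfolding e_def by (rule positive_functional_sesquilinear(1)[OF g])
  have e0: "e i = 0" if "d = 0" for i
    using positive_functional_sesquilinear(2)[OF g, of "b n" "b i"] that by (simp add: e_def d_def)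
  \<comment> \<open>For d = 0 the quotient is 0 and b' = b; \<open>gb'\<close> still holds, since
    then every e i vanishes by \<open>e0\<close>.\<close>
  define b' where "b' i = b i - (e i / d) *\<^sub>C b n" for i
  have gb': "g (star (b i) * b j) = g (star (b' i) * b' j) + cnj (e i) * e j / d" for i j
  proof (cases "d = 0")
    case True
    then show ?thesis by (simp add: b'_def e0)
  next
    case False
    have ej: "g (star (b n) * b j) = e j" by (simp add: e_def)
    have "g (star (b' i) * b' j) = g (star (b i) * b j) - (e j / d) * g (star (b i) * b n)
        - cnj (e i / d) * g (star (b n) * b j) + cnj (e i / d) * (e j / d) * g (star (b n) * b n)"
      by (simp add: b'_def star_diff star_scaleC left_diff_distrib right_diff_distrib
          scaleC_mult_left scaleC_mult_right lin)
    also have "\<dots> = g (star (b i) * b j) - cnj (e i) * e j / d"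
      unfolding d(1) unfolding e ej using False by (simp add: field_simps)
    finally show ?thesis by simp
  qed
  \<comment> \<open>The last row and column of the projected Gram matrix are zero, so the induction
    hypothesis for n applies.\<close>
  have b'n: "g (star (b' i) * b' n) = 0" "g (star (b' n) * b' i) = 0" for i
  proof -
    show *: "g (star (b' i) * b' n) = 0" for i
    proof (cases "d = 0")
      case True
      then show ?thesis by (simp add: b'_def e0 e)
    next
      case False
      then have "b' n = 0" using d by (simp add: b'_def e_def)
      then show ?thesis by (simp add: lin)
    qed
    then show "g (star (b' n) * b' i) = 0"
      using positive_functional_sesquilinear(1)[OF g, of "b' n" "b' i"] by simp
  qed
  \<comment> \<open>The rank-one correction cnj (e i) * e j / d contributes f (star z * z) / d,
    which is nonnegative.\<close>
  define z where "z = (\<Sum>i<Suc n. e i *\<^sub>C a i)"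
  have z: "f (star z * z) = (\<Sum>i<Suc n. \<Sum>j<Suc n. f (star (a i) * a j) * (cnj (e i) * e j))"
    unfolding z_def star_sum star_scaleC sum_product lin
    by (intro sum.cong refl) (simp add: scaleC_mult_left scaleC_mult_right lin)
  have "(\<Sum>i<Suc n. \<Sum>j<Suc n. f (star (a i) * a j) * g (star (b i) * b j))
      = (\<Sum>i<Suc n. \<Sum>j<Suc n. f (star (a i) * a j) * g (star (b' i) * b' j)) + f (star z * z) / d"
    unfolding z gb' by (simp only: distrib_left sum.distrib sum_divide_distrib times_divide_eq_right)
  also have "(\<Sum>i<Suc n. \<Sum>j<Suc n. f (star (a i) * a j) * g (star (b' i) * b' j))
      = (\<Sum>i<n. \<Sum>j<n. f (star (a i) * a j) * g (star (b' i) * b' j))"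
    by (simp add: b'n)
  finally show ?case
    using Suc.IH[of b'] f d(2)
    by (simp add: positive_functional_def nonneg_Reals_add_I nonneg_Reals_divide_I)
qed simp

text \<open>The summands are entrywise products of two Gram matrices. Positivity is stated on lists
  because the extension of f \<otimes> g to the completion will itself rest on it.\<close>

lemma algebraic_product_positive:
  fixes f :: "'a::cstar_algebra \<Rightarrow> complex" and g :: "'b::cstar_algebra \<Rightarrow> complex"
  assumes f: "positive_functional f" and g: "positive_functional g"
  shows "alg_sum (\<lambda>a b. f a * g b) (alg_mult (alg_star xs) xs) \<in> \<real>\<^sub>\<ge>\<^sub>0"
proof -
  have "alg_sum (\<lambda>a b. f a * g b) (alg_mult (alg_star xs) xs) =
      (\<Sum>i<length xs. \<Sum>j<length xs. f (star (fst (xs ! i)) * fst (xs ! j))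
        * g (star (snd (xs ! i)) * snd (xs ! j)))"
    unfolding alg_sum_alg_mult
    by (simp add: sum_list_sum_nth alg_star_def case_prod_beta atLeast0LessThan)
  then show ?thesis using Schur_product_functionals[OF f g] by simp
qed

text \<open>The vector y = 1 \<otimes> 1 in the spatial norm bounds (f \<otimes> g)(star x * x) by
  the squared norm of x, and the Cauchy-Schwarz inequality against 1 \<otimes> 1 then bounds (f
  \<otimes> g)(x).\<close>

lemma state_product_bound:
  fixes t :: "'a::cstar_algebra \<Rightarrow> 'b::cstar_algebra \<Rightarrow> 'c::cstar_algebra"
  assumes t: "min_tensor t" and f: "state f" and g: "state g"
  shows "cmod (alg_sum (\<lambda>a b. f a * g b) xs) \<le> norm (alg_sum t xs)"
proof -
  define P where "P = alg_sum (\<lambda>a b. f a * g b)"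
  have pf: "positive_functional f" "positive_functional g" and one: "f 1 = 1" "g 1 = 1"
    using f g by (auto simp: state_iff)
  note lin = clinear_functional_simps[OF positive_functional_clinear[OF pf(1)]]
    clinear_functional_simps[OF positive_functional_clinear[OF pf(2)]]
  have Ps: "P (alg_mult (alg_star zs) zs) \<in> \<real>\<^sub>\<ge>\<^sub>0" for zs
    unfolding P_def by (rule algebraic_product_positive[OF pf])
  define A where "A = Re (P (alg_mult (alg_star xs) xs))"
  have A: "P (alg_mult (alg_star xs) xs) = of_real A" "A \<ge> 0"
    using Ps[of xs] by (auto simp: A_def complex_nonneg_Reals_iff complex_eq_iff)
  have mult1: "alg_mult xs [(1, 1)] = xs" "alg_mult [(1, 1)] zs = zs" for zs :: "('a \<times> 'b) list"
    by (auto simp: alg_mult_def concat_map_singleton)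
  have "ennreal (sqrt A) \<le> spatial_norm xs"
    unfolding spatial_norm_def
  proof (rule Sup_upper, intro CollectI exI conjI)
    show "ennreal (sqrt A) = ennreal (sqrt (Re (alg_sum (\<lambda>a b. f a * g b)
       (alg_mult (alg_star [(1, 1)]) (alg_mult (alg_star xs) (alg_mult xs [(1, 1)]))))))"
      by (simp add: mult1 A_def P_def)
  qed (use f g one in \<open>auto simp: alg_mult_def\<close>)
  also have "\<dots> = ennreal (norm (alg_sum t xs))" using t by (simp add: min_tensor_def)
  finally have "sqrt A \<le> norm (alg_sum t xs)" by (simp add: ennreal_le_iff)
  moreover have "(cmod (P (alg_star xs)))\<^sup>2 \<le> A * 1 \<and> P xs = cnj (P (alg_star xs))"
  proof -
    \<comment> \<open>Positivity on the list that represents x + c (1 \<otimes> 1), expanded in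
      c.\<close>
    have "of_real A + c * P (alg_star xs) + cnj c * P xs + c * cnj c * of_real 1 \<in> \<real>\<^sub>\<ge>\<^sub>0" for c
    proof -
      have 1: "(\<Sum>y\<leftarrow>alg_star xs. f (fst y * c *\<^sub>C 1) * g (snd y)) = c * P (alg_star xs)"
        unfolding P_def by (induction "xs") (auto simp: scaleC_mult_right lin distrib_left)
      have 2: "(\<Sum>y\<leftarrow>xs. f (star (c *\<^sub>C 1) * fst y) * g (snd y)) = cnj c * P xs"
        unfolding P_def by (induction "xs")
          (auto simp: star_scaleC scaleC_mult_left lin distrib_left)
      have 3: "f (star (c *\<^sub>C 1) * c *\<^sub>C 1) = c * cnj c"
        by (simp add: star_scaleC scaleC_mult_left lin one)
      have "P (alg_mult (alg_star (xs @ [(c *\<^sub>C 1, 1)])) (xs @ [(c *\<^sub>C 1, 1)])) =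
          P (alg_mult (alg_star xs) xs) + c * P (alg_star xs) + cnj c * P xs + c * cnj c"
        unfolding 1[symmetric] 2[symmetric] 3[symmetric]
        by (simp add: P_def alg_sum_alg_mult sum_list_addf one)
      then show ?thesis using Ps[of "xs @ [(c *\<^sub>C 1, 1)]"] by (simp add: A)
    qed
    from quadratic_form_discriminant[OF this] show ?thesis by auto
  qed
  ultimately have "cmod (P xs) \<le> sqrt A" "sqrt A \<le> norm (alg_sum t xs)"
    by (auto intro: real_le_rsqrt)
  then show ?thesis unfolding P_def by (rule order_trans)
qed

text \<open>The complex span of the positive functionals. Unlike these, it is stable under a
  \<mapsto> f (y * F a * z), and products of functionals extend to it by bilinearity.\<close>

inductive positive_span :: "('a::cstar_algebra \<Rightarrow> complex) \<Rightarrow> bool" where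
  positive_span_base: "positive_functional f \<Longrightarrow> positive_span f"
| positive_span_add: "positive_span f \<Longrightarrow> positive_span g \<Longrightarrow> positive_span (\<lambda>x. f x + g x)"
| positive_span_scale: "positive_span f \<Longrightarrow> positive_span (\<lambda>x. c * f x)"

lemma positive_span_state: "state f \<Longrightarrow> positive_span f"
  by (simp add: state_iff positive_span_base)

lemma positive_span_clinear: "positive_span f \<Longrightarrow> clinear_functional f"
  by (induction rule: positive_span.induct)
    (auto simp: positive_functional_def clinear_functional_def algebra_simps)

lemma positive_functional_zero: "positive_functional f \<Longrightarrow> f 1 = 0 \<Longrightarrow> f x = 0"
  using positive_functional_bound[of f x] by simp

lemma positive_functional_normalize:
  assumes f: "positive_functional f" and "f 1 \<noteq> 0"
  shows "\<exists>r h. state h \<and> f = (\<lambda>x. complex_of_real r * h x)"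
proof -
  define r where "r = Re (f 1)"
  have r: "f 1 = of_real r" "r \<ge> 0" "r \<noteq> 0"
    using positive_functional_one[OF f] assms(2) by (auto simp: r_def)
  have "of_real (1 / r) * f (star x * x) \<in> \<real>\<^sub>\<ge>\<^sub>0" for x
    using f r(2) by (intro nonneg_Reals_mult_I) (auto simp: positive_functional_def)
  then have "state (\<lambda>x. of_real (1 / r) * f x)"
    using f r by (simp add: state_iff positive_functional_def clinear_functional_def add_divide_distrib)
  moreover have "f = (\<lambda>x. of_real r * (of_real (1 / r) * f x))" using r by simp
  ultimately show ?thesis by blast
qed

text \<open>f \<otimes> g on the completion. Density of the algebraic tensor product leaves at most
  one bounded extension, so the choice operator has no freedom once one exists.\<close>

definition product_functional ::
  "('a::cstar_algebra \<Rightarrow> 'b::cstar_algebra \<Rightarrow> 'c::cstar_algebra) \<Rightarrow>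
   ('a \<Rightarrow> complex) \<Rightarrow> ('b \<Rightarrow> complex) \<Rightarrow> 'c \<Rightarrow> complex" where
  "product_functional t f g = (SOME \<Phi>. bounded_linear \<Phi> \<and> (\<forall>a b. \<Phi> (t a b) = f a * g b))"

text \<open>For states the extension has constant 1. A positive functional is a multiple of a state,
  or vanishes when f 1 = 0. The span is then reached by induction in one argument at a time.\<close>

lemma product_functional_exists:
  fixes t :: "'a::cstar_algebra \<Rightarrow> 'b::cstar_algebra \<Rightarrow> 'c::cstar_algebra"
  assumes t: "min_tensor t" and f: "positive_span f" and g: "positive_span g"
  shows "\<exists>\<Phi>. bounded_linear \<Phi> \<and> (\<forall>a b. \<Phi> (t a b) = f a * g b)"
proof -
  have st: "\<exists>\<Phi>. bounded_linear \<Phi> \<and> (\<forall>a b. \<Phi> (t a b) = f a * g b)" if "state f" "state g" for f g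
  proof (rule min_tensor_extension[OF t])
    have "clinear_functional f" using that by (simp add: state_iff positive_functional_clinear)
    note lin = clinear_functional_simps[OF this]
    show "f (- a) * g b = - (f a * g b)" "f (r *\<^sub>R a) * g b = r *\<^sub>R (f a * g b)" for a b r
      by (simp_all only: lin) (simp_all add: scaleR_conv_of_real)
    show "norm (alg_sum (\<lambda>a b. f a * g b) xs) \<le> 1 * norm (alg_sum t xs)" for xs
      using state_product_bound[OF t that] by simp
  qed
  have pos: "\<exists>\<Phi>. bounded_linear \<Phi> \<and> (\<forall>a b. \<Phi> (t a b) = f a * g b)"
    if f: "positive_functional f" and g: "positive_functional g" for f g
  proof (cases "f 1 = 0 \<or> g 1 = 0")
    case True
    then have "f a * g b = 0" for a b
      using positive_functional_zero[OF f] positive_functional_zero[OF g] by auto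
    then show ?thesis by (intro exI[of _ "\<lambda>_. 0"]) auto
  next
    case False
    obtain r h where h: "state h" "f = (\<lambda>x. complex_of_real r * h x)"
      using positive_functional_normalize[OF f] False by blast
    obtain q k where k: "state k" "g = (\<lambda>x. complex_of_real q * k x)"
      using positive_functional_normalize[OF g] False by blast
    obtain \<Phi> where \<Phi>: "bounded_linear \<Phi>" "\<And>a b. \<Phi> (t a b) = h a * k b"
      using st[OF h(1) k(1)] by blast
    then show ?thesis
      by (intro exI[of _ "\<lambda>x. of_real r * of_real q * \<Phi> x"] conjI)
        (auto simp: h(2) k(2) intro: bounded_linear_const_mult)
  qed
  have right: "\<exists>\<Phi>. bounded_linear \<Phi> \<and> (\<forall>a b. \<Phi> (t a b) = f a * g b)"
    if f: "positive_functional f" for f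
    using g
  proof induction
    case (positive_span_base g)
    then show ?case using pos[OF f] by blast
  next
    case (positive_span_add g h)
    then obtain \<Phi> \<Psi> where "bounded_linear \<Phi>" "\<And>a b. \<Phi> (t a b) = f a * g b"
      "bounded_linear \<Psi>" "\<And>a b. \<Psi> (t a b) = f a * h b" by blast
    then show ?case
      by (intro exI[of _ "\<lambda>x. \<Phi> x + \<Psi> x"]) (auto intro: bounded_linear_add simp: distrib_left)
  next
    case (positive_span_scale g c)
    then obtain \<Phi> where "bounded_linear \<Phi>" "\<And>a b. \<Phi> (t a b) = f a * g b" by blast
    then show ?case
      by (intro exI[of _ "\<lambda>x. c * \<Phi> x"]) (auto intro: bounded_linear_const_mult)
  qed
  show ?thesis
    using f
  proof induction
    case (positive_span_base f)
    then show ?case by (rule right)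
  next
    case (positive_span_add f h)
    then obtain \<Phi> \<Psi> where "bounded_linear \<Phi>" "\<And>a b. \<Phi> (t a b) = f a * g b"
      "bounded_linear \<Psi>" "\<And>a b. \<Psi> (t a b) = h a * g b" by blast
    then show ?case
      by (intro exI[of _ "\<lambda>x. \<Phi> x + \<Psi> x"]) (auto intro: bounded_linear_add simp: distrib_right)
  next
    case (positive_span_scale f c)
    then obtain \<Phi> where "bounded_linear \<Phi>" "\<And>a b. \<Phi> (t a b) = f a * g b" by blast
    then show ?case
      by (intro exI[of _ "\<lambda>x. c * \<Phi> x"]) (auto intro: bounded_linear_const_mult)
  qed
qed

lemma product_functional:
  assumes "min_tensor t" "positive_span f" "positive_span g"
  shows bounded_linear_product_functional: "bounded_linear (product_functional t f g)"
    and product_functional_tensor: "product_functional t f g (t a b) = f a * g b"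
  using someI_ex[OF product_functional_exists[OF assms]]
  unfolding product_functional_def[symmetric] by auto

lemma product_functional_eqI:
  assumes "min_tensor t" "positive_span f" "positive_span g"
    and "bounded_linear \<Phi>" "\<And>a b. \<Phi> (t a b) = f a * g b"
  shows "product_functional t f g X = \<Phi> X"
  by (rule min_tensor_eqI[OF assms(1)])
    (auto simp: assms bounded_linear_product_functional product_functional_tensor)

lemma product_functional_add_left:
  assumes "min_tensor t" "positive_span f" "positive_span f'" "positive_span g"
  shows "product_functional t (\<lambda>x. f x + f' x) g X =
    product_functional t f g X + product_functional t f' g X"
  using assms
  by (intro product_functional_eqI bounded_linear_add)
    (auto simp: bounded_linear_product_functional product_functional_tensor distrib_right
      intro: positive_span_add)

lemma product_functional_add_right:
  assumes "min_tensor t" "positive_span f" "positive_span g" "positive_span g'"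
  shows "product_functional t f (\<lambda>x. g x + g' x) X =
    product_functional t f g X + product_functional t f g' X"
  using assms
  by (intro product_functional_eqI bounded_linear_add)
    (auto simp: bounded_linear_product_functional product_functional_tensor distrib_left
      intro: positive_span_add)

lemma product_functional_scale_left:
  assumes "min_tensor t" "positive_span f" "positive_span g"
  shows "product_functional t (\<lambda>x. c * f x) g X = c * product_functional t f g X"
  using assms
  by (intro product_functional_eqI bounded_linear_const_mult)
    (auto simp: bounded_linear_product_functional product_functional_tensor
      intro: positive_span_scale)

lemma product_functional_scale_right:
  assumes "min_tensor t" "positive_span f" "positive_span g"
  shows "product_functional t f (\<lambda>x. c * g x) X = c * product_functional t f g X"
  using assms
  by (intro product_functional_eqI bounded_linear_const_mult)
    (auto simp: bounded_linear_product_functional product_functional_tensor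
      intro: positive_span_scale)

text \<open>\<open>bounded_linear\<close> is linearity over the reals, so complex homogeneity is
  transported separately, from elementary tensors to the closure.\<close>

lemma clinear_functional_min_tensorI:
  assumes t: "min_tensor t" and \<Phi>: "bounded_linear \<Phi>"
    and c: "\<And>c a b. \<Phi> (t (c *\<^sub>C a) b) = c * \<Phi> (t a b)"
  shows "clinear_functional \<Phi>"
proof -
  have "\<Phi> (c *\<^sub>C X) = c * \<Phi> X" for c X
    by (rule min_tensor_eqI[OF t, of "\<lambda>X. \<Phi> (c *\<^sub>C X)" "\<lambda>X. c * \<Phi> X"])
      (auto intro: bounded_linear_compose[OF \<Phi> bounded_linear_scaleC]
        bounded_linear_const_mult \<Phi> simp: c min_tensorD(3)[OF t, symmetric])
  then show ?thesis
    using linear_add[OF bounded_linear.linear[OF \<Phi>]] by (auto simp: clinear_functional_def)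
qed

lemma positive_functional_min_tensorI:
  assumes t: "min_tensor t" and \<Phi>: "bounded_linear \<Phi>"
    and c: "\<And>c a b. \<Phi> (t (c *\<^sub>C a) b) = c * \<Phi> (t a b)"
    and pos: "\<And>xs. \<Phi> (star (alg_sum t xs) * alg_sum t xs) \<in> \<real>\<^sub>\<ge>\<^sub>0"
  shows "positive_functional \<Phi>"
proof -
  have cont: "continuous_on UNIV (\<lambda>X. \<Phi> (star X * X))"
    by (intro bounded_linear.continuous_on[OF \<Phi>] continuous_on_mult
        bounded_linear.continuous_on[OF bounded_linear_star] continuous_on_id)
  have "\<Phi> (star X * X) \<in> \<real>\<^sub>\<ge>\<^sub>0" for X
  proof (rule min_tensor_closed_induct[OF t, where P = "\<lambda>X. \<Phi> (star X * X) \<in> \<real>\<^sub>\<ge>\<^sub>0"])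
    show "closed {X. \<Phi> (star X * X) \<in> \<real>\<^sub>\<ge>\<^sub>0}"
      unfolding complex_nonneg_Reals_iff
      by (intro closed_Collect_conj closed_Collect_le closed_Collect_eq continuous_on_Re
          continuous_on_Im cont continuous_on_const)
  qed (rule pos)
  then show ?thesis
    using clinear_functional_min_tensorI[OF t \<Phi> c] by (simp add: positive_functional_def)
qed

lemma positive_functional_product:
  assumes t: "min_tensor t" and f: "positive_functional f" and g: "positive_functional g"
  shows "positive_functional (product_functional t f g)"
proof (rule positive_functional_min_tensorI[OF t])
  note sp = positive_span_base[OF f] positive_span_base[OF g]
  note tens = product_functional_tensor[OF t sp]
  show bl: "bounded_linear (product_functional t f g)"
    by (rule bounded_linear_product_functional[OF t sp])
  show "product_functional t f g (t (c *\<^sub>C a) b) = c * product_functional t f g (t a b)" for c a b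
    using clinear_functional_simps(2)[OF positive_functional_clinear[OF f]] by (simp add: tens)
  show "product_functional t f g (star (alg_sum t xs) * alg_sum t xs) \<in> \<real>\<^sub>\<ge>\<^sub>0" for xs
    using algebraic_product_positive[OF f g, of xs]
    by (simp add: alg_sum_star[OF t, symmetric] alg_sum_mult[OF t, symmetric]
        bounded_linear_alg_sum[OF bl] tens)
qed

lemma state_product: "min_tensor t \<Longrightarrow> state f \<Longrightarrow> state g \<Longrightarrow> state (product_functional t f g)"
  using positive_functional_product[of t f g] product_functional_tensor[of t f g 1 1]
  by (simp add: state_iff positive_span_base min_tensorD)

lemma positive_span_product:
  assumes t: "min_tensor t" and f: "positive_span f" and g: "positive_span g"
  shows "positive_span (product_functional t f g)"
  using f
proof induction
  case (positive_span_base f)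
  from g show ?case
  proof induction
    case (positive_span_base g)
    then show ?case
      using positive_functional_product[OF t \<open>positive_functional f\<close>]
      by (simp add: positive_span.positive_span_base)
  next
    case (positive_span_add g h)
    then show ?case
      using positive_span.positive_span_base[OF \<open>positive_functional f\<close>] t
      by (simp add: product_functional_add_right positive_span.positive_span_add)
  next
    case (positive_span_scale g c)
    then show ?case
      using positive_span.positive_span_base[OF \<open>positive_functional f\<close>] t
      by (simp add: product_functional_scale_right positive_span.positive_span_scale)
  qed
next
  case (positive_span_add f h)
  then show ?case using t g
    by (simp add: product_functional_add_left positive_span.positive_span_add)
next
  case (positive_span_scale f c)
  then show ?case using t g
    by (simp add: product_functional_scale_left positive_span.positive_span_scale)
qed

section \<open>Star homomorphisms and polarisation\<close>

lemma unital_star_homD: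
  assumes "unital_star_hom F"
  shows "F (x + y) = F x + F y" "F (c *\<^sub>C x) = c *\<^sub>C F x" "F (x * y) = F x * F y"
    "F (star x) = star (F x)" "F 1 = 1" "F 0 = 0" "F (- x) = - F x" "F (x - y) = F x - F y"
    "F (r *\<^sub>R x) = r *\<^sub>R F x" "F (sum g I) = (\<Sum>i\<in>I. F (g i))"
proof -
  show add: "F (x + y) = F x + F y" and sc: "F (c *\<^sub>C x) = c *\<^sub>C F x"
    and "F (x * y) = F x * F y" "F (star x) = star (F x)" "F 1 = 1" for x y c
    using assms by (auto simp: unital_star_hom_def clinear_map_def)
  show z: "F 0 = 0" using sc[of 0 0] by simp
  show m: "F (- x) = - F x" for x using sc[of "-1" x] by simp
  show "F (x - y) = F x - F y" using add[of x "-y"] m by simp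
  show "F (r *\<^sub>R x) = r *\<^sub>R F x" by (simp add: scaleR_eq_scaleC sc)
  show "F (sum g I) = (\<Sum>i\<in>I. F (g i))"
    by (induction I rule: infinite_finite_induct) (auto simp: add z)
qed

lemma unital_star_hom_id: "unital_star_hom id"
  by (simp add: unital_star_hom_def clinear_map_def)

lemma positive_functional_hom:
  assumes f: "positive_functional f" and F: "unital_star_hom F"
  shows "positive_functional (\<lambda>a. f (star m * F a * m))"
proof -
  note lin = clinear_functional_simps[OF positive_functional_clinear[OF f]]
  have "f (star m * F (star x * x) * m) \<in> \<real>\<^sub>\<ge>\<^sub>0" for x
  proof -
    have "star m * F (star x * x) * m = star (F x * m) * (F x * m)"
      by (simp add: unital_star_homD[OF F] star_mult mult.assoc)
    then show ?thesis using f by (simp add: positive_functional_def)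
  qed
  then show ?thesis
    by (simp add: positive_functional_def clinear_functional_def unital_star_homD[OF F]
        distrib_left distrib_right scaleC_mult_left scaleC_mult_right lin)
qed

lemma state_hom: "state f \<Longrightarrow> unital_star_hom F \<Longrightarrow> state (\<lambda>a. f (F a))"
  using positive_functional_hom[of f F 1] by (simp add: state_iff unital_star_homD(5))

text \<open>Polarisation with p = star y: the functional q m is positive, and the sum of c * q (z +
  c p) over the fourth roots of unity c kills all terms except 4 f (y * F a * z).\<close>

lemma positive_span_hom:
  assumes f: "positive_span f" and F: "unital_star_hom F"
  shows "positive_span (\<lambda>a. f (y * F a * z))"
  using f
proof induction
  case (positive_span_base f)
  note lin = clinear_functional_simps[OF positive_functional_clinear[OF positive_span_base]]
  define q where "q m a = f (star m * F a * m)" for m a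
  define p where "p = star y"
  have q: "positive_span (q m)" for m
    unfolding q_def
    by (rule positive_span.positive_span_base[OF positive_functional_hom[OF positive_span_base F]])
  have "q (z + c *\<^sub>C p) a = f (star z * F a * z) + c * f (star z * F a * p) + cnj c * f (y * F a * z)
      + c * cnj c * f (y * F a * p)" for c a
    by (simp add: q_def p_def star_star star_add star_scaleC distrib_left distrib_right
        scaleC_mult_left scaleC_mult_right scaleC_scaleC lin mult.assoc add.assoc)
  then have "(\<lambda>a. f (y * F a * z)) = (\<lambda>a. (1/4) * (q (z + 1 *\<^sub>C p) a + \<i> * q (z + \<i> *\<^sub>C p) a
      + (- 1) * q (z + (- 1) *\<^sub>C p) a + (- \<i>) * q (z + (- \<i>) *\<^sub>C p) a))"
    by (simp only:) (simp add: algebra_simps)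
  then show ?case
    by (simp only:) (intro q positive_span.intros(2,3))
next
  case (positive_span_add f g)
  show ?case by (rule positive_span.positive_span_add[OF positive_span_add.IH])
next
  case (positive_span_scale f c)
  show ?case by (rule positive_span.positive_span_scale[OF positive_span_scale.IH])
qed

lemma min_tensor_norm: "min_tensor t \<Longrightarrow> ennreal (norm (alg_sum t xs)) = spatial_norm xs"
  unfolding min_tensor_def by (elim conjE) (erule spec)

section \<open>Tensor products of homomorphisms\<close>

text \<open>For states \<open>f\<close>, \<open>g\<close> and \<open>y\<close> with \<open>(f \<otimes> g)(y\<^sup>*y) = 1\<close>, the functional \<open>x \<mapsto> (f \<otimes> g)(y\<^sup>* (F \<otimes> G)(x) y)\<close> is by
  polarisation a combination of products of states, so it extends to a state, and a state is
  automatically contractive.\<close>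

lemma tensor_hom_contraction:
  fixes t :: "'a::cstar_algebra \<Rightarrow> 'b::cstar_algebra \<Rightarrow> 'c::cstar_algebra"
    and t' :: "'d::cstar_algebra \<Rightarrow> 'e::cstar_algebra \<Rightarrow> 'f::cstar_algebra"
  assumes t: "min_tensor t" and t': "min_tensor t'"
    and F: "unital_star_hom F" and G: "unital_star_hom G"
  shows "norm (alg_sum (\<lambda>a b. t' (F a) (G b)) xs) \<le> norm (alg_sum t xs)"
proof -
  define \<beta> where "\<beta> a b = t' (F a) (G b)" for a b
  define xs' where "xs' = map (\<lambda>(a, b). (F a, G b)) xs"
  have \<beta>xs: "alg_sum \<beta> zs = alg_sum t' (map (\<lambda>(a, b). (F a, G b)) zs)" for zs
    by (induction zs) (auto simp: \<beta>_def)
  have \<beta>_star_mult: "alg_sum \<beta> (alg_mult (alg_star zs) zs) = star (alg_sum \<beta> zs) * alg_sum \<beta> zs" for zs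
  proof -
    have 1: "alg_star (map (\<lambda>(a, b). (F a, G b)) zs) = map (\<lambda>(a, b). (F a, G b)) (alg_star zs)" for zs
      by (induction zs) (auto simp: unital_star_homD[OF F] unital_star_homD[OF G])
    have 2: "alg_mult (map (\<lambda>(a, b). (F a, G b)) ys) (map (\<lambda>(a, b). (F a, G b)) zs) =
      map (\<lambda>(a, b). (F a, G b)) (alg_mult ys zs)" for ys zs
      by (auto simp: alg_mult_def map_concat comp_def case_prod_beta
          unital_star_homD[OF F] unital_star_homD[OF G])
    show ?thesis
      unfolding \<beta>xs by (simp add: alg_sum_star[OF t', symmetric] alg_sum_mult[OF t', symmetric] 1 2)
  qed
  have "spatial_norm xs' \<le> ennreal (norm (alg_sum t xs))"
    unfolding spatial_norm_def
  proof (rule Sup_least, clarify)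
    fix f :: "'d \<Rightarrow> complex" and g :: "'e \<Rightarrow> complex" and ys
    assume f: "state f" and g: "state g"
      and ys: "alg_sum (\<lambda>a b. f a * g b) (alg_mult (alg_star ys) ys) = 1"
    define \<Psi> where "\<Psi> = product_functional t' f g"
    have \<Psi>: "state \<Psi>" unfolding \<Psi>_def by (rule state_product[OF t' f g])
    then have \<Psi>': "positive_functional \<Psi>" by (simp add: state_iff)
    note lin = clinear_functional_simps[OF positive_functional_clinear[OF \<Psi>']]
    have \<Psi>_tensor: "\<Psi> (t' a b) = f a * g b" for a b
      unfolding \<Psi>_def by (rule product_functional_tensor[OF t' f[THEN positive_span_state]
            g[THEN positive_span_state]])
    have \<Psi>_alg: "\<Psi> (alg_sum t' zs) = alg_sum (\<lambda>a b. f a * g b) zs" for zs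
      by (simp add: bounded_linear_alg_sum[OF bounded_linear_positive_functional[OF \<Psi>']] \<Psi>_tensor)
    define Y where "Y = alg_sum t' ys"
    \<comment> \<open>Between elementary tensors the functional splits into a product of two members
      of the span. General outer factors are sums of these, added up here for the right factor and
      below for the left one.\<close>
    have step: "\<exists>\<Theta>. bounded_linear \<Theta> \<and> (\<forall>a b. \<Theta> (t a b) = \<Psi> (t' p q * \<beta> a b * alg_sum t' zs))" for p q zs
    proof (induction zs)
      case Nil
      show ?case by (intro exI[of _ "\<lambda>_. 0"]) (auto simp: lin)
    next
      case (Cons z zs)
      then obtain \<Theta> where \<Theta>: "bounded_linear \<Theta>"
        "\<And>a b. \<Theta> (t a b) = \<Psi> (t' p q * \<beta> a b * alg_sum t' zs)" by blast
      let ?f = "\<lambda>a. f (p * F a * fst z)" and ?g = "\<lambda>b. g (q * G b * snd z)"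
      have sp: "positive_span ?f" "positive_span ?g"
        using positive_span_hom f g F G positive_span_state by blast+
      show ?case
        by (intro exI[of _ "\<lambda>X. product_functional t ?f ?g X + \<Theta> X"] conjI bounded_linear_add
            bounded_linear_product_functional t sp \<Theta>(1))
          (simp add: product_functional_tensor[OF t sp] \<Theta>(2) \<beta>_def min_tensorD[OF t'] lin
            \<Psi>_tensor distrib_left)
    qed
    have "\<exists>\<Theta>. bounded_linear \<Theta> \<and> (\<forall>a b. \<Theta> (t a b) = \<Psi> (alg_sum t' ws * \<beta> a b * alg_sum t' zs))" for ws zs
    proof (induction ws)
      case Nil
      show ?case by (intro exI[of _ "\<lambda>_. 0"]) (auto simp: lin)
    next
      case (Cons w ws)
      then obtain \<Theta> where \<Theta>: "bounded_linear \<Theta>"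
        "\<And>a b. \<Theta> (t a b) = \<Psi> (alg_sum t' ws * \<beta> a b * alg_sum t' zs)" by blast
      obtain \<Theta>' where \<Theta>': "bounded_linear \<Theta>'"
        "\<And>a b. \<Theta>' (t a b) = \<Psi> (t' (fst w) (snd w) * \<beta> a b * alg_sum t' zs)" using step by blast
      show ?case
        by (intro exI[of _ "\<lambda>X. \<Theta>' X + \<Theta> X"] conjI bounded_linear_add \<Theta>(1) \<Theta>'(1))
          (simp add: \<Theta>(2) \<Theta>'(2) lin distrib_right)
    qed
    from this[of "alg_star ys" ys] obtain \<Theta> where \<Theta>: "bounded_linear \<Theta>"
      "\<And>a b. \<Theta> (t a b) = \<Psi> (star Y * \<beta> a b * Y)"
      by (auto simp: alg_sum_star[OF t'] Y_def)
    have \<Theta>_alg: "\<Theta> (alg_sum t zs) = \<Psi> (star Y * alg_sum \<beta> zs * Y)" for zs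
      by (induction zs) (auto simp: linear_0 linear_add bounded_linear.linear[OF \<Theta>(1)] \<Theta>(2) lin
          distrib_left distrib_right)
    have \<Theta>_square: "\<Theta> (star (alg_sum t zs) * alg_sum t zs) =
        \<Psi> (star (alg_sum \<beta> zs * Y) * (alg_sum \<beta> zs * Y))" for zs
      by (simp only: alg_sum_star[OF t, symmetric] alg_sum_mult[OF t, symmetric] \<Theta>_alg
          \<beta>_star_mult star_mult mult.assoc)
    have "positive_functional \<Theta>"
    proof (rule positive_functional_min_tensorI[OF t \<Theta>(1)])
      show "\<Theta> (t (c *\<^sub>C a) b) = c * \<Theta> (t a b)" for c a b
        by (simp add: \<Theta>(2) \<beta>_def unital_star_homD[OF F] min_tensorD[OF t'] scaleC_mult_left
            scaleC_mult_right lin)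
      show "\<Theta> (star (alg_sum t zs) * alg_sum t zs) \<in> \<real>\<^sub>\<ge>\<^sub>0" for zs
        using \<Psi>' unfolding \<Theta>_square positive_functional_def by blast
    qed
    moreover have "\<Theta> 1 = 1"
    proof -
      have "\<Theta> 1 = \<Psi> (star Y * Y)"
        using \<Theta>(2)[of 1 1]
        by (simp add: min_tensorD[OF t] min_tensorD[OF t'] \<beta>_def unital_star_homD[OF F] unital_star_homD[OF G])
      then show ?thesis
        using ys by (simp add: Y_def alg_sum_star[OF t', symmetric] alg_sum_mult[OF t', symmetric] \<Psi>_alg)
    qed
    \<comment> \<open>The bound for the state \<Theta> at a square is the estimate for the member of
      the supremum that belongs to f, g and ys.\<close>
    ultimately have "Re (\<Theta> (star (alg_sum t xs) * alg_sum t xs)) \<le> (norm (alg_sum t xs))\<^sup>2"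
      using positive_functional_square_bound[of \<Theta> "alg_sum t xs"] by simp
    also have "\<Theta> (star (alg_sum t xs) * alg_sum t xs) = alg_sum (\<lambda>a b. f a * g b)
        (alg_mult (alg_star ys) (alg_mult (alg_star xs') (alg_mult xs' ys)))"
      unfolding \<Theta>_square \<Psi>_alg[symmetric]
      by (simp add: alg_sum_star[OF t'] alg_sum_mult[OF t'] \<beta>xs xs'_def Y_def star_mult mult.assoc)
    finally show "ennreal (sqrt (Re (alg_sum (\<lambda>a b. f a * g b)
        (alg_mult (alg_star ys) (alg_mult (alg_star xs') (alg_mult xs' ys))))))
        \<le> ennreal (norm (alg_sum t xs))"
      by (intro ennreal_leI real_le_lsqrt) auto
  qed
  moreover have "spatial_norm xs' = ennreal (norm (alg_sum t' xs'))"
    using t' by (simp add: min_tensor_def)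
  ultimately show ?thesis
    by (simp add: ennreal_le_iff \<beta>xs[unfolded \<beta>_def] xs'_def)
qed

text \<open>Contractivity on formal sums gives existence and density gives uniqueness, so the
  definite description behind \<open>tensor_map\<close> denotes.\<close>

lemma tensor_map:
  fixes t :: "'a::cstar_algebra \<Rightarrow> 'b::cstar_algebra \<Rightarrow> 'c::cstar_algebra"
    and t' :: "'d::cstar_algebra \<Rightarrow> 'e::cstar_algebra \<Rightarrow> 'f::cstar_algebra"
  assumes t: "min_tensor t" and t': "min_tensor t'"
    and F: "unital_star_hom F" and G: "unital_star_hom G"
  shows bounded_linear_tensor_map: "bounded_linear (tensor_map t t' F G)"
    and tensor_map_tensor: "tensor_map t t' F G (t a b) = t' (F a) (G b)"
proof -
  have "\<exists>!\<Phi>. bounded_linear \<Phi> \<and> (\<forall>a b. \<Phi> (t a b) = t' (F a) (G b))"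
  proof (rule ex_ex1I)
    show "\<exists>\<Phi>. bounded_linear \<Phi> \<and> (\<forall>a b. \<Phi> (t a b) = t' (F a) (G b))"
    proof (rule min_tensor_extension[OF t])
      show "norm (alg_sum (\<lambda>a b. t' (F a) (G b)) xs) \<le> 1 * norm (alg_sum t xs)" for xs
        using tensor_hom_contraction[OF assms] by simp
    qed (simp_all add: unital_star_homD[OF F] scaleR_eq_scaleC[where 'a = 'd]
        scaleR_eq_scaleC[where 'a = 'f] min_tensorD[OF t'])
    show "\<Phi> = \<Psi>"
      if "bounded_linear \<Phi> \<and> (\<forall>a b. \<Phi> (t a b) = t' (F a) (G b))"
        "bounded_linear \<Psi> \<and> (\<forall>a b. \<Psi> (t a b) = t' (F a) (G b))" for \<Phi> \<Psi>
      by (rule ext, rule min_tensor_eqI[OF t, of \<Phi> \<Psi>]) (simp_all add: that)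
  qed
  from theI'[OF this] show "bounded_linear (tensor_map t t' F G)"
    "tensor_map t t' F G (t a b) = t' (F a) (G b)"
    unfolding tensor_map_def by auto
qed

text \<open>For a \<noteq> 0 the element a \<otimes> 1 has positive spatial norm, so some f, g and y
  make f \<otimes> g nonzero at star y * (star a * a \<otimes> 1) * y. Replacing the factor a there
  by a variable w gives a functional in the span of the states that does not vanish at a.\<close>

lemma states_separate:
  fixes t :: "'a::cstar_algebra \<Rightarrow> 'b::cstar_algebra \<Rightarrow> 'c::cstar_algebra" and a :: 'a
  assumes t: "min_tensor t" and a: "\<And>f. state f \<Longrightarrow> f a = 0"
  shows "a = 0"
proof (rule ccontr)
  assume "a \<noteq> 0"
  define F where "F w = t w 1" for w
  have F: "unital_star_hom F"
    by (simp add: F_def unital_star_hom_def clinear_map_def min_tensorD[OF t])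
  have "F a \<noteq> 0" using min_tensor_left_cancel[OF t] \<open>a \<noteq> 0\<close> by (auto simp: F_def)
  then have "0 < ennreal (norm (alg_sum t [(a, 1)]))" by (simp add: F_def)
  also have "\<dots> = spatial_norm [(a, 1::'b)]" by (rule min_tensor_norm[OF t])
  finally obtain f g ys where f: "state f" and g: "state g"
    and pos: "0 < ennreal (sqrt (Re (alg_sum (\<lambda>a b. f a * g b)
       (alg_mult (alg_star ys) (alg_mult (alg_star [(a, 1::'b)]) (alg_mult [(a, 1)] ys))))))"
    unfolding spatial_norm_def less_Sup_iff by blast
  define \<Psi> where "\<Psi> = product_functional t f g"
  note sp = positive_span_state[OF f] positive_span_state[OF g]
  have "\<Psi> (alg_sum t zs) = alg_sum (\<lambda>a b. f a * g b) zs" for zs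
    unfolding \<Psi>_def
    by (simp add: bounded_linear_alg_sum[OF bounded_linear_product_functional[OF t sp]]
        product_functional_tensor[OF t sp])
  note this[symmetric]
  with pos have "\<Psi> (star (alg_sum t ys) * star (F a) * F a * alg_sum t ys) \<noteq> 0"
    by (auto simp: alg_sum_mult[OF t] alg_sum_star[OF t] min_tensorD(6)[OF t] F_def mult.assoc)
  moreover have "positive_span (\<lambda>w. \<Psi> (star (alg_sum t ys) * star (F a) * F w * alg_sum t ys))"
    unfolding \<Psi>_def by (rule positive_span_hom[OF positive_span_product[OF t sp] F])
  moreover have "h a = 0" if "positive_span h" for h
    using that
  proof induction
    case (positive_span_base h)
    show ?case
    proof (cases "h 1 = 0")
      case True
      then show ?thesis by (rule positive_functional_zero[OF positive_span_base])
    next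
      case False
      then show ?thesis using positive_functional_normalize[OF positive_span_base False] a by auto
    qed
  qed auto
  ultimately show False by blast
qed

text \<open>A unit vector y of the product representation compresses f \<otimes> g to the state w
  \<mapsto> (f \<otimes> g)(star y * (w \<otimes> 1) * y), which the norm of w bounds. The estimate
  serves the continuity of \<open>t\<close> in its left argument.\<close>

lemma norm_tensor_one_le:
  fixes t :: "'a::cstar_algebra \<Rightarrow> 'b::cstar_algebra \<Rightarrow> 'c::cstar_algebra"
  assumes t: "min_tensor t"
  shows "norm (t a 1) \<le> norm a"
proof -
  define F where "F w = t w 1" for w
  have F: "unital_star_hom F"
    by (simp add: F_def unital_star_hom_def clinear_map_def min_tensorD[OF t])
  have "spatial_norm [(a, 1::'b)] \<le> ennreal (norm a)"
    unfolding spatial_norm_def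
  proof (rule Sup_least, clarify)
    fix f :: "'a \<Rightarrow> complex" and g :: "'b \<Rightarrow> complex" and ys
    assume f: "state f" and g: "state g"
      and ys: "alg_sum (\<lambda>a b. f a * g b) (alg_mult (alg_star ys) ys) = 1"
    define \<Psi> where "\<Psi> = product_functional t f g"
    note sp = positive_span_state[OF f] positive_span_state[OF g]
    have \<Psi>_alg: "\<Psi> (alg_sum t zs) = alg_sum (\<lambda>a b. f a * g b) zs" for zs
      unfolding \<Psi>_def
      by (simp add: bounded_linear_alg_sum[OF bounded_linear_product_functional[OF t sp]]
          product_functional_tensor[OF t sp])
    define Y where "Y = alg_sum t ys"
    define \<theta> where "\<theta> w = \<Psi> (star Y * F w * Y)" for w
    have "positive_functional \<theta>"
      using state_product[OF t f g] F unfolding \<theta>_def \<Psi>_def[symmetric] state_iff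
      by (blast intro: positive_functional_hom)
    moreover have "\<theta> 1 = 1"
      using ys by (simp add: \<theta>_def unital_star_homD[OF F] Y_def alg_sum_star[OF t, symmetric]
          alg_sum_mult[OF t, symmetric] \<Psi>_alg)
    ultimately have "Re (\<theta> (star a * a)) \<le> (norm a)\<^sup>2"
      using positive_functional_square_bound[of \<theta> a] by simp
    also have "\<theta> (star a * a) = alg_sum (\<lambda>a b. f a * g b)
        (alg_mult (alg_star ys) (alg_mult (alg_star [(a, 1)]) (alg_mult [(a, 1)] ys)))"
      unfolding \<Psi>_alg[symmetric]
      by (simp add: \<theta>_def F_def Y_def alg_sum_star[OF t] alg_sum_mult[OF t] min_tensorD[OF t]
          mult.assoc[symmetric])
    finally show "ennreal (sqrt (Re (alg_sum (\<lambda>a b. f a * g b)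
        (alg_mult (alg_star ys) (alg_mult (alg_star [(a, 1)]) (alg_mult [(a, 1)] ys))))))
        \<le> ennreal (norm a)"
      by (intro ennreal_leI real_le_lsqrt) auto
  qed
  then have "ennreal (norm (t a 1)) \<le> ennreal (norm a)"
    using min_tensor_norm[OF t, of "[(a, 1)]"] by simp
  then show ?thesis by (simp add: ennreal_le_iff)
qed

lemma bounded_linear_tensor_left:
  fixes t :: "'a::cstar_algebra \<Rightarrow> 'b::cstar_algebra \<Rightarrow> 'c::cstar_algebra"
  assumes t: "min_tensor t"
  shows "bounded_linear (\<lambda>a. t a b)"
proof (rule bounded_linear_intro[of _ "norm (t 1 b)"])
  show "norm (t a b) \<le> norm a * norm (t 1 b)" for a
  proof -
    have "t a b = t a 1 * t 1 b" by (simp add: min_tensorD[OF t])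
    then have "norm (t a b) \<le> norm (t a 1) * norm (t 1 b)" by (simp add: norm_mult_ineq)
    also have "\<dots> \<le> norm a * norm (t 1 b)"
      by (intro mult_right_mono norm_tensor_one_le[OF t]) simp
    finally show ?thesis .
  qed
qed (simp_all add: min_tensorD[OF t] scaleR_eq_scaleC)

lemma norm_tensor_map_le:
  assumes "min_tensor t" "min_tensor t'" "unital_star_hom F" "unital_star_hom G"
  shows "norm (tensor_map t t' F G X) \<le> norm X"
proof (rule min_tensor_closed_induct[OF assms(1), where P = "\<lambda>X. norm (tensor_map t t' F G X) \<le> norm X"])
  show "closed {X. norm (tensor_map t t' F G X) \<le> norm X}"
    by (intro closed_Collect_le continuous_on_norm continuous_on_id
        bounded_linear.continuous_on[OF bounded_linear_tensor_map[OF assms]])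
  show "norm (tensor_map t t' F G (alg_sum t xs)) \<le> norm (alg_sum t xs)" for xs
    using tensor_hom_contraction[OF assms]
    by (simp add: bounded_linear_alg_sum[OF bounded_linear_tensor_map[OF assms]]
        tensor_map_tensor[OF assms])
qed

section \<open>Cauchy-Schwarz estimates and slice maps\<close>

lemma state_Cauchy_Schwarz:
  assumes "state f"
  shows "cmod (f (x * y)) \<le> sqrt (Re (f (x * star x))) * sqrt (Re (f (star y * y)))"
proof -
  have f: "positive_functional f" using assms by (simp add: state_iff)
  have "(cmod (f (x * y)))\<^sup>2 \<le> Re (f (x * star x)) * Re (f (star y * y))"
    using positive_functional_sesquilinear(2)[OF f, of "star x" y] by (simp add: star_star)
  then show ?thesis by (simp add: real_le_rsqrt real_sqrt_mult[symmetric])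
qed

lemma state_square_bound: "state f \<Longrightarrow> Re (f (star x * x)) \<le> (norm x)\<^sup>2"
  using positive_functional_square_bound[of f x] by (simp add: state_iff)

lemma state_bound: "state f \<Longrightarrow> cmod (f x) \<le> norm x"
  using positive_functional_bound[of f x] by (simp add: state_iff)

lemma positive_span_left_mult: "positive_span f \<Longrightarrow> positive_span (\<lambda>x. f (c * x))"
  using positive_span_hom[OF _ unital_star_hom_id, of f c 1] by simp

lemma product_functional_left_mult:
  fixes t :: "'a::cstar_algebra \<Rightarrow> 'b::cstar_algebra \<Rightarrow> 'c::cstar_algebra"
  assumes t: "min_tensor t" and f: "positive_span f" and g: "positive_span g"
  shows "product_functional t (\<lambda>x. f (c * x)) g X = product_functional t f g (t c 1 * X)"
  by (rule product_functional_eqI[OF t positive_span_left_mult[OF f] g])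
    (auto simp: product_functional_tensor[OF t f g] min_tensorD[OF t]
      intro: bounded_linear_compose[OF bounded_linear_product_functional[OF t f g]
        bounded_linear_mult_right])

text \<open>The functional x \<mapsto> f (c * x) need not be positive, so the Cauchy-Schwarz
  inequality is applied to the state f \<otimes> g at c \<otimes> 1 and X. Keeping f (c * star c) in
  place of the norm of c is what makes the bound usable when c is the adjoint of a slice.\<close>

lemma product_functional_left_mult_bound:
  fixes t :: "'a::cstar_algebra \<Rightarrow> 'b::cstar_algebra \<Rightarrow> 'c::cstar_algebra"
  assumes t: "min_tensor t" and f: "state f" and g: "state g"
  shows "cmod (product_functional t (\<lambda>x. f (c * x)) g X) \<le> sqrt (Re (f (c * star c))) * norm X"
proof -
  note sp = positive_span_state[OF f] positive_span_state[OF g]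
  let ?\<Psi> = "product_functional t f g"
  have \<Psi>: "state ?\<Psi>" by (rule state_product[OF t f g])
  have "cmod (?\<Psi> (t c 1 * X)) \<le> sqrt (Re (?\<Psi> (t c 1 * star (t c 1)))) * sqrt (Re (?\<Psi> (star X * X)))"
    by (rule state_Cauchy_Schwarz[OF \<Psi>])
  also have "?\<Psi> (t c 1 * star (t c 1)) = f (c * star c)"
    using g by (simp add: min_tensorD[OF t] product_functional_tensor[OF t sp] state_iff)
  also have "sqrt (Re (f (c * star c))) * sqrt (Re (?\<Psi> (star X * X))) \<le> sqrt (Re (f (c * star c))) * norm X"
  proof (intro mult_left_mono)
    show "sqrt (Re (?\<Psi> (star X * X))) \<le> norm X"
      by (rule real_le_lsqrt) (use state_square_bound[OF \<Psi>] in auto)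
    show "0 \<le> sqrt (Re (f (c * star c)))"
      using f positive_functionalD(1)[of f "star c"] by (simp add: state_iff star_star)
  qed
  finally show ?thesis by (simp add: product_functional_left_mult[OF t sp])
qed

text \<open>The slice map id \<otimes> h, on formal sums, where it is a finite combination of left
  entries.\<close>

definition slice :: "('b \<Rightarrow> complex) \<Rightarrow> ('a \<times> 'b) list \<Rightarrow> 'a::cstar_algebra" where
  "slice h = alg_sum (\<lambda>p q. h q *\<^sub>C p)"

lemma functional_slice:
  fixes t :: "'a::cstar_algebra \<Rightarrow> 'b::cstar_algebra \<Rightarrow> 'c::cstar_algebra"
  assumes t: "min_tensor t" and f: "positive_span f" and h: "positive_span h"
  shows "f (slice h xs) = product_functional t f h (alg_sum t xs)"
proof -
  note lin = clinear_functional_simps[OF positive_span_clinear[OF f]]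
  show ?thesis
    unfolding slice_def bounded_linear_alg_sum[OF bounded_linear_product_functional[OF t f h]]
    by (induction xs) (auto simp: lin product_functional_tensor[OF t f h] mult.commute)
qed

text \<open>Since \<open>f (b\<^sup>*b) = (f (b\<^sup>* \<cdot>) \<otimes> h) X\<close>, the Cauchy-Schwarz inequality bounds \<open>f (b\<^sup>*b)\<close> by its own
  square root. A bound on the norm of \<open>b\<close> would need states attaining the norm.\<close>

lemma slice_bound:
  fixes t :: "'a::cstar_algebra \<Rightarrow> 'b::cstar_algebra \<Rightarrow> 'c::cstar_algebra"
    and xs :: "('a \<times> 'b) list"
  assumes t: "min_tensor t" and f: "state f" and h: "state h"
  defines "b \<equiv> slice h xs"
  shows "0 \<le> Re (f (star b * b))" "sqrt (Re (f (star b * b))) \<le> norm (alg_sum t xs)"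
    "Re (f (star b * b)) \<le> (norm (alg_sum t xs))\<^sup>2"
proof -
  have pf: "positive_functional f" using f by (simp add: state_iff)
  define r where "r = Re (f (star b * b))"
  show r0: "0 \<le> Re (f (star b * b))" by (rule positive_functionalD(1)[OF pf])
  have "r \<le> cmod (f (star b * b))" unfolding r_def by (rule complex_Re_le_cmod)
  also have "f (star b * b) = product_functional t (\<lambda>x. f (star b * x)) h (alg_sum t xs)"
    using functional_slice[OF t positive_span_left_mult[OF positive_span_state[OF f]]
        positive_span_state[OF h], of "star b" xs] by (simp add: b_def)
  also have "cmod \<dots> \<le> sqrt (Re (f (star b * star (star b)))) * norm (alg_sum t xs)"
    by (rule product_functional_left_mult_bound[OF t f h])
  finally have "sqrt r * sqrt r \<le> sqrt r * norm (alg_sum t xs)"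
    using r0 by (simp add: star_star r_def[symmetric])
  note le = this
  show *: "sqrt (Re (f (star b * b))) \<le> norm (alg_sum t xs)"
  proof (cases "r > 0")
    case True
    with le show ?thesis unfolding r_def[symmetric] by (intro mult_left_le_imp_le[OF le]) simp
  next
    case False
    with r0 show ?thesis by (simp add: r_def)
  qed
  show "Re (f (star b * b)) \<le> (norm (alg_sum t xs))\<^sup>2"
    using power_mono[OF *, of 2] r0 by simp
qed

section \<open>Ergodicity of the comultiplication\<close>

text \<open>The argument is the one by which Van Daele constructs the Haar state, run with the Cesaro
  means of the convolution powers of a state instead of with a limit point of them.\<close>

context compact_quantum_group
begin

section \<open>Convolution of functionals\<close>

definition convolution :: "('a \<Rightarrow> complex) \<Rightarrow> ('a \<Rightarrow> complex) \<Rightarrow> 'a \<Rightarrow> complex" where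
  "convolution f g a = product_functional t f g (\<Delta> a)"

lemma positive_span_convolution:
  "positive_span f \<Longrightarrow> positive_span g \<Longrightarrow> positive_span (convolution f g)"
  using positive_span_hom[OF positive_span_product[OF tensor2] comult_hom, of f g 1 1]
  by (simp add: convolution_def[abs_def])

lemma state_convolution: "state f \<Longrightarrow> state g \<Longrightarrow> state (convolution f g)"
  using state_hom[OF state_product[OF tensor2] comult_hom, of f g]
  by (simp add: convolution_def[abs_def])

text \<open>Moves the comultiplication from the functional to the argument, where
  \<open>coassoc\<close> can act; with its mirror image this leads to associativity of
  convolution.\<close>

lemma product_functional_comult_left:
  assumes f: "positive_span f" and g: "positive_span g"
  shows "product_functional t (\<lambda>a. f (\<Delta> a)) g X =
    product_functional tl f g (tensor_map t tl \<Delta> id X)"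
proof (rule product_functional_eqI[OF tensor2 _ g])
  note tm = tensor2 tensor3_left comult_hom unital_star_hom_id
  show "positive_span (\<lambda>a. f (\<Delta> a))" using positive_span_hom[OF f comult_hom, of 1 1] by simp
  show "bounded_linear (\<lambda>X. product_functional tl f g (tensor_map t tl \<Delta> id X))"
    by (rule bounded_linear_compose[OF bounded_linear_product_functional[OF tensor3_left f g]
          bounded_linear_tensor_map[OF tm]])
  show "product_functional tl f g (tensor_map t tl \<Delta> id (t a b)) = f (\<Delta> a) * g b" for a b
    by (simp add: tensor_map_tensor[OF tm] product_functional_tensor[OF tensor3_left f g])
qed

lemma product_functional_comult_right:
  assumes f: "positive_span f" and g: "positive_span g"
  shows "product_functional t f (\<lambda>a. g (\<Delta> a)) X =
    product_functional tr f g (tensor_map t tr id \<Delta> X)"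
proof (rule product_functional_eqI[OF tensor2 f])
  note tm = tensor2 tensor3_right unital_star_hom_id comult_hom
  show "positive_span (\<lambda>a. g (\<Delta> a))" using positive_span_hom[OF g comult_hom, of 1 1] by simp
  show "bounded_linear (\<lambda>X. product_functional tr f g (tensor_map t tr id \<Delta> X))"
    by (rule bounded_linear_compose[OF bounded_linear_product_functional[OF tensor3_right f g]
          bounded_linear_tensor_map[OF tm]])
  show "product_functional tr f g (tensor_map t tr id \<Delta> (t a b)) = f a * g (\<Delta> b)" for a b
    by (simp add: tensor_map_tensor[OF tm] product_functional_tensor[OF tensor3_right f g])
qed

text \<open>Uniqueness of the extension is used twice, because the left leg of \<open>tl\<close> is
  itself a completed tensor product; on a \<otimes> b \<otimes> c the two sides agree by
  \<open>tensor3_assoc\<close>.\<close>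

lemma product_functional_assoc:
  assumes f: "positive_span f" and g: "positive_span g" and h: "positive_span h"
  shows "product_functional tl (product_functional t f g) h Z =
    product_functional tr f (product_functional t g h) Z"
proof (rule product_functional_eqI[OF tensor3_left positive_span_product[OF tensor2 f g] h])
  note gh = positive_span_product[OF tensor2 g h]
  show bl: "bounded_linear (product_functional tr f (product_functional t g h))"
    by (rule bounded_linear_product_functional[OF tensor3_right f gh])
  show "product_functional tr f (product_functional t g h) (tl W c) = product_functional t f g W * h c" for W c
  proof (rule min_tensor_eqI[OF tensor2, of "\<lambda>W. product_functional tr f (product_functional t g h) (tl W c)"
        "\<lambda>W. product_functional t f g W * h c"])
    show "bounded_linear (\<lambda>W. product_functional tr f (product_functional t g h) (tl W c))"
      by (rule bounded_linear_compose[OF bl bounded_linear_tensor_left[OF tensor3_left]])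
    show "bounded_linear (\<lambda>W. product_functional t f g W * h c)"
      by (rule bounded_linear_mult_const[OF bounded_linear_product_functional[OF tensor2 f g]])
  qed (simp add: tensor3_assoc product_functional_tensor tensor2 tensor3_right f g h gh)
qed

lemma convolution_assoc:
  assumes f: "positive_span f" and g: "positive_span g" and h: "positive_span h"
  shows "convolution (convolution f g) h a = convolution f (convolution g h) a"
proof -
  have "convolution (convolution f g) h a =
      product_functional tl (product_functional t f g) h (tensor_map t tl \<Delta> id (\<Delta> a))"
    using product_functional_comult_left[OF positive_span_product[OF tensor2 f g] h]
    by (simp add: convolution_def[abs_def])
  also have "\<dots> = product_functional tr f (product_functional t g h) (tensor_map t tr id \<Delta> (\<Delta> a))"
    unfolding product_functional_assoc[OF f g h] coassoc ..
  also have "\<dots> = convolution f (convolution g h) a"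
    using product_functional_comult_right[OF f positive_span_product[OF tensor2 g h]]
    by (simp add: convolution_def[abs_def])
  finally show ?thesis .
qed

text \<open>As f (c * x) need not be positive in x, the convolution is first unfolded to f \<otimes>
  g \<otimes> h at (c \<otimes> 1 \<otimes> 1)(\<Delta> \<otimes> id)(X). There the Cauchy-Schwarz
  inequality applies, and \<Delta> \<otimes> id does not increase the norm.\<close>

lemma product_functional_convolution_bound:
  assumes f: "state f" and g: "state g" and h: "state h"
  shows "cmod (product_functional t (convolution (\<lambda>x. f (c * x)) g) h X)
    \<le> sqrt (Re (f (c * star c))) * norm X"
proof -
  note sp = positive_span_state[OF f] positive_span_state[OF g] positive_span_state[OF h]
  note tm = tensor2 tensor3_left comult_hom unital_star_hom_id
  let ?\<Psi> = "product_functional t f g"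
  have \<Psi>: "state ?\<Psi>" by (rule state_product[OF tensor2 f g])
  have "product_functional t (convolution (\<lambda>x. f (c * x)) g) h X =
      product_functional t (\<lambda>a. (\<lambda>W. ?\<Psi> (t c 1 * W)) (\<Delta> a)) h X"
    unfolding convolution_def[abs_def] product_functional_left_mult[OF tensor2 sp(1,2)] ..
  also have "\<dots> = product_functional tl (\<lambda>W. ?\<Psi> (t c 1 * W)) h (tensor_map t tl \<Delta> id X)"
    by (rule product_functional_comult_left[OF positive_span_left_mult[OF positive_span_state[OF \<Psi>]] sp(3)])
  finally have "cmod (product_functional t (convolution (\<lambda>x. f (c * x)) g) h X)
      \<le> sqrt (Re (?\<Psi> (t c 1 * star (t c 1)))) * norm (tensor_map t tl \<Delta> id X)"
    using product_functional_left_mult_bound[OF tensor3_left \<Psi> h] by simp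
  moreover have "?\<Psi> (t c 1 * star (t c 1)) = f (c * star c)"
    using g by (simp add: min_tensorD[OF tensor2] product_functional_tensor[OF tensor2 sp(1,2)] state_iff)
  moreover have "sqrt (Re (f (c * star c))) * norm (tensor_map t tl \<Delta> id X) \<le> sqrt (Re (f (c * star c))) * norm X"
    using f positive_functionalD(1)[of f "star c"]
    by (intro mult_left_mono norm_tensor_map_le tm) (simp add: state_iff star_star)
  ultimately show ?thesis by simp
qed

end

lemma min_tensor_approx:
  fixes t :: "'a::cstar_algebra \<Rightarrow> 'b::cstar_algebra \<Rightarrow> 'c::cstar_algebra"
  assumes t: "min_tensor t" and e: "e > 0"
  shows "\<exists>xs. norm (alg_sum t xs - X) < e"
proof -
  let ?S = "range (alg_sum t)"
  have "X \<in> closure ?S"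
    by (rule min_tensor_closed_induct[OF t, where P = "\<lambda>X. X \<in> closure ?S"])
      (use closure_subset[of ?S] in auto)
  then show ?thesis using e by (auto simp: closure_approachable dist_norm)
qed

lemma product_functional_weighted_sum:
  assumes t: "min_tensor t" and f: "\<And>k. k < n \<Longrightarrow> positive_span (f k)" and g: "positive_span g"
    and F: "positive_span (\<lambda>x. c * (\<Sum>k<n. f k x))"
  shows "product_functional t (\<lambda>x. c * (\<Sum>k<n. f k x)) g X = c * (\<Sum>k<(n::nat). product_functional t (f k) g X)"
  by (rule product_functional_eqI[OF t F g])
    (auto intro!: bounded_linear_const_mult bounded_linear_sum bounded_linear_product_functional t f g
      simp: product_functional_tensor[OF t f g] sum_distrib_right)

lemma product_functional_weighted_sum_right:
  assumes t: "min_tensor t" and f: "\<And>k. k < n \<Longrightarrow> positive_span (f k)" and g: "positive_span g"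
    and F: "positive_span (\<lambda>x. c * (\<Sum>k<n. f k x))"
  shows "product_functional t g (\<lambda>x. c * (\<Sum>k<n. f k x)) X = c * (\<Sum>k<(n::nat). product_functional t g (f k) X)"
  by (rule product_functional_eqI[OF t g F])
    (auto intro!: bounded_linear_const_mult bounded_linear_sum bounded_linear_product_functional t f g
      simp: product_functional_tensor[OF t g f] sum_distrib_left sum_distrib_right mult_ac)

text \<open>Invariance will be known up to d times a difference of states; this carries the error
  through the second leg.\<close>

lemma product_functional_perturbation:
  assumes t: "min_tensor t" and sp: "positive_span g" "positive_span h" "positive_span \<alpha>" "positive_span \<beta>"
  shows "product_functional t g (\<lambda>x. h x + d * (\<alpha> x - \<beta> x)) X = product_functional t g h X
    + d * (product_functional t g \<alpha> X - product_functional t g \<beta> X)"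
proof (rule product_functional_eqI[OF t sp(1)])
  have "positive_span (\<lambda>x. h x + d * (\<alpha> x + (-1) * \<beta> x))"
    by (intro positive_span.intros(2,3) sp)
  then show "positive_span (\<lambda>x. h x + d * (\<alpha> x - \<beta> x))" by simp
  show "bounded_linear (\<lambda>X. product_functional t g h X
    + d * (product_functional t g \<alpha> X - product_functional t g \<beta> X))"
    by (intro bounded_linear_add bounded_linear_const_mult bounded_linear_sub
        bounded_linear_product_functional t sp)
qed (simp add: product_functional_tensor[OF t] sp algebra_simps)

context compact_quantum_group
begin

text \<open>Van Daele's argument with explicit errors. The slice b approximates (id \<otimes>
  h)(\<Delta> a), and near-invariance of h makes D = \<Delta> b - b \<otimes> 1 small in the
  seminorm of h \<otimes> \<omega>, hence in that of h \<otimes> \<phi>. Pairing D with c \<otimes>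
  1 and undoing the slice gives the claim.\<close>

lemma approximate_invariance:
  assumes h: "state h" and \<omega>: "state \<omega>" and \<alpha>: "state \<alpha>" and \<beta>: "state \<beta>"
    and \<phi>: "state \<phi>" and \<phi>': "state \<phi>'" and avg: "\<And>x. \<omega> x = (\<phi> x + \<phi>' x) / 2"
    and h\<omega>: "\<And>x. convolution h \<omega> x = h x + of_real \<delta> * (\<alpha> x - \<beta> x)"
    and \<omega>h: "\<And>x. convolution \<omega> h x = h x + of_real \<delta> * (\<alpha> x - \<beta> x)"
    and \<delta>: "0 < \<delta>" "\<delta> \<le> 1"
  shows "cmod (product_functional t h (convolution \<phi> h) (t c 1 * \<Delta> a)
      - product_functional t h h (t c 1 * \<Delta> a))
    \<le> norm c * (2 * \<delta> + sqrt (18 * (norm (\<Delta> a) + 1)\<^sup>2 * \<delta>))"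
proof -
  \<comment> \<open>As \<delta> \<le> 1, N bounds the norms of both \<Delta> a and X; as N \<ge> 1,
    a multiple of N * \<delta> can be absorbed into N^2 * \<delta>.\<close>
  define N where "N = norm (\<Delta> a) + 1"
  \<comment> \<open>The precision \<delta> makes the approximation error of the same order as the
    failure of invariance.\<close>
  obtain xs where xs: "norm (alg_sum t xs - \<Delta> a) < \<delta>"
    using min_tensor_approx[OF tensor2 \<delta>(1)] by blast
  define X where "X = alg_sum t xs"
  define b where "b = slice h xs"
  have Xa: "norm (X - \<Delta> a) \<le> \<delta>" using xs by (simp add: X_def)
  have XN: "norm X \<le> N"
    using norm_triangle_ineq2[of X "\<Delta> a"] Xa \<delta>(2) by (simp add: N_def)
  have N1: "N \<ge> 1" "norm (\<Delta> a) \<le> N" by (simp_all add: N_def)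
  note sp = h[THEN positive_span_state] \<omega>[THEN positive_span_state] \<alpha>[THEN positive_span_state]
    \<beta>[THEN positive_span_state] \<phi>[THEN positive_span_state] \<phi>'[THEN positive_span_state]
  have slice: "f b = product_functional t f h X" if "positive_span f" for f
    unfolding b_def X_def by (rule functional_slice[OF tensor2 that sp(1)])
  have sq: "sqrt (Re (f (star b * b))) \<le> N" "0 \<le> Re (f (star b * b))" "Re (f (star b * b)) \<le> N\<^sup>2"
    if "state f" for f
  proof -
    note * = slice_bound[OF tensor2 that h, of xs, folded b_def X_def]
    from * XN show "sqrt (Re (f (star b * b))) \<le> N" "0 \<le> Re (f (star b * b))" by auto
    from *(3) power_mono[OF XN, of 2] show "Re (f (star b * b)) \<le> N\<^sup>2" by simp
  qed
  have pdiff: "product_functional t f g X = product_functional t f g (\<Delta> a)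
      + product_functional t f g (X - \<Delta> a)" if "positive_span f" "positive_span g" for f g
    using linear_diff[OF bounded_linear.linear[OF bounded_linear_product_functional[OF tensor2 that]]]
    by simp

  define D where "D = \<Delta> b - t b 1"
  define g where "g x = h (star b * x)" for x
  have g: "positive_span g" unfolding g_def by (rule positive_span_left_mult[OF sp(1)])
  have g_bound: "cmod (product_functional t g k Y) \<le> N * norm Y" if "state k" for k Y
  proof -
    have "cmod (product_functional t g k Y) \<le> sqrt (Re (h (star b * b))) * norm Y"
      using product_functional_left_mult_bound[OF tensor2 h that, of "star b" Y]
      unfolding g_def star_star .
    also have "\<dots> \<le> N * norm Y" by (intro mult_right_mono sq h) simp
    finally show ?thesis .
  qed
  have g\<omega>_bound: "cmod (product_functional t (convolution g \<omega>) h Y) \<le> N * norm Y" for Y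
  proof -
    have "cmod (product_functional t (convolution g \<omega>) h Y) \<le> sqrt (Re (h (star b * b))) * norm Y"
      using product_functional_convolution_bound[OF h \<omega> h, of "star b" Y]
      unfolding g_def[abs_def] star_star .
    also have "\<dots> \<le> N * norm Y" by (intro mult_right_mono sq h) simp
    finally show ?thesis .
  qed
  have \<omega>h': "convolution \<omega> h = (\<lambda>x. h x + of_real \<delta> * (\<alpha> x - \<beta> x))" using \<omega>h by blast
  \<comment> \<open>F is h \<otimes> \<omega> at (star b \<otimes> 1) * \<Delta> b, the mixed term
    of star D * D. Evaluation at the slice b brings in h as a further factor, and by associativity
    \<omega> meets h, where \<omega> is absorbed up to an error.\<close>
  define F where "F = convolution g \<omega> b"
  have F: "F = g b + product_functional t (convolution g \<omega>) h (X - \<Delta> a) - product_functional t g h (X - \<Delta> a)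
      + of_real \<delta> * (product_functional t g \<alpha> (\<Delta> a) - product_functional t g \<beta> (\<Delta> a))"
  proof -
    have "F = product_functional t (convolution g \<omega>) h (\<Delta> a)
        + product_functional t (convolution g \<omega>) h (X - \<Delta> a)"
      unfolding F_def by (simp only: slice pdiff positive_span_convolution g sp)
    also have "product_functional t (convolution g \<omega>) h (\<Delta> a) = convolution g (convolution \<omega> h) a"
      using convolution_assoc[OF g sp(2,1), of a] by (simp add: convolution_def)
    also have "\<dots> = product_functional t g h (\<Delta> a)
        + of_real \<delta> * (product_functional t g \<alpha> (\<Delta> a) - product_functional t g \<beta> (\<Delta> a))"
      unfolding \<omega>h' convolution_def by (rule product_functional_perturbation[OF tensor2 g sp(1,3,4)])
    finally show ?thesis using slice[OF g] pdiff[OF g sp(1)] by simp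
  qed
  \<comment> \<open>Replacing \<Delta> a by X costs N \<delta> twice, and the states \<alpha> and
    \<beta> cost \<delta> N^2 each; with N \<ge> 1 the total is at most 4 N^2 \<delta>.\<close>
  have F_near: "cmod (F - g b) \<le> 4 * N\<^sup>2 * \<delta>"
  proof -
    define p q r s where "p = product_functional t (convolution g \<omega>) h (X - \<Delta> a)"
      and "q = product_functional t g h (X - \<Delta> a)"
      and "r = product_functional t g \<alpha> (\<Delta> a)" and "s = product_functional t g \<beta> (\<Delta> a)"
    have b1: "N * norm (X - \<Delta> a) \<le> N * \<delta>" and b2: "N * norm (\<Delta> a) \<le> N * N"
      using Xa N1 by (auto intro!: mult_left_mono)
    have p: "cmod p \<le> N * \<delta>" unfolding p_def by (rule order_trans[OF g\<omega>_bound b1])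
    have q: "cmod q \<le> N * \<delta>" unfolding q_def by (rule order_trans[OF g_bound[OF h] b1])
    have r: "cmod r \<le> N * N" unfolding r_def by (rule order_trans[OF g_bound[OF \<alpha>] b2])
    have s: "cmod s \<le> N * N" unfolding s_def by (rule order_trans[OF g_bound[OF \<beta>] b2])
    have rs': "cmod (of_real \<delta> * (r - s)) \<le> \<delta> * (N * N + N * N)"
      unfolding norm_mult using \<delta> r s norm_triangle_ineq4[of r s]
      by (intro mult_mono) auto
    have "N * \<delta> \<le> N * N * \<delta>" using N1 \<delta> by (simp add: mult_le_cancel_right1)
    moreover have "F - g b = p - q + of_real \<delta> * (r - s)"
      unfolding F p_def q_def r_def s_def by simp
    then have "cmod (F - g b) \<le> cmod p + cmod q + cmod (of_real \<delta> * (r - s))"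
      using norm_triangle_ineq[of "p - q" "of_real \<delta> * (r - s)"] norm_triangle_ineq4[of p q] by simp
    ultimately have "cmod (F - g b) \<le> 2 * (N * N * \<delta>) + \<delta> * (N * N + N * N)"
      using p q rs' by linarith
    then show ?thesis by (simp add: power2_eq_square algebra_simps)
  qed

  \<comment> \<open>In the real part the terms h (star b * b) cancel against g b. There remain
    \<delta> times a difference of two states, at most N^2 \<delta>, and twice the distance from F
    to g b, at most 8 N^2 \<delta>.\<close>
  have Q: "Re (product_functional t h \<omega> (star D * D)) \<le> 9 * N\<^sup>2 * \<delta>"
  proof -
    let ?\<Psi> = "product_functional t h \<omega>"
    have \<Psi>: "state ?\<Psi>" by (rule state_product[OF tensor2 h \<omega>])
    then have \<Psi>p: "positive_functional ?\<Psi>" by (simp add: state_iff)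
    note lin = clinear_functional_simps[OF positive_functional_clinear[OF \<Psi>p]]
    have F': "?\<Psi> (t (star b) 1 * \<Delta> b) = F"
      unfolding F_def convolution_def g_def product_functional_left_mult[OF tensor2 sp(1,2)] ..
    have "?\<Psi> (\<Delta> (star b) * t b 1) = cnj F"
      using positive_functional_star[OF \<Psi>p, of "t (star b) 1 * \<Delta> b"]
      by (simp add: F' star_mult min_tensorD[OF tensor2] star_star unital_star_homD[OF comult_hom])
    moreover have "?\<Psi> (\<Delta> (star b) * \<Delta> b) = h (star b * b) + of_real \<delta> * (\<alpha> (star b * b) - \<beta> (star b * b))"
      using h\<omega>[of "star b * b"] by (simp add: convolution_def unital_star_homD[OF comult_hom])
    moreover have "?\<Psi> (t (star b) 1 * t b 1) = g b"
      using \<omega> by (simp add: min_tensorD[OF tensor2] product_functional_tensor[OF tensor2 sp(1,2)]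
          state_iff g_def)
    moreover have "star D * D = \<Delta> (star b) * \<Delta> b - \<Delta> (star b) * t b 1 - t (star b) 1 * \<Delta> b
        + t (star b) 1 * t b 1"
      by (simp add: D_def star_diff unital_star_homD[OF comult_hom] min_tensorD(6)[OF tensor2] algebra_simps)
    ultimately have "?\<Psi> (star D * D) = h (star b * b) + of_real \<delta> * (\<alpha> (star b * b) - \<beta> (star b * b))
        - cnj F - F + g b"
      by (simp add: lin F')
    then have "Re (?\<Psi> (star D * D)) = \<delta> * (Re (\<alpha> (star b * b)) - Re (\<beta> (star b * b))) - 2 * Re (F - g b)"
      by (simp add: g_def)
    also have "\<dots> \<le> \<delta> * N\<^sup>2 + 2 * cmod (F - g b)"
    proof -
      have "\<delta> * (Re (\<alpha> (star b * b)) - Re (\<beta> (star b * b))) \<le> \<delta> * N\<^sup>2"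
        using sq[OF \<alpha>] sq[OF \<beta>] \<delta> by (intro mult_left_mono) auto
      moreover have "- Re (F - g b) \<le> cmod (F - g b)"
        using complex_Re_le_cmod[of "- (F - g b)"] by (metis norm_minus_cancel uminus_complex.sel(1))
      ultimately show ?thesis by linarith
    qed
    also have "\<dots> \<le> \<delta> * N\<^sup>2 + 2 * (4 * N\<^sup>2 * \<delta>)" using F_near by linarith
    finally show ?thesis by (simp add: algebra_simps)
  qed

  let ?\<Phi> = "product_functional t h \<phi>"
  have \<Phi>: "state ?\<Phi>" by (rule state_product[OF tensor2 h \<phi>])
  note lin = clinear_functional_simps[OF positive_span_clinear[OF positive_span_state[OF \<Phi>]]]
  \<comment> \<open>h \<otimes> \<phi>' is nonnegative on squares, so h \<otimes> \<phi> is at most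
    twice h \<otimes> \<omega> there; this doubles 9 to 18.\<close>
  have "Re (?\<Phi> (star D * D)) \<le> 18 * N\<^sup>2 * \<delta>"
  proof -
    have \<omega>_eq: "\<omega> = (\<lambda>x. (1/2) * (\<phi> x + \<phi>' x))" using avg by auto
    have half: "product_functional t h \<omega> Y = (1/2) * (?\<Phi> Y + product_functional t h \<phi>' Y)" for Y
      unfolding \<omega>_eq
        product_functional_scale_right[OF tensor2 sp(1) positive_span_add[OF sp(5,6)]]
        product_functional_add_right[OF tensor2 sp(1,5,6)] ..
    have "2 * Re (product_functional t h \<omega> (star D * D)) =
        Re (?\<Phi> (star D * D)) + Re (product_functional t h \<phi>' (star D * D))"
      unfolding half by simp
    moreover have "0 \<le> Re (product_functional t h \<phi>' (star D * D))"
      using state_product[OF tensor2 h \<phi>'] by (simp add: state_iff positive_functionalD(1))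
    ultimately show ?thesis using Q by linarith
  qed
  moreover have "0 \<le> Re (?\<Phi> (star D * D))" using \<Phi> by (simp add: state_iff positive_functionalD(1))
  ultimately have sqrtD: "sqrt (Re (?\<Phi> (star D * D))) \<le> sqrt (18 * N\<^sup>2 * \<delta>)" by simp
  have hc: "sqrt (Re (h (c * star c))) \<le> norm c"
    using state_square_bound[OF h, of "star c"] by (intro real_le_lsqrt) (auto simp: star_star)
  have main: "cmod (?\<Phi> (t c 1 * D)) \<le> norm c * sqrt (18 * N\<^sup>2 * \<delta>)"
  proof -
    have "cmod (?\<Phi> (t c 1 * D)) \<le> sqrt (Re (?\<Phi> (t c 1 * star (t c 1)))) * sqrt (Re (?\<Phi> (star D * D)))"
      by (rule state_Cauchy_Schwarz[OF \<Phi>])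
    moreover have "?\<Phi> (t c 1 * star (t c 1)) = h (c * star c)"
      using \<phi> by (simp add: min_tensorD[OF tensor2] product_functional_tensor[OF tensor2 sp(1,5)] state_iff)
    moreover have "sqrt (Re (h (c * star c))) * sqrt (Re (?\<Phi> (star D * D))) \<le> norm c * sqrt (18 * N\<^sup>2 * \<delta>)"
      using \<open>0 \<le> Re (?\<Phi> (star D * D))\<close> by (intro mult_mono hc sqrtD) auto
    ultimately show ?thesis by simp
  qed
  define k where "k x = h (c * x)" for x
  have k: "positive_span k" unfolding k_def by (rule positive_span_left_mult[OF sp(1)])
  \<comment> \<open>The manipulation done for F, with k and \<phi> in place of g and \<omega>. The
    convolution of \<phi> with h is kept, which is how it enters the conclusion.\<close>
  have 1: "?\<Phi> (t c 1 * \<Delta> b) = product_functional t h (convolution \<phi> h) (t c 1 * \<Delta> a)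
      + product_functional t (convolution k \<phi>) h (X - \<Delta> a)"
  proof -
    have "?\<Phi> (t c 1 * \<Delta> b) = convolution k \<phi> b"
      unfolding convolution_def k_def product_functional_left_mult[OF tensor2 sp(1,5)] ..
    also have "\<dots> = product_functional t (convolution k \<phi>) h (\<Delta> a)
        + product_functional t (convolution k \<phi>) h (X - \<Delta> a)"
      by (simp only: slice pdiff positive_span_convolution k sp)
    also have "product_functional t (convolution k \<phi>) h (\<Delta> a) = convolution k (convolution \<phi> h) a"
      using convolution_assoc[OF k sp(5,1), of a] by (simp add: convolution_def)
    also have "\<dots> = product_functional t h (convolution \<phi> h) (t c 1 * \<Delta> a)"
      unfolding convolution_def[of k] k_def
      by (rule product_functional_left_mult[OF tensor2 sp(1) positive_span_convolution[OF sp(5,1)]])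
    finally show ?thesis .
  qed
  \<comment> \<open>Here \<phi> only meets 1 and disappears, so undoing the slice leaves h \<otimes>
    h.\<close>
  have 2: "?\<Phi> (t c 1 * t b 1) = product_functional t h h (t c 1 * \<Delta> a)
      + product_functional t k h (X - \<Delta> a)"
  proof -
    have "?\<Phi> (t c 1 * t b 1) = k b"
      using \<phi> by (simp add: min_tensorD[OF tensor2] product_functional_tensor[OF tensor2 sp(1,5)] state_iff k_def)
    also have "\<dots> = product_functional t k h (\<Delta> a) + product_functional t k h (X - \<Delta> a)"
      by (simp only: slice pdiff k sp)
    also have "product_functional t k h (\<Delta> a) = product_functional t h h (t c 1 * \<Delta> a)"
      unfolding k_def by (rule product_functional_left_mult[OF tensor2 sp(1,1)])
    finally show ?thesis .
  qed
  have "product_functional t h (convolution \<phi> h) (t c 1 * \<Delta> a) - product_functional t h h (t c 1 * \<Delta> a)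
      = ?\<Phi> (t c 1 * D) + (product_functional t k h (X - \<Delta> a) - product_functional t (convolution k \<phi>) h (X - \<Delta> a))"
    unfolding D_def right_diff_distrib lin 1 2 by simp
  also have "cmod \<dots> \<le> norm c * sqrt (18 * N\<^sup>2 * \<delta>) + (norm c * \<delta> + norm c * \<delta>)"
  proof (rule order_trans[OF norm_triangle_ineq add_mono[OF main order_trans[OF norm_triangle_ineq4 add_mono]]])
    have *: "sqrt (Re (h (c * star c))) * norm (X - \<Delta> a) \<le> norm c * \<delta>"
      by (intro mult_mono hc Xa) auto
    show "cmod (product_functional t k h (X - \<Delta> a)) \<le> norm c * \<delta>"
      unfolding k_def by (rule order_trans[OF product_functional_left_mult_bound[OF tensor2 h h] *])
    show "cmod (product_functional t (convolution k \<phi>) h (X - \<Delta> a)) \<le> norm c * \<delta>"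
      unfolding k_def[abs_def] by (rule order_trans[OF product_functional_convolution_bound[OF h \<phi> h] *])
  qed
  finally show ?thesis by (simp add: N_def algebra_simps)
qed

section \<open>Convolution powers and Cesaro means\<close>

primrec convolution_power :: "('a \<Rightarrow> complex) \<Rightarrow> nat \<Rightarrow> 'a \<Rightarrow> complex" where
  "convolution_power \<omega> 0 = \<omega>"
| "convolution_power \<omega> (Suc k) = convolution \<omega> (convolution_power \<omega> k)"

lemma state_convolution_power: "state \<omega> \<Longrightarrow> state (convolution_power \<omega> k)"
  by (induction k) (auto intro: state_convolution)

lemma convolution_power_commute:
  assumes "state \<omega>"
  shows "convolution (convolution_power \<omega> k) \<omega> = convolution_power \<omega> (Suc k)"
proof (induction k)
  case (Suc k)
  note sp = positive_span_state[OF assms] positive_span_state[OF state_convolution_power[OF assms, of k]]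
  have "convolution (convolution_power \<omega> (Suc k)) \<omega> = convolution \<omega> (convolution (convolution_power \<omega> k) \<omega>)"
    using convolution_assoc[OF sp(1) sp(2) sp(1)] by (intro ext) simp
  then show ?case by (simp add: Suc.IH)
qed simp

text \<open>Index 0 of \<open>convolution_power\<close> is \<omega> itself, so this is the mean of
  the first n + 1 powers.\<close>

definition cesaro :: "('a \<Rightarrow> complex) \<Rightarrow> nat \<Rightarrow> 'a \<Rightarrow> complex" where
  "cesaro \<omega> n = (\<lambda>x. of_real (1 / real (Suc n)) * (\<Sum>k<Suc n. convolution_power \<omega> k x))"

lemma state_cesaro:
  assumes "state \<omega>"
  shows "state (cesaro \<omega> n)"
proof -
  have p: "state (convolution_power \<omega> k)" for k by (rule state_convolution_power[OF assms])
  then have lin: "clinear_functional (convolution_power \<omega> k)" for k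
    by (simp add: state_iff positive_functional_clinear)
  have "clinear_functional (cesaro \<omega> n)"
    unfolding clinear_functional_def cesaro_def
    by (simp only: clinear_functional_simps[OF lin] sum.distrib distrib_left
        sum_distrib_left[symmetric] mult.left_commute) simp
  moreover have "cesaro \<omega> n (star x * x) \<in> \<real>\<^sub>\<ge>\<^sub>0" for x
  proof -
    have "(\<Sum>k<m. convolution_power \<omega> k (star x * x)) \<in> \<real>\<^sub>\<ge>\<^sub>0" for m
      by (induction m) (use p in \<open>auto simp: state_iff positive_functional_def intro: nonneg_Reals_add_I\<close>)
    then show ?thesis
      unfolding cesaro_def by (intro nonneg_Reals_mult_I) (simp_all only: nonneg_Reals_of_real_iff, simp)
  qed
  moreover have "cesaro \<omega> n 1 = 1"
    using p by (simp add: cesaro_def state_iff del: of_nat_Suc sum.lessThan_Suc)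
  ultimately show ?thesis by (simp add: state_iff positive_functional_def)
qed

text \<open>Convolving with \<omega> shifts every power by one, and the sums differ only by the new
  last term and the old first one. The error has the shape required by
  \<open>approximate_invariance\<close>, with \<delta> = 1 / (n + 1).\<close>

lemma convolution_cesaro:
  assumes "state \<omega>"
  shows "convolution (cesaro \<omega> n) \<omega> x = cesaro \<omega> n x
      + of_real (1 / real (Suc n)) * (convolution_power \<omega> (Suc n) x - \<omega> x)"
    and "convolution \<omega> (cesaro \<omega> n) x = cesaro \<omega> n x
      + of_real (1 / real (Suc n)) * (convolution_power \<omega> (Suc n) x - \<omega> x)"
proof -
  note p = positive_span_state[OF state_convolution_power[OF assms]]
  note \<omega> = positive_span_state[OF assms]
  note c = positive_span_state[OF state_cesaro[OF assms, of n], unfolded cesaro_def]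
  have shift: "(\<Sum>k<Suc n. convolution_power \<omega> (Suc k) x) =
      (\<Sum>k<Suc n. convolution_power \<omega> k x) + (convolution_power \<omega> (Suc n) x - \<omega> x)"
    using sum.lessThan_Suc_shift[of "\<lambda>k. convolution_power \<omega> k x" "Suc n"]
    by (simp del: convolution_power.simps(2))
  have "convolution (cesaro \<omega> n) \<omega> x =
      of_real (1 / real (Suc n)) * (\<Sum>k<Suc n. convolution (convolution_power \<omega> k) \<omega> x)"
    unfolding convolution_def cesaro_def
    by (rule product_functional_weighted_sum[OF tensor2 p \<omega> c])
  then show "convolution (cesaro \<omega> n) \<omega> x = cesaro \<omega> n x
      + of_real (1 / real (Suc n)) * (convolution_power \<omega> (Suc n) x - \<omega> x)"
    by (simp only: convolution_power_commute[OF assms] shift distrib_left cesaro_def)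
  have "convolution \<omega> (cesaro \<omega> n) x =
      of_real (1 / real (Suc n)) * (\<Sum>k<Suc n. convolution \<omega> (convolution_power \<omega> k) x)"
    unfolding convolution_def cesaro_def
    by (rule product_functional_weighted_sum_right[OF tensor2 p \<omega> c])
  then show "convolution \<omega> (cesaro \<omega> n) x = cesaro \<omega> n x
      + of_real (1 / real (Suc n)) * (convolution_power \<omega> (Suc n) x - \<omega> x)"
    by (simp only: convolution_power.simps(2)[symmetric] shift distrib_left cesaro_def)
qed

text \<open>At (c \<otimes> 1) * \<Delta> a the explicit estimate tends to 0 with \<delta>;
  \<open>dense_left\<close> and a bound uniform in n extend the convergence to every Z.\<close>

lemma cesaro_asymptotically_invariant:
  assumes \<phi>: "state \<phi>" and \<phi>': "state \<phi>'"
  defines "\<omega> \<equiv> \<lambda>x. (\<phi> x + \<phi>' x) / 2"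
  shows "state \<omega>"
    and "(\<lambda>n. product_functional t (cesaro \<omega> n) (convolution \<phi> (cesaro \<omega> n)) Z
      - product_functional t (cesaro \<omega> n) (cesaro \<omega> n) Z) \<longlonglongrightarrow> 0"
proof -
  have "(\<phi> (star x * x) + \<phi>' (star x * x)) / 2 \<in> \<real>\<^sub>\<ge>\<^sub>0" for x
    using \<phi> \<phi>' by (intro nonneg_Reals_divide_I nonneg_Reals_add_I)
      (auto simp: state_iff positive_functional_def)
  then show \<omega>: "state \<omega>"
    using \<phi> \<phi>' by (simp add: \<omega>_def state_iff positive_functional_def clinear_functional_def field_simps)
  define h where "h = cesaro \<omega>"
  define T where "T n Y = product_functional t (h n) (convolution \<phi> (h n)) Y
      - product_functional t (h n) (h n) Y" for n Y
  have h: "state (h n)" for n unfolding h_def by (rule state_cesaro[OF \<omega>])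
  have s: "state (product_functional t (h n) (convolution \<phi> (h n)))"
    "state (product_functional t (h n) (h n))" for n
    by (intro state_product[OF tensor2] h state_convolution \<phi>)+
  have T_lin: "linear (T n)" for n
    unfolding T_def[abs_def]
    by (intro bounded_linear.linear bounded_linear_sub bounded_linear_positive_functional)
      (use s in \<open>auto simp: state_iff\<close>)
  \<comment> \<open>T n is a difference of two states, which gives a constant independent of
    n.\<close>
  have T_bound: "cmod (T n Y) \<le> 2 * norm Y" for n Y
    using norm_triangle_ineq4[of "product_functional t (h n) (convolution \<phi> (h n)) Y"
        "product_functional t (h n) (h n) Y"]
      state_bound[OF s(1)[of n], of Y] state_bound[OF s(2)[of n], of Y]
    unfolding T_def by linarith
  have gen: "(\<lambda>n. T n (t c 1 * \<Delta> a)) \<longlonglongrightarrow> 0" for c a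
  proof (rule tendsto_norm_zero_cancel, rule tendsto_sandwich[OF _ _ tendsto_const])
    show "\<forall>\<^sub>F n in sequentially. 0 \<le> norm (T n (t c 1 * \<Delta> a))" by simp
    define d where "d n = 1 / real (Suc n)" for n
    have d: "d \<longlonglongrightarrow> 0" unfolding d_def using LIMSEQ_inverse_real_of_nat by (simp add: inverse_eq_divide)
    show "\<forall>\<^sub>F n in sequentially. norm (T n (t c 1 * \<Delta> a)) \<le>
        norm c * (2 * d n + sqrt (18 * (norm (\<Delta> a) + 1)\<^sup>2 * d n))"
    proof (rule always_eventually, rule allI)
      fix n
      show "norm (T n (t c 1 * \<Delta> a)) \<le> norm c * (2 * d n + sqrt (18 * (norm (\<Delta> a) + 1)\<^sup>2 * d n))"
        unfolding T_def
        by (rule approximate_invariance[OF h \<omega> state_convolution_power[OF \<omega>, of "Suc n"] \<omega> \<phi> \<phi>'])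
          (simp_all only: h_def d_def convolution_cesaro[OF \<omega>], simp_all add: \<omega>_def)
    qed
    have "(\<lambda>n. norm c * (2 * d n + sqrt (18 * (norm (\<Delta> a) + 1)\<^sup>2 * d n))) \<longlonglongrightarrow>
        norm c * (2 * 0 + sqrt (18 * (norm (\<Delta> a) + 1)\<^sup>2 * 0))"
      by (intro tendsto_intros d)
    then show "(\<lambda>n. norm c * (2 * d n + sqrt (18 * (norm (\<Delta> a) + 1)\<^sup>2 * d n))) \<longlonglongrightarrow> 0" by simp
  qed
  have sp: "(\<lambda>n. T n Y) \<longlonglongrightarrow> 0" if "Y \<in> span {t b 1 * \<Delta> c | b c. True}" for Y
    using that
  proof (induction rule: span_induct_alt)
    case base
    show ?case by (simp add: linear_0[OF T_lin])
  next
    case (step r x y)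
    then have "(\<lambda>n. r *\<^sub>R T n x + T n y) \<longlonglongrightarrow> r *\<^sub>R 0 + 0"
      using gen by (intro tendsto_intros) auto
    then show ?case by (simp add: linear_add[OF T_lin] linear_scale[OF T_lin])
  qed
  have "(\<lambda>n. T n Z) \<longlonglongrightarrow> 0"
  proof (rule LIMSEQ_I)
    fix e :: real assume e: "e > 0"
    have "Z \<in> closure (span {t b 1 * \<Delta> c | b c. True})" unfolding dense_left ..
    then obtain Y where Y: "Y \<in> span {t b 1 * \<Delta> c | b c. True}" "norm (Z - Y) < e / 4"
      using e unfolding closure_approachable by (metis dist_norm dist_commute divide_pos_pos zero_less_numeral)
    obtain n0 where n0: "\<And>n. n \<ge> n0 \<Longrightarrow> norm (T n Y) < e / 2"
      using LIMSEQ_D[OF sp[OF Y(1)], of "e / 2"] e by auto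
    show "\<exists>no. \<forall>n\<ge>no. norm (T n Z - 0) < e"
    proof (intro exI allI impI)
      fix n assume "n \<ge> n0"
      have "T n Z = T n Y + T n (Z - Y)" by (simp add: linear_diff[OF T_lin])
      then have "norm (T n Z) \<le> norm (T n Y) + norm (T n (Z - Y))" by (simp only: norm_triangle_ineq)
      also have "\<dots> < e / 2 + 2 * (e / 4)"
        using n0[OF \<open>n \<ge> n0\<close>] T_bound[of n "Z - Y"] Y(2) by linarith
      finally show "norm (T n Z - 0) < e" by simp
    qed
  qed
  then show "(\<lambda>n. product_functional t (cesaro \<omega> n) (convolution \<phi> (cesaro \<omega> n)) Z
      - product_functional t (cesaro \<omega> n) (cesaro \<omega> n) Z) \<longlonglongrightarrow> 0"
    by (simp add: T_def h_def)
qed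

theorem comult_right_invariant_scalar:
  assumes x: "\<Delta> x = t x 1"
  shows "\<exists>c. x = of_cplx c"
proof -
  have conv_x: "convolution f g x = f x" if "state f" "state g" for f g
    using that(2) product_functional_tensor[OF tensor2 that[THEN positive_span_state], of x 1]
    by (simp add: convolution_def x state_iff)
  have agree: "\<phi> x = \<phi>' x" if \<phi>: "state \<phi>" and \<phi>': "state \<phi>'" for \<phi> \<phi>'
  proof -
    define \<omega> where "\<omega> = (\<lambda>x. (\<phi> x + \<phi>' x) / 2)"
    note \<omega> = cesaro_asymptotically_invariant(1)[OF \<phi> \<phi>', folded \<omega>_def]
    \<comment> \<open>At 1 \<otimes> x the first leg contributes 1, and only the second functionals
      remain.\<close>
    note lim = cesaro_asymptotically_invariant(2)[OF \<phi> \<phi>', folded \<omega>_def, of "t 1 x"]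
    have h: "state (cesaro \<omega> n)" for n by (rule state_cesaro[OF \<omega>])
    have "convolution_power \<omega> k x = \<omega> x" for k
      by (cases k) (auto simp: conv_x \<omega> state_convolution_power)
    then have hx: "cesaro \<omega> n x = \<omega> x" for n by (simp add: cesaro_def del: of_nat_Suc sum.lessThan_Suc)
    have "product_functional t (cesaro \<omega> n) (convolution \<phi> (cesaro \<omega> n)) (t 1 x)
      - product_functional t (cesaro \<omega> n) (cesaro \<omega> n) (t 1 x) = \<phi> x - \<omega> x" for n
      using h[of n] hx[of n] conv_x[OF \<phi> h, of n]
        product_functional_tensor[OF tensor2 positive_span_state[OF h] positive_span_state[OF h], of n n 1 x]
        product_functional_tensor[OF tensor2 positive_span_state[OF h]
          positive_span_state[OF state_convolution[OF \<phi> h]], of n n 1 x]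
      by (simp add: state_iff)
    with lim have "(\<lambda>n::nat. \<phi> x - \<omega> x) \<longlonglongrightarrow> 0" by simp
    then have "\<phi> x - \<omega> x = 0" by (simp add: LIMSEQ_const_iff)
    then show ?thesis by (simp add: \<omega>_def field_simps)
  qed
  \<comment> \<open>Were there no state, separation would make 1 equal to 0.\<close>
  obtain \<phi> :: "'a \<Rightarrow> complex" where \<phi>: "state \<phi>"
    using states_separate[OF tensor2, of 1] by auto
  have "x - of_cplx (\<phi> x) = 0"
  proof (rule states_separate[OF tensor2])
    fix f :: "'a \<Rightarrow> complex" assume f: "state f"
    note lin = clinear_functional_simps[OF positive_span_clinear[OF positive_span_state[OF f]]]
    show "f (x - of_cplx (\<phi> x)) = 0" using agree[OF f \<phi>] f by (simp add: lin state_iff)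
  qed
  then show ?thesis by auto
qed

end

section \<open>Coefficients of representations\<close>

lemma sum_mult_delta:
  fixes a :: "nat \<Rightarrow> 'a::ring_1"
  assumes "k < n"
  shows "(\<Sum>i<n. a i * (if i = k then 1 else 0)) = a k"
  using assms by (simp add: if_distrib[of "\<lambda>x. _ * x"] cong: if_cong)

text \<open>Unitarity in terms of a function of two indices, so that applying a homomorphism to
  every entry keeps the format.\<close>

definition unitary_coeffs :: "nat \<Rightarrow> (nat \<Rightarrow> nat \<Rightarrow> 'a::cstar_algebra) \<Rightarrow> bool" where
  "unitary_coeffs n U \<longleftrightarrow> (\<forall>k<n. \<forall>j<n.
     (\<Sum>i<n. star (U i k) * U i j) = (if k = j then 1 else 0) \<and>
     (\<Sum>i<n. U k i * star (U j i)) = (if k = j then 1 else 0))"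

lemma unitary_coeffsD:
  assumes "unitary_coeffs n U" "k < n" "j < n"
  shows "(\<Sum>i<n. star (U i k) * U i j) = (if k = j then 1 else 0)"
    "(\<Sum>i<n. U k i * star (U j i)) = (if k = j then 1 else 0)"
  using assms by (auto simp: unitary_coeffs_def)

lemma unitary_coeffs_hom:
  assumes U: "unitary_coeffs n U" and F: "unital_star_hom F"
  shows "unitary_coeffs n (\<lambda>i j. F (U i j))"
proof -
  have *: "(\<Sum>i<n. star (F (U i k)) * F (U i j)) = F (\<Sum>i<n. star (U i k) * U i j)"
    "(\<Sum>i<n. F (U k i) * star (F (U j i))) = F (\<Sum>i<n. U k i * star (U j i))" for k j
    by (simp_all add: unital_star_homD[OF F])
  show ?thesis
    using U unfolding unitary_coeffs_def * by (auto simp: unital_star_homD(5,6)[OF F])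
qed

lemma unitary_rep_coeffs:
  assumes "unitary_rep t \<Delta> u"
  shows "unitary_coeffs (dim_row u) (\<lambda>i j. u $$ (i, j))"
    and "i < dim_row u \<Longrightarrow> j < dim_row u \<Longrightarrow>
      \<Delta> (u $$ (i, j)) = (\<Sum>k<dim_row u. t (u $$ (i, k)) (u $$ (k, j)))"
    and "dim_col u = dim_row u"
proof -
  show dc: "dim_col u = dim_row u" using assms by (simp add: unitary_rep_def)
  show "i < dim_row u \<Longrightarrow> j < dim_row u \<Longrightarrow>
      \<Delta> (u $$ (i, j)) = (\<Sum>k<dim_row u. t (u $$ (i, k)) (u $$ (k, j)))"
    using assms by (simp add: unitary_rep_def)
  have m: "star_mat u * u = 1\<^sub>m (dim_row u)" "u * star_mat u = 1\<^sub>m (dim_row u)"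
    using assms by (simp_all add: unitary_rep_def)
  show "unitary_coeffs (dim_row u) (\<lambda>i j. u $$ (i, j))"
    unfolding unitary_coeffs_def
  proof (intro allI impI)
    fix k j assume kj: "k < dim_row u" "j < dim_row u"
    have "(star_mat u * u) $$ (k, j) = (\<Sum>i<dim_row u. star (u $$ (i, k)) * u $$ (i, j))"
      "(u * star_mat u) $$ (k, j) = (\<Sum>i<dim_row u. u $$ (k, i) * star (u $$ (j, i)))"
      using kj dc by (simp_all add: star_mat_def scalar_prod_def atLeast0LessThan)
    then show "(\<Sum>i<dim_row u. star (u $$ (i, k)) * u $$ (i, j)) = (if k = j then 1 else 0) \<and>
        (\<Sum>i<dim_row u. u $$ (k, i) * star (u $$ (j, i))) = (if k = j then 1 else 0)"
      unfolding m using kj by auto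
  qed
qed

text \<open>Multiplying U \<psi> = \<psi> by the adjoint matrix shows that the adjoint fixes \<psi>
  too, and conversely. The right side is this adjoint equation after taking stars: a row vector
  times U, the form in which \<open>T_map\<close> meets the coefficients.\<close>

lemma unitary_coeffs_fixed_vector:
  assumes U: "unitary_coeffs n U"
  shows "(\<forall>i<n. (\<Sum>j<n. \<psi> j *\<^sub>C U i j) = of_cplx (\<psi> i)) \<longleftrightarrow>
    (\<forall>k<n. (\<Sum>i<n. cnj (\<psi> i) *\<^sub>C U i k) = of_cplx (cnj (\<psi> k)))" (is "?L \<longleftrightarrow> ?R")
proof
  assume L: ?L
  show ?R
  proof (intro allI impI)
    fix k assume k: "k < n"
    have "(\<Sum>i<n. \<psi> i *\<^sub>C star (U i k)) = (\<Sum>i<n. star (U i k) * (\<Sum>j<n. \<psi> j *\<^sub>C U i j))"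
      using L by (simp add: scaleC_mult_right)
    also have "\<dots> = (\<Sum>j<n. \<psi> j *\<^sub>C (\<Sum>i<n. star (U i k) * U i j))"
      unfolding sum_distrib_left scaleC_sum_right scaleC_mult_right by (rule sum.swap)
    also have "\<dots> = of_cplx (\<psi> k)"
      using k by (simp add: unitary_coeffsD[OF U] if_distrib[of "\<lambda>x. _ *\<^sub>C x"] cong: if_cong)
    finally have "star (\<Sum>i<n. \<psi> i *\<^sub>C star (U i k)) = star (of_cplx (\<psi> k) :: 'a)" by simp
    then show "(\<Sum>i<n. cnj (\<psi> i) *\<^sub>C U i k) = of_cplx (cnj (\<psi> k))"
      by (simp add: star_sum star_scaleC star_star)
  qed
next
  assume R: ?R
  show ?L
  proof (intro allI impI)
    fix l assume l: "l < n"
    have *: "(\<Sum>i<n. \<psi> i *\<^sub>C star (U i k)) = of_cplx (\<psi> k)" if "k < n" for k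
    proof -
      have "star (\<Sum>i<n. cnj (\<psi> i) *\<^sub>C U i k) = star (of_cplx (cnj (\<psi> k)) :: 'a)"
        using R that by simp
      then show ?thesis by (simp add: star_sum star_scaleC)
    qed
    have "(\<Sum>j<n. \<psi> j *\<^sub>C U l j) = (\<Sum>k<n. U l k * (\<Sum>i<n. \<psi> i *\<^sub>C star (U i k)))"
      by (simp add: * scaleC_mult_right)
    also have "\<dots> = (\<Sum>i<n. \<psi> i *\<^sub>C (\<Sum>k<n. U l k * star (U i k)))"
      unfolding sum_distrib_left scaleC_sum_right scaleC_mult_right by (rule sum.swap)
    also have "\<dots> = of_cplx (\<psi> l)"
      using l by (simp add: unitary_coeffsD[OF U] if_distrib[of "\<lambda>x. _ *\<^sub>C x"] cong: if_cong)
    finally show "(\<Sum>j<n. \<psi> j *\<^sub>C U l j) = of_cplx (\<psi> l)" .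
  qed
qed

section \<open>Invariant vectors, coefficients of the comparison map, and arrows\<close>

lemma rep_apply_index:
  assumes "dim_col u = dim_row u" "\<phi> \<in> carrier_vec (dim_row u)" "i < dim_row u"
  shows "rep_apply u \<phi> $ i = (\<Sum>j<dim_row u. (\<phi> $ j) *\<^sub>C (u $$ (i, j)))"
  using assms by (simp add: rep_apply_def scalar_prod_def atLeast0LessThan scaleC_mult_right)

lemma dim_rep_apply [simp]: "dim_vec (rep_apply u \<phi>) = dim_row u"
  by (simp add: rep_apply_def)

lemma invariant_vectors_iff:
  assumes "dim_col u = dim_row u" "unital_star_hom \<pi>"
  shows "\<psi> \<in> invariant_vectors \<pi> u \<longleftrightarrow> \<psi> \<in> carrier_vec (dim_row u) \<and>
    (\<forall>i<dim_row u. (\<Sum>j<dim_row u. (\<psi> $ j) *\<^sub>C \<pi> (u $$ (i, j))) = of_cplx (\<psi> $ i))"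
proof (cases "\<psi> \<in> carrier_vec (dim_row u)")
  case True
  have "\<pi> (rep_apply u \<psi> $ i) = (\<Sum>j<dim_row u. (\<psi> $ j) *\<^sub>C \<pi> (u $$ (i, j)))" if "i < dim_row u" for i
    unfolding rep_apply_index[OF assms(1) True that] by (simp only: unital_star_homD[OF assms(2)])
  moreover have "map_vec \<pi> (rep_apply u \<psi>) = map_vec of_cplx \<psi> \<longleftrightarrow>
      (\<forall>i<dim_row u. \<pi> (rep_apply u \<psi> $ i) = of_cplx (\<psi> $ i))"
    using True by (auto simp: vec_eq_iff)
  ultimately show ?thesis using True by (simp add: invariant_vectors_def)
next
  case False
  then show ?thesis by (simp add: invariant_vectors_def)
qed

definition T_coeff :: "'a::cstar_algebra mat \<Rightarrow> complex vec \<Rightarrow> nat \<Rightarrow> 'a" where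
  "T_coeff u \<psi> j = (\<Sum>i<dim_row u. cnj (\<psi> $ i) *\<^sub>C (u $$ (i, j)))"

lemma T_map_eq:
  assumes "dim_col u = dim_row u" "\<phi> \<in> carrier_vec (dim_row u)"
  shows "T_map u \<psi> \<phi> = (\<Sum>j<dim_row u. (\<phi> $ j) *\<^sub>C T_coeff u \<psi> j)"
proof -
  have "T_map u \<psi> \<phi> = (\<Sum>i<dim_row u. \<Sum>j<dim_row u. cnj (\<psi> $ i) *\<^sub>C (\<phi> $ j) *\<^sub>C (u $$ (i, j)))"
    using assms by (simp add: T_map_def ell_adj_def rep_apply_index scaleC_sum_right)
  also have "\<dots> = (\<Sum>j<dim_row u. (\<phi> $ j) *\<^sub>C T_coeff u \<psi> j)"
    unfolding T_coeff_def scaleC_sum_right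
    by (subst sum.swap) (simp add: scaleC_scaleC mult.commute)
  finally show ?thesis .
qed

lemma T_map_unit_vec:
  assumes "dim_col u = dim_row u" "j < dim_row u"
  shows "T_map u \<psi> (unit_vec (dim_row u) j) = T_coeff u \<psi> j"
proof -
  have "T_map u \<psi> (unit_vec (dim_row u) j) =
      (\<Sum>i<dim_row u. (if i = j then 1 else 0) *\<^sub>C T_coeff u \<psi> i)"
    using assms(2) by (subst T_map_eq[OF assms(1)]) auto
  then show ?thesis
    using assms(2) by (simp add: if_distrib[of "\<lambda>c. c *\<^sub>C _"] cong: if_cong)
qed

lemma T_coeff_add:
  assumes "\<psi> \<in> carrier_vec (dim_row u)" "\<psi>' \<in> carrier_vec (dim_row u)"
  shows "T_coeff u (\<psi> + \<psi>') j = T_coeff u \<psi> j + T_coeff u \<psi>' j"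
  using assms by (simp add: T_coeff_def scaleC_add_left sum.distrib)

lemma T_coeff_scale:
  assumes "\<psi> \<in> carrier_vec (dim_row u)"
  shows "T_coeff u (c \<cdot>\<^sub>v \<psi>) j = cnj c *\<^sub>C T_coeff u \<psi> j"
  using assms by (simp add: T_coeff_def scaleC_sum_right scaleC_scaleC)

lemma comult_T_coeff:
  assumes \<Delta>: "unital_star_hom \<Delta>" and t: "min_tensor t" and u: "unitary_rep t \<Delta> u" and j: "j < dim_row u"
  shows "\<Delta> (T_coeff u \<psi> j) = (\<Sum>k<dim_row u. t (T_coeff u \<psi> k) (u $$ (k, j)))"
proof -
  have "\<Delta> (T_coeff u \<psi> j) =
      (\<Sum>i<dim_row u. \<Sum>k<dim_row u. cnj (\<psi> $ i) *\<^sub>C t (u $$ (i, k)) (u $$ (k, j)))"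
    using j by (simp add: T_coeff_def unital_star_homD[OF \<Delta>] unitary_rep_coeffs(2)[OF u] scaleC_sum_right)
  also have "\<dots> = (\<Sum>k<dim_row u. t (T_coeff u \<psi> k) (u $$ (k, j)))"
    unfolding T_coeff_def min_tensorD(3,14)[OF t] by (rule sum.swap)
  finally show ?thesis .
qed

lemma sum_lessThan_times:
  fixes f :: "nat \<Rightarrow> 'a::comm_monoid_add"
  shows "(\<Sum>k<n * m. f k) = (\<Sum>i<n. \<Sum>p<m. f (i * m + p))"
proof -
  have "sum f {i * m..<i * m + m} = (\<Sum>p<m. f (i * m + p))" for i
    using sum.shift_bounds_nat_ivl[of f 0 "i * m" m]
    by (simp add: atLeast0LessThan add.commute)
  then show ?thesis using sum.nat_group[of f m n] by simp
qed

lemma T_coeff_tensor: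
  assumes "x \<in> carrier_vec (dim_row u)" "y \<in> carrier_vec (dim_row v)"
    and "j < dim_row u" "q < dim_row v"
  shows "T_coeff (rep_tensor u v) (vec_tensor x y) (j * dim_row v + q) = T_coeff u x j * T_coeff v y q"
proof -
  let ?n = "dim_row u" and ?m = "dim_row v"
  have lt: "i * ?m + p < ?n * ?m" if "i < ?n" "p < ?m" for i p
  proof -
    have "i * ?m + p < Suc i * ?m" using that by simp
    also have "\<dots> \<le> ?n * ?m" using that by (intro mult_right_mono) auto
    finally show ?thesis .
  qed
  have "T_coeff (rep_tensor u v) (vec_tensor x y) (j * ?m + q) =
      (\<Sum>i<?n. \<Sum>p<?m. (cnj (x $ i) *\<^sub>C u $$ (i, j)) * (cnj (y $ p) *\<^sub>C v $$ (p, q)))"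
    using assms lt
    by (simp add: T_coeff_def rep_tensor_def vec_tensor_def Let_def sum_lessThan_times
        scaleC_mult_left scaleC_mult_right scaleC_scaleC mult.commute)
  also have "\<dots> = T_coeff u x j * T_coeff v y q" by (simp add: T_coeff_def sum_product)
  finally show ?thesis .
qed

lemma mat_adjoint_mult_vec_index:
  fixes A :: "complex mat"
  assumes "A \<in> carrier_mat n m" "\<phi> \<in> carrier_vec n" "j < m"
  shows "(mat_adjoint A *\<^sub>v \<phi>) $ j = (\<Sum>l<n. cnj (A $$ (l, j)) * \<phi> $ l)"
  using assms
  by (simp add: mat_adjoint_def scalar_prod_def atLeast0LessThan mat_of_rows_def)

text \<open>In matrix form: \<open>Au = vA\<close> gives \<open>u\<^sup>*A\<^sup>* = A\<^sup>*v\<^sup>*\<close>, hence \<open>A\<^sup>*v = uA\<^sup>*\<close> by unitarity.\<close>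

lemma arrow_adjoint_coeffs:
  assumes u: "unitary_rep t \<Delta> u" and v: "unitary_rep t \<Delta> v" and A: "A \<in> arrows u v"
    and p: "p < dim_row u" and q: "q < dim_row v"
  shows "(\<Sum>i<dim_row v. cnj (A $$ (i, p)) *\<^sub>C (v $$ (i, q))) =
    (\<Sum>j<dim_row u. cnj (A $$ (q, j)) *\<^sub>C (u $$ (p, j)))"
proof -
  let ?n = "dim_row u" and ?m = "dim_row v"
  note U = unitary_rep_coeffs(1)[OF u] and V = unitary_rep_coeffs(1)[OF v]
  have Ac: "A \<in> carrier_mat ?m ?n" and AA: "map_mat of_cplx A * u = v * map_mat of_cplx A"
    using A by (auto simp: arrows_def)
  have 1: "(\<Sum>k<?n. cnj (A $$ (i, k)) *\<^sub>C star (u $$ (k, j))) = (\<Sum>l<?m. cnj (A $$ (l, j)) *\<^sub>C star (v $$ (i, l)))"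
    if "i < ?m" "j < ?n" for i j
  proof -
    have "(\<Sum>k<?n. (A $$ (i, k)) *\<^sub>C (u $$ (k, j))) = (map_mat of_cplx A * u) $$ (i, j)"
      "(\<Sum>l<?m. (A $$ (l, j)) *\<^sub>C (v $$ (i, l))) = (v * map_mat of_cplx A) $$ (i, j)"
      using that Ac unitary_rep_coeffs(3)[OF u] unitary_rep_coeffs(3)[OF v]
      by (simp_all add: scalar_prod_def atLeast0LessThan scaleC_mult_left scaleC_mult_right)
    then have "star (\<Sum>k<?n. (A $$ (i, k)) *\<^sub>C (u $$ (k, j))) = star (\<Sum>l<?m. (A $$ (l, j)) *\<^sub>C (v $$ (i, l)))"
      using AA by simp
    then show ?thesis by (simp add: star_sum star_scaleC)
  qed
  \<comment> \<open>The adjoint relation is multiplied by u from the left, and u u^* = 1 isolates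
    the entries of A^*.\<close>
  have 2: "of_cplx (cnj (A $$ (i, p))) = (\<Sum>j<?n. u $$ (p, j) * (\<Sum>l<?m. cnj (A $$ (l, j)) *\<^sub>C star (v $$ (i, l))))"
    if i: "i < ?m" for i
  proof -
    have "(\<Sum>j<?n. u $$ (p, j) * (\<Sum>l<?m. cnj (A $$ (l, j)) *\<^sub>C star (v $$ (i, l)))) =
        (\<Sum>j<?n. u $$ (p, j) * (\<Sum>k<?n. cnj (A $$ (i, k)) *\<^sub>C star (u $$ (k, j))))"
      using 1[OF i] by simp
    also have "\<dots> = (\<Sum>k<?n. cnj (A $$ (i, k)) *\<^sub>C (\<Sum>j<?n. u $$ (p, j) * star (u $$ (k, j))))"
      unfolding sum_distrib_left scaleC_sum_right scaleC_mult_right by (rule sum.swap)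
    also have "\<dots> = of_cplx (cnj (A $$ (i, p)))"
      using p by (simp add: unitary_coeffsD(2)[OF U] if_distrib[of "\<lambda>x. _ *\<^sub>C x"] cong: if_cong)
    finally show ?thesis by simp
  qed
  \<comment> \<open>Now v multiplies from the right, and v^* v = 1 leaves u A^*.\<close>
  have "(\<Sum>i<?m. cnj (A $$ (i, p)) *\<^sub>C (v $$ (i, q))) = (\<Sum>i<?m. of_cplx (cnj (A $$ (i, p))) * v $$ (i, q))"
    by (simp add: scaleC_mult_left)
  also have "\<dots> = (\<Sum>i<?m. \<Sum>j<?n. \<Sum>l<?m. cnj (A $$ (l, j)) *\<^sub>C (u $$ (p, j) * (star (v $$ (i, l)) * v $$ (i, q))))"
    by (intro sum.cong refl)
      (simp add: 2 sum_distrib_right sum_distrib_left scaleC_mult_left scaleC_mult_right mult.assoc)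
  also have "\<dots> = (\<Sum>j<?n. \<Sum>i<?m. \<Sum>l<?m. cnj (A $$ (l, j)) *\<^sub>C (u $$ (p, j) * (star (v $$ (i, l)) * v $$ (i, q))))"
    by (rule sum.swap)
  also have "\<dots> = (\<Sum>j<?n. \<Sum>l<?m. cnj (A $$ (l, j)) *\<^sub>C (u $$ (p, j) * (\<Sum>i<?m. star (v $$ (i, l)) * v $$ (i, q))))"
    unfolding sum_distrib_left scaleC_sum_right by (intro sum.cong refl sum.swap)
  also have "\<dots> = (\<Sum>j<?n. cnj (A $$ (q, j)) *\<^sub>C (u $$ (p, j)))"
    using q by (simp add: unitary_coeffsD(1)[OF V] if_distrib[of "\<lambda>x. _ * x"]
        if_distrib[of "\<lambda>x. _ *\<^sub>C x"] cong: if_cong)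
  finally show ?thesis .
qed

text \<open>Linearity is given on the carrier, so the expansion is built along the truncations of
  \<phi> to its first m coordinates, all of which lie in the carrier.\<close>

lemma linear_on_carrier_vec_expansion:
  fixes T :: "complex vec \<Rightarrow> 'a::cstar_algebra"
  assumes add: "\<And>\<phi> \<phi>'. \<phi> \<in> carrier_vec n \<Longrightarrow> \<phi>' \<in> carrier_vec n \<Longrightarrow> T (\<phi> + \<phi>') = T \<phi> + T \<phi>'"
    and scale: "\<And>c \<phi>. \<phi> \<in> carrier_vec n \<Longrightarrow> T (c \<cdot>\<^sub>v \<phi>) = c *\<^sub>C T \<phi>"
    and \<phi>: "\<phi> \<in> carrier_vec n"
  shows "T \<phi> = (\<Sum>j<n. (\<phi> $ j) *\<^sub>C T (unit_vec n j))"
proof -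
  have "T (vec n (\<lambda>i. if i < m then \<phi> $ i else 0)) = (\<Sum>j<m. (\<phi> $ j) *\<^sub>C T (unit_vec n j))" if "m \<le> n" for m
    using that
  proof (induction m)
    case 0
    \<comment> \<open>Written as a multiple by 0, so that homogeneity gives the value of T at the
      zero vector.\<close>
    have "vec n (\<lambda>i. 0) = 0 \<cdot>\<^sub>v (0\<^sub>v n :: complex vec)" by auto
    then show ?case using scale[of "0\<^sub>v n" 0] by simp
  next
    case (Suc m)
    have "vec n (\<lambda>i. if i < Suc m then \<phi> $ i else 0) =
        vec n (\<lambda>i. if i < m then \<phi> $ i else 0) + (\<phi> $ m) \<cdot>\<^sub>v unit_vec n m"
      using Suc.prems by (auto simp: vec_eq_iff less_Suc_eq)
    then show ?case using Suc by (simp add: add scale)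
  qed
  from this[of n] have "T (vec n (\<lambda>i. if i < n then \<phi> $ i else 0)) = (\<Sum>j<n. (\<phi> $ j) *\<^sub>C T (unit_vec n j))"
    by simp
  also have "vec n (\<lambda>i. if i < n then \<phi> $ i else 0) = \<phi>" using \<phi> by (auto simp: vec_eq_iff)
  finally show ?thesis .
qed

section \<open>The comparison map\<close>

context compact_quantum_subgroup
begin

abbreviation "A\<delta> \<equiv> quotient_space t s \<Delta> \<pi>"

section \<open>The algebra of the quotient and its spectral spaces\<close>

lemma restriction_comult_map:
  "bounded_linear (tensor_map t s \<pi> id)" "tensor_map t s \<pi> id (t a b) = s (\<pi> a) b"
  using bounded_linear_tensor_map[OF G.tensor2 tensor_mixed restriction_hom unital_star_hom_id]
    tensor_map_tensor[OF G.tensor2 tensor_mixed restriction_hom unital_star_hom_id] by auto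

lemma restriction_comult_sum:
  "tensor_map t s \<pi> id (\<Sum>k<n. t (a k) (b k)) = (\<Sum>k<n. s (\<pi> (a k)) (b k))"
  using linear_sum[OF bounded_linear.linear[OF restriction_comult_map(1)], of "\<lambda>k. t (a k) (b k)" "{..<n}"]
  by (simp add: restriction_comult_map(2))

lemma quotient_space_add: "a \<in> A\<delta> \<Longrightarrow> b \<in> A\<delta> \<Longrightarrow> a + b \<in> A\<delta>"
  by (simp add: quotient_space_def unital_star_homD[OF G.comult_hom] min_tensorD[OF tensor_mixed]
      linear_add[OF bounded_linear.linear[OF restriction_comult_map(1)]])

lemma quotient_space_scale: "a \<in> A\<delta> \<Longrightarrow> c *\<^sub>C a \<in> A\<delta>"
proof -
  have "tensor_map t s \<pi> id (c *\<^sub>C X) = c *\<^sub>C tensor_map t s \<pi> id X" for X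
    by (rule min_tensor_eqI[OF G.tensor2, of "\<lambda>X. tensor_map t s \<pi> id (c *\<^sub>C X)" "\<lambda>X. c *\<^sub>C tensor_map t s \<pi> id X"])
      (auto intro: bounded_linear_compose[OF restriction_comult_map(1) bounded_linear_scaleC]
        bounded_linear_compose[OF bounded_linear_scaleC restriction_comult_map(1)]
        simp: min_tensorD(3)[OF G.tensor2, symmetric] restriction_comult_map(2)
          unital_star_homD[OF restriction_hom] min_tensorD[OF tensor_mixed])
  then show "a \<in> A\<delta> \<Longrightarrow> c *\<^sub>C a \<in> A\<delta>"
    by (simp add: quotient_space_def unital_star_homD[OF G.comult_hom] min_tensorD[OF tensor_mixed])
qed

lemma quotient_space_sum: "(\<And>i. i < n \<Longrightarrow> f i \<in> A\<delta>) \<Longrightarrow> (\<Sum>i<(n::nat). f i) \<in> A\<delta>"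
proof (induction n)
  case 0
  show ?case
    by (simp add: quotient_space_def unital_star_homD[OF G.comult_hom] min_tensorD[OF tensor_mixed]
        linear_0[OF bounded_linear.linear[OF restriction_comult_map(1)]])
qed (simp add: quotient_space_add)

text \<open>The fixed vector equivalence for the unitary matrix with entries \<pi> (u $$ (i, j)).
  Invariance of \<psi> thus becomes a condition on the elements \<open>T_coeff u \<psi> k\<close>,
  which can be compared with membership in A\<delta>.\<close>

lemma restriction_T_coeff:
  assumes u: "unitary_rep t \<Delta> u" and \<psi>: "\<psi> \<in> carrier_vec (dim_row u)"
  shows "\<psi> \<in> invariant_vectors \<pi> u \<longleftrightarrow> (\<forall>k<dim_row u. \<pi> (T_coeff u \<psi> k) = of_cplx (cnj (\<psi> $ k)))"
  using \<psi> unitary_coeffs_fixed_vector[OF unitary_coeffs_hom[OF unitary_rep_coeffs(1)[OF u] restriction_hom],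
      of "\<lambda>i. \<psi> $ i"]
  by (simp add: invariant_vectors_iff[OF unitary_rep_coeffs(3)[OF u] restriction_hom] T_coeff_def
      unital_star_homD[OF restriction_hom])

lemma T_map_in_spectral_space:
  assumes u: "unitary_rep t \<Delta> u" and \<psi>: "\<psi> \<in> invariant_vectors \<pi> u"
  shows "T_map u \<psi> \<in> spectral_space t A\<delta> \<Delta> u"
proof -
  let ?n = "dim_row u"
  have dc: "dim_col u = ?n" and \<psi>c: "\<psi> \<in> carrier_vec ?n"
    using unitary_rep_coeffs(3)[OF u] \<psi> by (auto simp: invariant_vectors_def)
  note T = T_map_eq[OF dc]
  note comult = comult_T_coeff[OF G.comult_hom G.tensor2 u]
  \<comment> \<open>After \<pi> \<otimes> id the first legs of \<Delta> are scalars; moved to the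
    second leg they rebuild the coefficient itself.\<close>
  have coeff: "T_coeff u \<psi> j \<in> A\<delta>" if j: "j < ?n" for j
  proof -
    have "tensor_map t s \<pi> id (\<Delta> (T_coeff u \<psi> j)) = (\<Sum>k<?n. s (of_cplx (cnj (\<psi> $ k))) (u $$ (k, j)))"
      using \<psi> restriction_T_coeff[OF u \<psi>c]
      by (simp add: comult[OF j] restriction_comult_sum)
    also have "\<dots> = s 1 (T_coeff u \<psi> j)"
      by (simp add: T_coeff_def min_tensorD[OF tensor_mixed])
    finally show ?thesis by (simp add: quotient_space_def)
  qed
  have mem: "T_map u \<psi> \<phi> \<in> A\<delta>" if "\<phi> \<in> carrier_vec ?n" for \<phi>
    unfolding T[OF that] by (intro quotient_space_sum quotient_space_scale coeff)
  have ext: "T_map u \<psi> \<in> extensional (carrier_vec ?n)" by (simp add: T_map_def)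
  have comm: "\<Delta> (T_map u \<psi> \<phi>) = tensor_id t (T_map u \<psi>) (rep_apply u \<phi>)" if \<phi>: "\<phi> \<in> carrier_vec ?n" for \<phi>
  proof -
    have "\<Delta> (T_map u \<psi> \<phi>) = (\<Sum>j<?n. \<Sum>k<?n. (\<phi> $ j) *\<^sub>C t (T_coeff u \<psi> k) (u $$ (k, j)))"
      by (simp add: T[OF \<phi>] unital_star_homD[OF G.comult_hom] comult scaleC_sum_right)
    also have "\<dots> = (\<Sum>k<?n. t (T_coeff u \<psi> k) (\<Sum>j<?n. (\<phi> $ j) *\<^sub>C (u $$ (k, j))))"
      unfolding min_tensorD(4,15)[OF G.tensor2] by (rule sum.swap)
    also have "\<dots> = tensor_id t (T_map u \<psi>) (rep_apply u \<phi>)"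
      by (simp add: tensor_id_def T_map_unit_vec[OF dc] rep_apply_index[OF dc \<phi>])
    finally show ?thesis .
  qed
  show ?thesis
    unfolding spectral_space_def
    using mem ext comm
    by (auto simp: PiE_def T scaleC_add_left sum.distrib scaleC_sum_right scaleC_scaleC)
qed

lemma T_map_surj:
  assumes u: "unitary_rep t \<Delta> u" and T: "T \<in> spectral_space t A\<delta> \<Delta> u"
  shows "\<exists>\<psi>\<in>invariant_vectors \<pi> u. T_map u \<psi> = T"
proof -
  let ?n = "dim_row u"
  have dc: "dim_col u = ?n" by (rule unitary_rep_coeffs(3)[OF u])
  note U = unitary_rep_coeffs(1)[OF u]
  define a where "a j = T (unit_vec ?n j)" for j
  have aA: "a j \<in> A\<delta>" if "j < ?n" for j
    using T that by (auto simp: spectral_space_def PiE_def a_def)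
  have T_ext: "T \<in> extensional (carrier_vec ?n)" using T by (auto simp: spectral_space_def PiE_def)
  have T_sum: "T \<phi> = (\<Sum>j<?n. (\<phi> $ j) *\<^sub>C a j)" if "\<phi> \<in> carrier_vec ?n" for \<phi>
    unfolding a_def
    by (rule linear_on_carrier_vec_expansion) (use T that in \<open>auto simp: spectral_space_def\<close>)
  have \<Delta>a: "\<Delta> (a j) = (\<Sum>k<?n. t (a k) (u $$ (k, j)))" if j: "j < ?n" for j
  proof -
    have "\<Delta> (a j) = tensor_id t T (rep_apply u (unit_vec ?n j))"
      using T by (simp add: spectral_space_def a_def)
    moreover have "rep_apply u (unit_vec ?n j) $ k = u $$ (k, j)" if "k < ?n" for k
    proof -
      have "rep_apply u (unit_vec ?n j) $ k = (\<Sum>i<?n. (if i = j then 1 else 0) *\<^sub>C u $$ (k, i))"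
        using that j by (subst rep_apply_index[OF dc]) auto
      then show ?thesis using j by (simp add: if_distrib[of "\<lambda>c. c *\<^sub>C _"] cong: if_cong)
    qed
    ultimately show ?thesis by (simp add: tensor_id_def a_def)
  qed
  define b where "b k = (\<Sum>j<?n. a j * star (u $$ (k, j)))" for k
  have "\<exists>c. b k = of_cplx c" if k: "k < ?n" for k
  proof (rule G.comult_right_invariant_scalar)
    \<comment> \<open>In the product the second legs are u $$ (i, j) times the star of u $$ (l, j).
      Summed over j they give 1 for i = l and 0 otherwise, which removes the second leg.\<close>
    have "\<Delta> (b k) = (\<Sum>j<?n. (\<Sum>i<?n. t (a i) (u $$ (i, j))) * (\<Sum>l<?n. t (star (u $$ (k, l))) (star (u $$ (l, j)))))"
      using k by (simp add: b_def unital_star_homD[OF G.comult_hom] \<Delta>a unitary_rep_coeffs(2)[OF u]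
          star_sum min_tensorD[OF G.tensor2])
    also have "\<dots> = (\<Sum>j<?n. \<Sum>i<?n. \<Sum>l<?n. t (a i * star (u $$ (k, l))) (u $$ (i, j) * star (u $$ (l, j))))"
      by (simp add: sum_product min_tensorD[OF G.tensor2])
    also have "\<dots> = (\<Sum>i<?n. \<Sum>j<?n. \<Sum>l<?n. t (a i * star (u $$ (k, l))) (u $$ (i, j) * star (u $$ (l, j))))"
      by (rule sum.swap)
    also have "\<dots> = (\<Sum>i<?n. \<Sum>l<?n. t (a i * star (u $$ (k, l))) (\<Sum>j<?n. u $$ (i, j) * star (u $$ (l, j))))"
      unfolding min_tensorD(15)[OF G.tensor2] by (intro sum.cong refl sum.swap)
    also have "\<dots> = (\<Sum>i<?n. t (a i * star (u $$ (k, i))) 1)"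
      by (intro sum.cong refl)
        (simp add: unitary_coeffsD(2)[OF U] if_distrib[of "t _"] min_tensorD(9)[OF G.tensor2] cong: if_cong)
    also have "\<dots> = t (b k) 1" by (simp add: b_def min_tensorD[OF G.tensor2])
    finally show "\<Delta> (b k) = t (b k) 1" .
  qed
  then obtain c where c: "\<And>k. k < ?n \<Longrightarrow> b k = of_cplx (c k)" by metis
  \<comment> \<open>The conjugation compensates the antilinearity of \<open>T_coeff\<close> in
    \<psi>.\<close>
  define \<psi> where "\<psi> = vec ?n (\<lambda>k. cnj (c k))"
  have \<psi>: "\<psi> \<in> carrier_vec ?n" "\<And>k. k < ?n \<Longrightarrow> \<psi> $ k = cnj (c k)" by (auto simp: \<psi>_def)
  have a: "T_coeff u \<psi> j = a j" if j: "j < ?n" for j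
  proof -
    have "T_coeff u \<psi> j = (\<Sum>k<?n. b k * u $$ (k, j))"
      by (simp add: T_coeff_def \<psi> c scaleC_mult_left)
    also have "\<dots> = (\<Sum>k<?n. \<Sum>i<?n. a i * (star (u $$ (k, i)) * u $$ (k, j)))"
      by (simp add: b_def sum_distrib_right mult.assoc)
    also have "\<dots> = (\<Sum>i<?n. a i * (\<Sum>k<?n. star (u $$ (k, i)) * u $$ (k, j)))"
      unfolding sum_distrib_left by (rule sum.swap)
    also have "\<dots> = a j" using j by (simp add: unitary_coeffsD(1)[OF U] sum_mult_delta)
    finally show ?thesis .
  qed
  have "\<pi> (a l) = of_cplx (c l)" if l: "l < ?n" for l
  proof -
    define d where "d k = \<pi> (a k) - of_cplx (c k)" for k
    have d: "(\<Sum>k<?n. s (d k) (u $$ (k, j))) = 0" if j: "j < ?n" for j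
    proof -
      have "(\<Sum>k<?n. s (\<pi> (a k)) (u $$ (k, j))) = s 1 (a j)"
        using aA[OF j] by (simp add: quotient_space_def \<Delta>a[OF j] restriction_comult_sum)
      also have "\<dots> = (\<Sum>k<?n. s (of_cplx (c k)) (u $$ (k, j)))"
        unfolding a[OF j, symmetric] by (simp add: T_coeff_def \<psi> min_tensorD[OF tensor_mixed])
      finally show ?thesis
        by (simp add: d_def min_tensorD(12)[OF tensor_mixed] sum_subtractf)
    qed
    \<comment> \<open>Multiplying by 1 \<otimes> star (u $$ (l, j)) and summing over j inverts u in
      the second leg and isolates d l.\<close>
    have "0 = (\<Sum>j<?n. (\<Sum>k<?n. s (d k) (u $$ (k, j))) * s 1 (star (u $$ (l, j))))"
      by (simp add: d)
    also have "\<dots> = (\<Sum>j<?n. \<Sum>k<?n. s (d k) (u $$ (k, j) * star (u $$ (l, j))))"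
      by (simp add: sum_distrib_right min_tensorD[OF tensor_mixed])
    also have "\<dots> = (\<Sum>k<?n. s (d k) (\<Sum>j<?n. u $$ (k, j) * star (u $$ (l, j))))"
      unfolding min_tensorD(15)[OF tensor_mixed] by (rule sum.swap)
    also have "\<dots> = s (d l) 1"
      using l by (simp add: unitary_coeffsD(2)[OF U] if_distrib[of "s _"] min_tensorD(9)[OF tensor_mixed] cong: if_cong)
    finally have "d l = 0" using min_tensor_left_cancel[OF tensor_mixed, of "d l"] by simp
    then show ?thesis by (simp add: d_def)
  qed
  then have "\<psi> \<in> invariant_vectors \<pi> u"
    using restriction_T_coeff[OF u \<psi>(1)] by (simp add: a \<psi>)
  moreover have "T_map u \<psi> = T"
  proof (rule extensionalityI[OF _ T_ext])
    show "T_map u \<psi> \<in> extensional (carrier_vec ?n)" by (simp add: T_map_def)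
  qed (simp add: T_map_eq[OF dc] a T_sum)
  ultimately show ?thesis by blast
qed

section \<open>Linearity, naturality, compatibility with tensor products, unitarity\<close>

lemma T_map_linear:
  assumes u: "unitary_rep t \<Delta> u"
  shows "linear_h (obj_f (invariant_functor \<pi>) u) (obj_f (spectral_functor t A\<delta> \<Delta>) u) (T_map u)"
proof -
  have dc: "dim_col u = dim_row u" by (rule unitary_rep_coeffs(3)[OF u])
  have car: "\<psi> \<in> carrier_vec (dim_row u)" if "\<psi> \<in> invariant_vectors \<pi> u" for \<psi>
    using that by (simp add: invariant_vectors_def)
  have add: "T_map u (\<psi> + \<psi>') = (\<lambda>\<phi>\<in>carrier_vec (dim_row u). T_map u \<psi> \<phi> + T_map u \<psi>' \<phi>)"
    if "\<psi> \<in> carrier_vec (dim_row u)" "\<psi>' \<in> carrier_vec (dim_row u)" for \<psi> \<psi>'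
  proof (rule extensionalityI[where A = "carrier_vec (dim_row u)"])
    show "T_map u (\<psi> + \<psi>') \<in> extensional (carrier_vec (dim_row u))" by (simp add: T_map_def)
  qed (simp_all add: T_map_eq[OF dc] T_coeff_add[OF that] scaleC_add_right sum.distrib)
  have scale: "T_map u (c \<cdot>\<^sub>v \<psi>) = (\<lambda>\<phi>\<in>carrier_vec (dim_row u). cnj c *\<^sub>C T_map u \<psi> \<phi>)"
    if "\<psi> \<in> carrier_vec (dim_row u)" for c \<psi>
  proof (rule extensionalityI[where A = "carrier_vec (dim_row u)"])
    show "T_map u (c \<cdot>\<^sub>v \<psi>) \<in> extensional (carrier_vec (dim_row u))" by (simp add: T_map_def)
  qed (simp_all add: T_map_eq[OF dc] T_coeff_scale[OF that] scaleC_sum_right scaleC_scaleC mult.commute)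
  show ?thesis
    using T_map_in_spectral_space[OF u] add scale car
    by (simp add: linear_h_def invariant_functor_def spectral_functor_def conj_spectral_hilb_def Let_def)
qed

text \<open>The entries of A come out conjugated because \<open>T_map\<close> is antilinear in its
  vector. \<open>arrow_adjoint_coeffs\<close> moves the adjoint of A from the side of v to that of
  u, where it acts on the argument \<phi>.\<close>

lemma T_map_natural:
  assumes u: "unitary_rep t \<Delta> u" and v: "unitary_rep t \<Delta> v" and A: "A \<in> arrows u v"
    and x: "x \<in> carrier_vec (dim_row u)"
  shows "T_map v (A *\<^sub>v x) = (\<lambda>\<phi>\<in>carrier_vec (dim_row v). T_map u x (mat_adjoint A *\<^sub>v \<phi>))"
proof (rule extensionalityI[where A = "carrier_vec (dim_row v)"])
  let ?n = "dim_row u" and ?m = "dim_row v"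
  note dc = unitary_rep_coeffs(3)[OF u] unitary_rep_coeffs(3)[OF v]
  have Ac: "A \<in> carrier_mat ?m ?n" using A by (simp add: arrows_def)
  show "T_map v (A *\<^sub>v x) \<in> extensional (carrier_vec ?m)" by (simp add: T_map_def)
  fix \<phi> :: "complex vec" assume \<phi>: "\<phi> \<in> carrier_vec ?m"
  have A\<phi>: "mat_adjoint A *\<^sub>v \<phi> \<in> carrier_vec ?n"
    using Ac by (intro carrier_vecI) (simp add: mat_adjoint_def)
  have coeff: "T_coeff v (A *\<^sub>v x) l = (\<Sum>j<?n. cnj (A $$ (l, j)) *\<^sub>C T_coeff u x j)" if l: "l < ?m" for l
  proof -
    have "T_coeff v (A *\<^sub>v x) l = (\<Sum>i<?m. \<Sum>k<?n. cnj (x $ k) *\<^sub>C cnj (A $$ (i, k)) *\<^sub>C (v $$ (i, l)))"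
      using Ac x
      by (simp add: T_coeff_def scalar_prod_def atLeast0LessThan scaleC_sum_left scaleC_scaleC mult.commute)
    also have "\<dots> = (\<Sum>k<?n. cnj (x $ k) *\<^sub>C (\<Sum>i<?m. cnj (A $$ (i, k)) *\<^sub>C (v $$ (i, l))))"
      unfolding scaleC_sum_right by (rule sum.swap)
    also have "\<dots> = (\<Sum>k<?n. \<Sum>j<?n. cnj (A $$ (l, j)) *\<^sub>C cnj (x $ k) *\<^sub>C (u $$ (k, j)))"
      by (intro sum.cong refl)
        (simp add: arrow_adjoint_coeffs[OF u v A _ l] scaleC_sum_right scaleC_scaleC mult.commute)
    also have "\<dots> = (\<Sum>j<?n. cnj (A $$ (l, j)) *\<^sub>C T_coeff u x j)"
      unfolding T_coeff_def scaleC_sum_right by (rule sum.swap)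
    finally show ?thesis .
  qed
  have "T_map v (A *\<^sub>v x) \<phi> = (\<Sum>l<?m. \<Sum>j<?n. (\<phi> $ l) *\<^sub>C cnj (A $$ (l, j)) *\<^sub>C T_coeff u x j)"
    by (simp add: T_map_eq[OF dc(2) \<phi>] coeff scaleC_sum_right)
  also have "\<dots> = (\<Sum>j<?n. \<Sum>l<?m. (\<phi> $ l) *\<^sub>C cnj (A $$ (l, j)) *\<^sub>C T_coeff u x j)"
    by (rule sum.swap)
  also have "\<dots> = (\<Sum>j<?n. ((mat_adjoint A *\<^sub>v \<phi>) $ j) *\<^sub>C T_coeff u x j)"
    by (intro sum.cong refl)
      (simp add: mat_adjoint_mult_vec_index[OF Ac \<phi>] scaleC_sum_left scaleC_scaleC mult.commute
        del: index_mult_mat_vec)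
  also have "\<dots> = T_map u x (mat_adjoint A *\<^sub>v \<phi>)" by (simp only: T_map_eq[OF dc(1) A\<phi>])
  finally show "T_map v (A *\<^sub>v x) \<phi> = (\<lambda>\<phi>\<in>carrier_vec ?m. T_map u x (mat_adjoint A *\<^sub>v \<phi>)) \<phi>"
    using \<phi> by simp
qed simp

lemma T_map_tensor:
  assumes u: "unitary_rep t \<Delta> u" and v: "unitary_rep t \<Delta> v"
    and x: "x \<in> carrier_vec (dim_row u)" and y: "y \<in> carrier_vec (dim_row v)"
  shows "T_map (rep_tensor u v) (vec_tensor x y) = map_tensor (dim_row u) (dim_row v) (T_map u x) (T_map v y)"
proof (rule extensionalityI[where A = "carrier_vec (dim_row u * dim_row v)"])
  have dr: "dim_row (rep_tensor u v) = dim_row u * dim_row v"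
    and dc: "dim_col (rep_tensor u v) = dim_row (rep_tensor u v)"
    by (simp_all add: rep_tensor_def Let_def)
  show "T_map (rep_tensor u v) (vec_tensor x y) \<in> extensional (carrier_vec (dim_row u * dim_row v))"
    by (simp add: T_map_def dr)
  show "map_tensor (dim_row u) (dim_row v) (T_map u x) (T_map v y)
      \<in> extensional (carrier_vec (dim_row u * dim_row v))"
    by (simp add: map_tensor_def)
  fix \<zeta> :: "complex vec" assume \<zeta>: "\<zeta> \<in> carrier_vec (dim_row u * dim_row v)"
  show "T_map (rep_tensor u v) (vec_tensor x y) \<zeta> =
      map_tensor (dim_row u) (dim_row v) (T_map u x) (T_map v y) \<zeta>"
    using \<zeta> T_map_unit_vec[OF unitary_rep_coeffs(3)[OF u]] T_map_unit_vec[OF unitary_rep_coeffs(3)[OF v]]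
    by (simp add: T_map_eq[OF dc, unfolded dr] map_tensor_def sum_lessThan_times T_coeff_tensor[OF x y])
qed

text \<open>Both sides carry cnj c: on the left from antilinearity in the vector, on the right from
  the scalar action on a conjugate space.\<close>

lemma T_map_trivial:
  "T_map trivial_rep (c \<cdot>\<^sub>v unit_vec 1 0) = (\<lambda>\<phi>\<in>carrier_vec 1. cnj c *\<^sub>C (\<lambda>\<phi>\<in>carrier_vec 1. of_cplx (\<phi> $ 0)) \<phi>)"
proof (rule extensionalityI[where A = "carrier_vec 1"])
  show "T_map trivial_rep (c \<cdot>\<^sub>v unit_vec 1 0) \<in> extensional (carrier_vec 1)"
    by (simp add: T_map_def trivial_rep_def)
  fix \<phi> :: "complex vec" assume "\<phi> \<in> carrier_vec 1"
  then show "T_map trivial_rep (c \<cdot>\<^sub>v unit_vec 1 0) \<phi> =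
      (\<lambda>\<phi>\<in>carrier_vec 1. cnj c *\<^sub>C (\<lambda>\<phi>\<in>carrier_vec 1. of_cplx (\<phi> $ 0)) \<phi>) \<phi>"
    by (subst T_map_eq) (simp_all add: trivial_rep_def T_coeff_def scaleC_scaleC mult.commute)
qed simp

text \<open>Summation over j meets u u^* = 1 and leaves the diagonal. It also shows that the scalar
  described in \<open>inner_h\<close> exists for elements of the range.\<close>

lemma T_map_inner:
  assumes u: "unitary_rep t \<Delta> u"
    and x: "x \<in> carrier_vec (dim_row u)" and y: "y \<in> carrier_vec (dim_row u)"
  shows "(\<Sum>j<dim_row u. T_map u x (unit_vec (dim_row u) j) * star (T_map u y (unit_vec (dim_row u) j)))
    = of_cplx (y \<bullet>c x)"
proof -
  let ?n = "dim_row u"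
  have dc: "dim_col u = ?n" by (rule unitary_rep_coeffs(3)[OF u])
  note U = unitary_rep_coeffs(1)[OF u]
  have "(\<Sum>j<?n. T_map u x (unit_vec ?n j) * star (T_map u y (unit_vec ?n j))) =
      (\<Sum>j<?n. \<Sum>i<?n. \<Sum>k<?n. (cnj (x $ i) * y $ k) *\<^sub>C (u $$ (i, j) * star (u $$ (k, j))))"
    by (simp add: T_map_unit_vec[OF dc] T_coeff_def star_sum star_scaleC sum_product
        scaleC_mult_left scaleC_mult_right scaleC_scaleC mult.commute)
  also have "\<dots> = (\<Sum>i<?n. \<Sum>j<?n. \<Sum>k<?n. (cnj (x $ i) * y $ k) *\<^sub>C (u $$ (i, j) * star (u $$ (k, j))))"
    by (rule sum.swap)
  also have "\<dots> = (\<Sum>i<?n. \<Sum>k<?n. (cnj (x $ i) * y $ k) *\<^sub>C (\<Sum>j<?n. u $$ (i, j) * star (u $$ (k, j))))"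
    unfolding scaleC_sum_right by (intro sum.cong refl sum.swap)
  also have "\<dots> = (\<Sum>i<?n. of_cplx (cnj (x $ i) * y $ i))"
    by (intro sum.cong refl)
      (simp add: unitary_coeffsD(2)[OF U] if_distrib[of "\<lambda>x. _ *\<^sub>C x"] cong: if_cong)
  also have "\<dots> = of_cplx (y \<bullet>c x)"
    using x y by (simp add: scaleC_sum_left[symmetric] scalar_prod_def atLeast0LessThan mult.commute)
  finally show ?thesis .
qed

text \<open>Equal images have equal inner products with every z of the ambient space; the basis
  vectors read off the coordinates.\<close>

lemma T_map_inj:
  assumes u: "unitary_rep t \<Delta> u"
    and x: "x \<in> carrier_vec (dim_row u)" and y: "y \<in> carrier_vec (dim_row u)"
    and eq: "T_map u x = T_map u y"
  shows "x = y"
proof -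
  have "(of_cplx (z \<bullet>c x) :: 'a) = of_cplx (z \<bullet>c y)" if "z \<in> carrier_vec (dim_row u)" for z
    unfolding T_map_inner[OF u x that, symmetric] T_map_inner[OF u y that, symmetric] eq ..
  then have *: "z \<bullet>c x = z \<bullet>c y" if "z \<in> carrier_vec (dim_row u)" for z
    using that of_cplx_eq_iff by blast
  show ?thesis
  proof (rule eq_vecI)
    fix i assume "i < dim_vec y"
    then have i: "i < dim_row u" using y by simp
    have "unit_vec (dim_row u) i \<bullet>c x = cnj (x $ i)" "unit_vec (dim_row u) i \<bullet>c y = cnj (y $ i)"
      using i x y by (auto simp: scalar_prod_left_unit)
    then show "x $ i = y $ i" using *[of "unit_vec (dim_row u) i"] by simp
  qed (use x y in auto)
qed

lemma T_map_unitary: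
  assumes u: "unitary_rep t \<Delta> u"
  shows "unitary_h (obj_f (invariant_functor \<pi>) u) (obj_f (spectral_functor t A\<delta> \<Delta>) u) (T_map u)"
proof -
  have car: "\<psi> \<in> carrier_vec (dim_row u)" if "\<psi> \<in> invariant_vectors \<pi> u" for \<psi>
    using that by (simp add: invariant_vectors_def)
  have "bij_betw (T_map u) (invariant_vectors \<pi> u) (spectral_space t A\<delta> \<Delta> u)"
    unfolding bij_betw_def
  proof
    show "inj_on (T_map u) (invariant_vectors \<pi> u)"
      by (rule inj_onI) (use T_map_inj[OF u] car in blast)
    show "T_map u ` invariant_vectors \<pi> u = spectral_space t A\<delta> \<Delta> u"
      using T_map_in_spectral_space[OF u] T_map_surj[OF u] by blast
  qed
  moreover have "(THE c. of_cplx c = (\<Sum>j<dim_row u. T_map u x (unit_vec (dim_row u) j)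
      * star (T_map u y (unit_vec (dim_row u) j)))) = y \<bullet>c x"
    if "x \<in> invariant_vectors \<pi> u" "y \<in> invariant_vectors \<pi> u" for x y
    unfolding T_map_inner[OF u car[OF that(1)] car[OF that(2)]] of_cplx_eq_iff by simp
  ultimately show ?thesis
    using T_map_linear[OF u]
    by (simp add: unitary_h_def invariant_functor_def spectral_functor_def conj_spectral_hilb_def Let_def)
qed

lemma T_map_quasitensor:
  "quasitensor_nat_trans t \<Delta> (invariant_functor \<pi>) (spectral_functor t A\<delta> \<Delta>) T_map"
  unfolding quasitensor_nat_trans_def
proof (intro conjI allI impI ballI)
  show "linear_h (obj_f (invariant_functor \<pi>) u) (obj_f (spectral_functor t A\<delta> \<Delta>) u) (T_map u)"
    if "unitary_rep t \<Delta> u" for u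
    by (rule T_map_linear[OF that])
  show "T_map v (arr_f (invariant_functor \<pi>) u v A x) = arr_f (spectral_functor t A\<delta> \<Delta>) u v A (T_map u x)"
    if "unitary_rep t \<Delta> u \<and> unitary_rep t \<Delta> v" "A \<in> arrows u v"
      "x \<in> carr (obj_f (invariant_functor \<pi>) u)" for u v A x
    using that T_map_natural[of u v A x]
    by (simp add: invariant_functor_def spectral_functor_def invariant_vectors_def)
  show "T_map trivial_rep (scale_h (obj_f (invariant_functor \<pi>) trivial_rep) c (one_f (invariant_functor \<pi>))) =
      scale_h (obj_f (spectral_functor t A\<delta> \<Delta>) trivial_rep) c (one_f (spectral_functor t A\<delta> \<Delta>))" for c
    using T_map_trivial[of c]
    by (simp add: invariant_functor_def spectral_functor_def conj_spectral_hilb_def Let_def trivial_rep_def)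
  show "T_map (rep_tensor u v) (tensor_f (invariant_functor \<pi>) u v x y) =
      tensor_f (spectral_functor t A\<delta> \<Delta>) u v (T_map u x) (T_map v y)"
    if "unitary_rep t \<Delta> u \<and> unitary_rep t \<Delta> v" "x \<in> carr (obj_f (invariant_functor \<pi>) u)"
      "y \<in> carr (obj_f (invariant_functor \<pi>) v)" for u v x y
    using that T_map_tensor[of u v x y]
    by (simp add: invariant_functor_def spectral_functor_def invariant_vectors_def)
qed

end

theorem theorem7p7:
  fixes t :: "'a::cstar_algebra \<Rightarrow> 'a \<Rightarrow> 'aa::cstar_algebra"
    and tl :: "'aa \<Rightarrow> 'a \<Rightarrow> 'aaa::cstar_algebra"
    and tr :: "'a \<Rightarrow> 'aa \<Rightarrow> 'aaa"
    and \<Delta> :: "'a \<Rightarrow> 'aa"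
    and t' :: "'b::cstar_algebra \<Rightarrow> 'b \<Rightarrow> 'bb::cstar_algebra"
    and tl' :: "'bb \<Rightarrow> 'b \<Rightarrow> 'bbb::cstar_algebra"
    and tr' :: "'b \<Rightarrow> 'bb \<Rightarrow> 'bbb"
    and \<Delta>' :: "'b \<Rightarrow> 'bb"
    and s :: "'b \<Rightarrow> 'a \<Rightarrow> 'ba::cstar_algebra"
    and \<pi> :: "'a \<Rightarrow> 'b"
  assumes "compact_quantum_subgroup t tl tr \<Delta> t' tl' tr' \<Delta>' s \<pi>"
  defines "A\<delta> \<equiv> quotient_space t s \<Delta> \<pi>"
  defines "K \<equiv> invariant_functor \<pi>"
    and "L \<equiv> spectral_functor t A\<delta> \<Delta>"
  shows "(\<forall>u. unitary_rep t \<Delta> u \<longrightarrow>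
            (\<forall>\<psi>\<in>invariant_vectors \<pi> u. T_map u \<psi> \<in> spectral_space t A\<delta> \<Delta> u)) \<and>
         quasitensor_nat_trans t \<Delta> K L T_map \<and>
         (\<forall>u. unitary_rep t \<Delta> u \<and> invariant_vectors \<pi> u \<noteq> {0\<^sub>v (dim_row u)} \<longrightarrow>
            unitary_h (obj_f K u) (obj_f L u) (T_map u))"
proof -
  interpret compact_quantum_subgroup t tl tr \<Delta> t' tl' tr' \<Delta>' s \<pi> by (rule assms(1))
  show ?thesis
    unfolding A\<delta>_def K_def L_def
    using T_map_in_spectral_space T_map_quasitensor T_map_unitary by blast
qed

end
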